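(* Let $\mathbf L=\{(n,k)\in\mathbb N^2: k\le n^2\}$, where $\mathbb N=\{1,2,\dots\}$. Every type in the set $$\{(n,k)\in\mathbf L:n\leq3\}\cup\{(n,k)\in\mathbf L:k\leq3\}\cup\{(n,k)\in\mathbf L:k\geq n^2-n\}$$ is nonexceptional, and every type in the set $$\{(n,k)\in\mathbf L:4\leq n,\ 4\leq k\leq(n-4)^2+5\}\cup\{(6,10)\}$$ is exceptional.
   Context: Let $n\ge 1$ and $1\le k\le n^2$. A collection $(H_1,\dots,H_k)$ of Hermitian $n\times n$ matrices is nondegenerate if the matrices are linearly independent and have no common kernel ($H_1z=\dots=H_kz=0$ implies $z=0$). It determines the nondegenerate CR-quadric of type $(n,k)$ $$Q=\{(z,w)\in\mathbb C^n\times\mathbb C^k:\ \operatorname{Im} w=\langle z,\bar z\rangle\},\qquad \langle z,\bar z\rangle=(H_1z\cdot\bar z,\dots,H_kz\cdot\bar z).$$ $\mathrm{aut}\,Q$ is the Lie algebra of the local group of holomorphic automorphisms of the germ of $Q$ at the origin: the real Lie algebra of vector fields $2\operatorname{Re}X$, with $X=\sum_\alpha f_\alpha\,\partial/\partial z_\alpha+\sum_j h_j\,\partial/\partial w_j$ holomorphic near the origin and $2\operatorname{Re}X$ tangent to $Q$. For a nondegenerate quadric it is finite-dimensional. It is graded by assigning weight $1$ to each $z_\alpha$, weight $2$ to each $w_j$, weight $-1$ to $\partial/\partial z_\alpha$ and weight $-2$ to $\partial/\partial w_j$; thus $\mathrm{aut}\,Q=g_{-2}+g_{-1}+g_0+\dots+g_l$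 with $g_l\neq 0$, where $g_j$ is the component of weight $j$. The (nondegenerate) quadric $Q$ is exceptional if $l\ge 3$. A type $(n,k)\in\mathbf L$ is exceptional if there exists an exceptional quadric of type $(n,k)$, and nonexceptional otherwise. *)

theory Defs
  imports "HOL-Analysis.Analysis"
begin

text \<open>
  A type \<open>(n, k)\<close> is represented by a pair of finite index types \<open>'n\<close>, \<open>'k\<close> with
  \<open>CARD('n) = n\<close> and \<open>CARD('k) = k\<close>; a collection \<open>(H\<^sub>1, \<dots>, H\<^sub>k)\<close> of matrices is a function on \<open>'k\<close>.
\<close>

definition type_set :: "(nat \<times> nat) set" where
  "type_set = {(n, k). 1 \<le> n \<and> 1 \<le> k \<and> k \<le> n\<^sup>2}"

definition hermitian_matrix :: "complex^'n^'n \<Rightarrow> bool" where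
  "hermitian_matrix A \<longleftrightarrow> (\<forall>\<alpha> \<beta>. A $ \<alpha> $ \<beta> = cnj (A $ \<beta> $ \<alpha>))"

definition nondegenerate :: "('k::finite \<Rightarrow> complex^'n^'n) \<Rightarrow> bool" where
  "nondegenerate H \<longleftrightarrow>
     (\<forall>j. hermitian_matrix (H j)) \<and>
     (\<forall>c :: 'k \<Rightarrow> real. (\<Sum>j\<in>UNIV. c j *\<^sub>R H j) = 0 \<longrightarrow> (\<forall>j. c j = 0)) \<and>
     (\<forall>z. (\<forall>j. H j *v z = 0) \<longrightarrow> z = 0)"

definition quadric_form :: "('k::finite \<Rightarrow> complex^'n^'n) \<Rightarrow> complex^'n \<Rightarrow> complex^'k" where
  "quadric_form H z = (\<chi> j. \<Sum>\<alpha>\<in>UNIV. (H j *v z) $ \<alpha> * cnj (z $ \<alpha>))"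

definition defining_fun ::
    "('k::finite \<Rightarrow> complex^'n^'n) \<Rightarrow> (complex^'n) \<times> (complex^'k) \<Rightarrow> complex^'k" where
  "defining_fun H = (\<lambda>(z, w). (\<chi> j. complex_of_real (Im (w $ j))) - quadric_form H z)"

definition quadric :: "('k::finite \<Rightarrow> complex^'n^'n) \<Rightarrow> ((complex^'n) \<times> (complex^'k)) set" where
  "quadric H = {(z, w). (\<chi> j. complex_of_real (Im (w $ j))) = quadric_form H z}"

text \<open>
  A vector field \<open>X = \<Sum>\<^sub>\<alpha> f\<^sub>\<alpha> \<partial>/\<partial>z\<^sub>\<alpha> + \<Sum>\<^sub>j h\<^sub>j \<partial>/\<partial>w\<^sub>j\<close> is represented by its coefficient
  map \<open>p \<mapsto> (f p, h p)\<close>. Holomorphy of maps in several variables means complex differentiability: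
  the real Frechet derivative exists and commutes with multiplication by \<open>\<i>\<close>.
\<close>

type_synonym ('n, 'k) vfield =
  "(complex^'n) \<times> (complex^'k) \<Rightarrow> (complex^'n) \<times> (complex^'k)"

definition cscale :: "complex \<Rightarrow> (complex^'n) \<times> (complex^'k) \<Rightarrow> (complex^'n) \<times> (complex^'k)" where
  "cscale c = (\<lambda>(z, w). (c *s z, c *s w))"

definition vholomorphic_on ::
    "('n::finite, 'k::finite) vfield \<Rightarrow> ((complex^'n) \<times> (complex^'k)) set \<Rightarrow> bool" where
  "vholomorphic_on X U \<longleftrightarrow>
     (\<forall>p\<in>U. \<exists>D. (X has_derivative D) (at p) \<and> (\<forall>v. D (cscale \<i> v) = cscale \<i> (D v)))"

text \<open>
  The real vector field \<open>2 Re X = X + \<bar>X\<close> acts on real functions \<open>\<rho>\<close> as the derivative of \<open>\<rho>\<close> in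
  the direction of the real vector underlying \<open>(f, h)\<close>, and the tangent space of the quadric at a
  point is the kernel of the differential of its defining function.
\<close>

definition tangent_on ::
    "('k::finite \<Rightarrow> complex^'n^'n) \<Rightarrow> ('n::finite, 'k) vfield \<Rightarrow>
     ((complex^'n) \<times> (complex^'k)) set \<Rightarrow> bool" where
  "tangent_on H X U \<longleftrightarrow>
     (\<forall>p \<in> quadric H \<inter> U. frechet_derivative (defining_fun H) (at p) (X p) = 0)"

lemma defining_fun_has_derivative:
  fixes H :: "'k::finite \<Rightarrow> complex^'n::finite^'n"
  shows "(defining_fun H has_derivative
     (\<lambda>p. \<chi> j. complex_of_real (Im (snd p $ j)) -
        (\<Sum>\<alpha>\<in>UNIV. (H j *v z) $ \<alpha> * cnj (fst p $ \<alpha>) + (H j *v fst p) $ \<alpha> * cnj (z $ \<alpha>)))) (at (z, w))"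
proof -
  have *: "defining_fun H = (\<lambda>p. \<chi> j. complex_of_real (Im (snd p $ j)) -
      (\<Sum>\<alpha>\<in>UNIV. (H j *v fst p) $ \<alpha> * cnj (fst p $ \<alpha>)))"
    by (auto simp: defining_fun_def quadric_form_def fun_eq_iff vec_eq_iff)
  have fstd: "((\<lambda>p :: (complex^'n) \<times> (complex^'k). fst p $ \<alpha>) has_derivative (\<lambda>p. fst p $ \<alpha>)) F" for \<alpha> F
    by (rule bounded_linear_imp_has_derivative)
       (rule bounded_linear_compose[OF bounded_linear_vec_nth bounded_linear_fst])
  have sndd: "((\<lambda>p :: (complex^'n) \<times> (complex^'k). snd p $ j) has_derivative (\<lambda>p. snd p $ j)) F" for j F
    by (rule bounded_linear_imp_has_derivative)
       (rule bounded_linear_compose[OF bounded_linear_vec_nth bounded_linear_snd])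
  have Hd: "((\<lambda>p :: (complex^'n) \<times> (complex^'k). (H j *v fst p) $ \<alpha>) has_derivative
      (\<lambda>p. (H j *v fst p) $ \<alpha>)) F" for j \<alpha> F
    by (simp add: matrix_vector_mult_def) (intro has_derivative_sum has_derivative_mult_right fstd)
  have vec: "((\<lambda>p. \<chi> j. g j p) has_derivative (\<lambda>p. \<chi> j. g' j p)) (at x)"
    if g: "\<And>j. (g j has_derivative g' j) (at x)"
    for g g' :: "'k \<Rightarrow> (complex^'n) \<times> (complex^'k) \<Rightarrow> complex" and x
  proof -
    have e: "(\<lambda>p. \<chi> j. f j p) = (\<lambda>p. \<Sum>j\<in>UNIV. axis j (f j p))"
      for f :: "'k \<Rightarrow> (complex^'n) \<times> (complex^'k) \<Rightarrow> complex"
      by (rule ext) (simp add: vec_eq_iff axis_def)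
    have "bounded_linear (axis j :: complex \<Rightarrow> complex^'k)" for j
      by (intro linear_conv_bounded_linear[THEN iffD1] linearI) (auto simp: axis_def vec_eq_iff)
    then show ?thesis
      unfolding e[of g] e[of g'] by (intro has_derivative_sum bounded_linear.has_derivative[OF _ g])
  qed
  have im: "((\<lambda>p :: (complex^'n) \<times> (complex^'k). complex_of_real (Im (snd p $ j))) has_derivative
      (\<lambda>p. complex_of_real (Im (snd p $ j)))) F" for j F
    by (rule bounded_linear.has_derivative[OF bounded_linear_of_real
          bounded_linear.has_derivative[OF bounded_linear_Im sndd]])
  have form: "((\<lambda>p :: (complex^'n) \<times> (complex^'k). (H j *v fst p) $ \<alpha> * cnj (fst p $ \<alpha>)) has_derivative
      (\<lambda>p. (H j *v z) $ \<alpha> * cnj (fst p $ \<alpha>) + (H j *v fst p) $ \<alpha> * cnj (z $ \<alpha>))) (at (z, w))" for j \<alpha>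
    using has_derivative_mult[OF Hd[of j \<alpha> "at (z, w)"]
      bounded_linear.has_derivative[OF bounded_linear_cnj fstd[of \<alpha>]]] by simp
  show ?thesis
    unfolding * by (intro vec has_derivative_diff has_derivative_sum im form)
qed

text \<open>
  Elements of \<open>aut_alg H\<close> represent germs at the origin: only their values near the origin matter.
\<close>

definition aut_alg :: "('k::finite \<Rightarrow> complex^'n^'n) \<Rightarrow> ('n::finite, 'k) vfield set" where
  "aut_alg H = {X. \<exists>U. open U \<and> 0 \<in> U \<and> vholomorphic_on X U \<and> tangent_on H X U}"

definition zero_germ :: "('n::finite, 'k::finite) vfield \<Rightarrow> bool" where
  "zero_germ X \<longleftrightarrow> (\<forall>\<^sub>F p in nhds 0. X p = 0)"

definition multi_indices :: "int \<Rightarrow> (('n::finite \<Rightarrow> nat) \<times> ('k::finite \<Rightarrow> nat)) set" where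
  "multi_indices m = {(a, b). int ((\<Sum>\<alpha>\<in>UNIV. a \<alpha>) + 2 * (\<Sum>j\<in>UNIV. b j)) = m}"

lemma finite_multi_indices:
  "finite (multi_indices m :: (('n::finite \<Rightarrow> nat) \<times> ('k::finite \<Rightarrow> nat)) set)"
proof -
  let ?A = "PiE (UNIV :: 'n set) (\<lambda>_. {..nat m})" and ?B = "PiE (UNIV :: 'k set) (\<lambda>_. {..nat m})"
  have "a \<alpha> \<le> nat m \<and> b j \<le> nat m" if "(a, b) \<in> multi_indices m"
    for a :: "'n \<Rightarrow> nat" and b :: "'k \<Rightarrow> nat" and \<alpha> j
    using that member_le_sum[of \<alpha> UNIV a] member_le_sum[of j UNIV b]
    unfolding multi_indices_def by (simp del: of_nat_sum) linarith
  then have "multi_indices m \<subseteq> ?A \<times> ?B"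
    by (auto simp: PiE_def Pi_def)
  then show ?thesis
    by (rule finite_subset) (intro finite_cartesian_product finite_PiE; simp)
qed

definition zw_monomial ::
    "('n::finite \<Rightarrow> nat) \<times> ('k::finite \<Rightarrow> nat) \<Rightarrow> (complex^'n) \<times> (complex^'k) \<Rightarrow> complex" where
  "zw_monomial = (\<lambda>(a, b) (z, w). (\<Prod>\<alpha>\<in>UNIV. z $ \<alpha> ^ a \<alpha>) * (\<Prod>j\<in>UNIV. w $ j ^ b j))"

definition fun_weight :: "((complex^'n::finite) \<times> (complex^'k::finite) \<Rightarrow> complex) \<Rightarrow> int \<Rightarrow> bool" where
  "fun_weight f m \<longleftrightarrow>
     (\<exists>c. \<forall>\<^sub>F p in nhds 0. f p = (\<Sum>ab\<in>multi_indices m. c ab * zw_monomial ab p))"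

text \<open>
  As \<open>\<partial>/\<partial>z\<^sub>\<alpha>\<close> has weight \<open>-1\<close> and \<open>\<partial>/\<partial>w\<^sub>j\<close> has weight \<open>-2\<close>, a field of weight \<open>d\<close> has coefficients
  \<open>f\<^sub>\<alpha>\<close> of weight \<open>d + 1\<close> and \<open>h\<^sub>j\<close> of weight \<open>d + 2\<close>; the only function of negative weight is 0.
\<close>

definition field_weight :: "('n::finite, 'k::finite) vfield \<Rightarrow> int \<Rightarrow> bool" where
  "field_weight X d \<longleftrightarrow>
     (\<forall>\<alpha>. fun_weight (\<lambda>p. fst (X p) $ \<alpha>) (d + 1)) \<and>
     (\<forall>j. fun_weight (\<lambda>p. snd (X p) $ j) (d + 2))"

definition graded_component ::
    "('k::finite \<Rightarrow> complex^'n^'n) \<Rightarrow> int \<Rightarrow> ('n::finite, 'k) vfield set" where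
  "graded_component H d = {X \<in> aut_alg H. field_weight X d}"

definition nonzero_component :: "('k::finite \<Rightarrow> complex^'n::finite^'n) \<Rightarrow> int \<Rightarrow> bool" where
  "nonzero_component H d \<longleftrightarrow> (\<exists>X\<in>graded_component H d. \<not> zero_germ X)"

text \<open>The index \<open>l\<close> of the last nonzero summand in \<open>aut Q = g\<^sub>-\<^sub>2 + \<dots> + g\<^sub>l\<close>.\<close>

definition is_top_weight :: "('k::finite \<Rightarrow> complex^'n::finite^'n) \<Rightarrow> int \<Rightarrow> bool" where
  "is_top_weight H l \<longleftrightarrow> nonzero_component H l \<and> (\<forall>d>l. \<not> nonzero_component H d)"

definition exceptional_quadric :: "('k::finite \<Rightarrow> complex^'n::finite^'n) \<Rightarrow> bool" where
  "exceptional_quadric H \<longleftrightarrow> nondegenerate H \<and> (\<exists>l. is_top_weight H l \<and> l \<ge> 3)"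

definition exceptional_type :: "'n::finite itself \<Rightarrow> 'k::finite itself \<Rightarrow> bool" where
  "exceptional_type _ _ \<longleftrightarrow> (\<exists>H :: 'k \<Rightarrow> complex^'n^'n. exceptional_quadric H)"

definition nonexceptional_type :: "'n::finite itself \<Rightarrow> 'k::finite itself \<Rightarrow> bool" where
  "nonexceptional_type N K \<longleftrightarrow> \<not> exceptional_type N K"

end

theory Submission
  imports Defs
begin

text \<open>
  Write \<open>B z \<zeta>\<close> for the Hermitian form with \<open>\<bar>z\<close> replaced by an independent variable \<open>\<zeta>\<close>. A polynomial
  field is tangent to the quadric iff its coefficients \<open>(f, h)\<close> and their conjugates \<open>(g, l)\<close> satisfy
  the complexified equation
  \<open>h(z, w) - l(\<zeta>, w - 2\<i> B z \<zeta>) = 2\<i> (B (f(z, w)) \<zeta> + B z (g(\<zeta>, w - 2\<i> B z \<zeta>)))\<close> for all \<open>z, \<zeta>, w\<close>.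
  Comparing coefficients in \<open>\<zeta>\<close>, the second derivative \<open>a\<close> of \<open>g(0, \<cdot>)\<close> at any point is a symmetric
  bilinear map with \<open>B z (a (B z \<zeta>) (B z \<eta>)) = 0\<close>, and \<open>B z (a y (B z \<zeta>))\<close> has the form \<open>B (F z y) \<zeta>\<close>.
  Translations in \<open>\<zeta>\<close> preserve the equation, so the same holds for \<open>g(\<pi>, \<cdot>)\<close>.

  Polarizing the first identity shows that \<open>g\<close> is at most quadratic in \<open>w\<close> along every direction
  \<open>B z \<zeta>\<close>; these span, so the weights of \<open>aut Q\<close> are bounded for every nondegenerate quadric. If \<open>a = 0\<close>,
  then \<open>g\<close> is affine in \<open>w\<close> and there is no component of weight \<open>\<ge> 3\<close>. Now \<open>a = 0\<close> if some \<open>B z\<close> is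
  injective, which is automatic for \<open>k \<ge> n\<^sup>2 - n\<close>, or if some \<open>B z\<close> is surjective. Otherwise
  \<open>n \<le> 3\<close> or \<open>k \<le> 3\<close> makes the rank of all \<open>B z\<close> at most two, which leaves only the quadric
  \<open>Im w = \<i> z \<times> \<bar>z\<close> of type \<open>(3, 3)\<close>, where \<open>a = 0\<close> as well.

  For the exceptional types, a field of weight 3 exists on every quadric one of whose forms is
  \<open>2 Re (z\<^sub>1 \<bar>z\<^sub>3 + z\<^sub>2 \<bar>z\<^sub>4) + \<Sum>\<^sub>j\<^sub>>\<^sub>4 \<bar>z\<^sub>j\<bar>\<^sup>2\<close>, while the others do not involve \<open>z\<^sub>3, z\<^sub>4\<close> and include
  \<open>\<bar>z\<^sub>1\<bar>\<^sup>2\<close> and the real and imaginary part of \<open>z\<^sub>1 \<bar>z\<^sub>2\<close>. Such quadrics exist for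
  \<open>4 \<le> k \<le> (n - 2)\<^sup>2 + 1\<close>.
\<close>

section \<open>The complexified Hermitian form\<close>

definition cv :: "complex^'n \<Rightarrow> complex^'n" where
  "cv x = (\<chi> i. cnj (x $ i))"

definition levi :: "('k::finite \<Rightarrow> complex^'n::finite^'n) \<Rightarrow> complex^'n \<Rightarrow> complex^'n \<Rightarrow> complex^'k" where
  "levi H z \<zeta> = (\<chi> j. \<Sum>\<alpha>\<in>UNIV. (H j *v z) $ \<alpha> * \<zeta> $ \<alpha>)"

text \<open>The pairing is bilinear, without conjugation, so that every complex linear functional
  has the form \<open>dot \<phi>\<close>.\<close>

definition dot :: "complex^'k::finite \<Rightarrow> complex^'k \<Rightarrow> complex" where
  "dot \<phi> w = (\<Sum>j\<in>UNIV. \<phi> $ j * w $ j)"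

lemma cv_cv [simp]: "cv (cv x) = x"
  by (simp add: cv_def vec_eq_iff)

lemma cv_simps [simp]: "cv 0 = 0" "cv (x + y) = cv x + cv y" "cv (x - y) = cv x - cv y"
  "cv (- x) = - cv x" "cv (c *s x) = cnj c *s cv x" "cv x $ i = cnj (x $ i)"
  by (simp_all add: cv_def vec_eq_iff)

lemma cv_eq_iff: "cv x = y \<longleftrightarrow> x = cv y"
  by (metis cv_cv)

lemma cv_eq_0_iff [simp]: "cv x = 0 \<longleftrightarrow> x = 0"
  by (simp add: cv_eq_iff)

lemma dot_simps [simp]: "dot \<phi> 0 = 0" "dot \<phi> (x + y) = dot \<phi> x + dot \<phi> y"
  "dot \<phi> (x - y) = dot \<phi> x - dot \<phi> y" "dot \<phi> (- x) = - dot \<phi> x" "dot \<phi> (c *s x) = c * dot \<phi> x"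
  by (simp_all add: dot_def sum.distrib sum_subtractf sum_negf sum_distrib_left algebra_simps)

lemma levi_simps [simp]:
  "levi H 0 \<zeta> = 0" "levi H z 0 = 0"
  "levi H (x + y) \<zeta> = levi H x \<zeta> + levi H y \<zeta>"
  "levi H (x - y) \<zeta> = levi H x \<zeta> - levi H y \<zeta>"
  "levi H (- x) \<zeta> = - levi H x \<zeta>"
  "levi H (c *s x) \<zeta> = c *s levi H x \<zeta>"
  "levi H z (\<zeta> + \<eta>) = levi H z \<zeta> + levi H z \<eta>"
  "levi H z (\<zeta> - \<eta>) = levi H z \<zeta> - levi H z \<eta>"
  "levi H z (- \<zeta>) = - levi H z \<zeta>"
  "levi H z (c *s \<zeta>) = c *s levi H z \<zeta>"
  by (simp_all add: levi_def vec_eq_iff matrix_vector_mult_def sum.distrib sum_subtractf sum_negf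
      sum_distrib_left sum_distrib_right algebra_simps)

lemma quadric_form_eq_levi: "quadric_form H z = levi H z (cv z)"
  by (simp add: quadric_form_def levi_def)

lemma levi_axis: "levi H z (axis \<alpha> 1) $ j = (H j *v z) $ \<alpha>"
proof -
  have "levi H z (axis \<alpha> 1) $ j = (\<Sum>\<beta>\<in>UNIV. if \<beta> = \<alpha> then (H j *v z) $ \<beta> else 0)"
    unfolding levi_def by (simp only: vec_lambda_beta, intro sum.cong) (auto simp: axis_def)
  then show ?thesis by simp
qed

lemma levi_axis_axis: "levi H (axis \<beta> 1) (axis \<alpha> 1) $ j = H j $ \<alpha> $ \<beta>"
proof -
  have "(H j *v axis \<beta> 1) $ \<alpha> = (\<Sum>\<gamma>\<in>UNIV. if \<gamma> = \<beta> then H j $ \<alpha> $ \<gamma> else 0)"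
    unfolding matrix_vector_mult_def by (simp only: vec_lambda_beta, intro sum.cong) (auto simp: axis_def)
  then show ?thesis by (simp add: levi_axis)
qed

text \<open>A basis of the span of \<open>S\<close> stays independent when \<open>w\<close> is
  added, so some linear map kills \<open>S\<close> and not \<open>w\<close>; one coordinate of it is
  the functional.\<close>

lemma exists_dot_separating:
  fixes w :: "complex^'k::finite"
  assumes "w \<notin> vec.span S"
  shows "\<exists>\<phi>. (\<forall>s\<in>S. dot \<phi> s = 0) \<and> dot \<phi> w = 1"
proof -
  obtain T where T: "T \<subseteq> S" "vec.independent T" "vec.span T = vec.span S"
    using vec.basis_exists[of "S"] by (metis vec.span_eq vec.span_mono subset_antisym vec.span_span)
  have ind: "vec.independent (insert w T)"
    using T assms vec.independent_insert by (metis vec.span_base)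
  obtain g where g: "Vector_Spaces.linear (*s) (*s) (g :: complex^'k \<Rightarrow> complex^'k)"
    and gx: "\<forall>x\<in>insert w T. g x = (if x = w then 1 else 0)"
    using vec.linear_independent_extend[OF ind, of "\<lambda>x. if x = w then 1 else 0"] by blast
  let ?i = "undefined :: 'k"
  define \<phi> where "\<phi> = (\<chi> j. g (axis j 1) $ ?i)"
  interpret g: Vector_Spaces.linear "(*s)" "(*s)" g by (rule g)
  have dot: "dot \<phi> x = g x $ ?i" for x
  proof -
    have "g x = g (\<Sum>j\<in>UNIV. x $ j *s axis j 1)" by (simp add: basis_expansion)
    also have "\<dots> = (\<Sum>j\<in>UNIV. x $ j *s g (axis j 1))" by (simp add: g.sum g.scale)
    finally show ?thesis by (simp add: dot_def \<phi>_def mult.commute)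
  qed
  have "g x = 0" if "x \<in> vec.span T" for x
  proof (rule g.eq_0_on_span[OF _ that])
    fix y assume "y \<in> T"
    moreover have "y \<noteq> w" using assms T \<open>y \<in> T\<close> by (metis vec.span_base)
    ultimately show "g y = 0" using gx by simp
  qed
  then have "\<forall>s\<in>S. dot \<phi> s = 0" using T(3) dot vec.span_base by fastforce
  moreover have "dot \<phi> w = 1" using gx dot by simp
  ultimately show ?thesis by blast
qed

lemma in_span1: "x \<in> vec.span {a} \<longleftrightarrow> (\<exists>c. x = c *s (a :: complex^'m))"
  using vec.span_breakdown_eq[of x a "{}"] by auto

lemma in_span2: "x \<in> vec.span {a, b} \<longleftrightarrow> (\<exists>c d. x = c *s a + d *s (b :: complex^'m))"
  using vec.span_breakdown_eq[of x a "{b}"] by (auto simp: in_span1 algebra_simps)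

lemma in_span3: "x \<in> vec.span {a, b, c} \<longleftrightarrow> (\<exists>p q r. x = p *s a + q *s b + r *s (c :: complex^'m))"
  using vec.span_breakdown_eq[of x a "{b, c}"]
  by (auto simp: in_span2 algebra_simps)

text \<open>Vanishing of all such determinants says that \<open>levi H x\<close> has rank at most two.\<close>

definition det3 :: "complex \<Rightarrow> complex \<Rightarrow> complex \<Rightarrow> complex \<Rightarrow> complex \<Rightarrow> complex \<Rightarrow> complex \<Rightarrow> complex \<Rightarrow> complex \<Rightarrow> complex" where
  "det3 a b c d e f g h i = a * (e * i - f * h) - b * (d * i - f * g) + c * (d * h - e * g)"

lemma det3_eq_0:
  assumes "x \<noteq> 0 \<or> y \<noteq> 0 \<or> z \<noteq> 0"
    and "x * a + y * d + z * g = 0" "x * b + y * e + z * h = 0" "x * c + y * f + z * i = 0"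
  shows "det3 a b c d e f g h i = 0"
proof -
  have "x * det3 a b c d e f g h i = 0" "y * det3 a b c d e f g h i = 0" "z * det3 a b c d e f g h i = 0"
    using assms(2-) unfolding det3_def by algebra+
  then show ?thesis using assms(1) by auto
qed

locale levi_form =
  fixes H :: "'k::finite \<Rightarrow> complex^'n::finite^'n"
  assumes nondeg: "nondegenerate H"
begin

abbreviation "B \<equiv> levi H"

lemma cv_B: "cv (B z \<zeta>) = B (cv \<zeta>) (cv z)"
proof -
  have h: "cnj (H j $ \<alpha> $ \<beta>) = H j $ \<beta> $ \<alpha>" for j \<alpha> \<beta>
    using nondeg unfolding nondegenerate_def hermitian_matrix_def by (metis complex_cnj_cnj)
  have "cv (B z \<zeta>) $ j = B (cv \<zeta>) (cv z) $ j" for j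
  proof -
    have "cv (B z \<zeta>) $ j = (\<Sum>\<alpha>\<in>UNIV. \<Sum>\<beta>\<in>UNIV. H j $ \<beta> $ \<alpha> * cnj (z $ \<beta>) * cnj (\<zeta> $ \<alpha>))"
      by (simp add: levi_def matrix_vector_mult_def h sum_distrib_right)
    also have "\<dots> = (\<Sum>\<beta>\<in>UNIV. \<Sum>\<alpha>\<in>UNIV. H j $ \<beta> $ \<alpha> * cnj (z $ \<beta>) * cnj (\<zeta> $ \<alpha>))"
      by (rule sum.swap)
    also have "\<dots> = B (cv \<zeta>) (cv z) $ j"
      by (simp add: levi_def matrix_vector_mult_def sum_distrib_right sum_distrib_left algebra_simps)
    finally show ?thesis .
  qed
  then show ?thesis by (simp add: vec_eq_iff)
qed

lemma left_nondeg: assumes "\<And>\<zeta>. B z \<zeta> = 0" shows "z = 0"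
proof -
  have "(H j *v z) $ \<alpha> = 0" for j \<alpha>
    using assms[of "axis \<alpha> 1"] levi_axis[of H z \<alpha> j] by simp
  then have "\<forall>j. H j *v z = 0" by (simp add: vec_eq_iff)
  then show ?thesis using nondeg by (simp add: nondegenerate_def)
qed

text \<open>Conjugation exchanges the two arguments of \<open>B\<close>, which reduces this to
  \<open>left_nondeg\<close>.\<close>

lemma right_nondeg: assumes "\<And>z. B z \<zeta> = 0" shows "\<zeta> = 0"
proof -
  have "B (cv \<zeta>) x = 0" for x
    using cv_B[of "cv x" \<zeta>] assms[of "cv x"] by simp
  then have "cv \<zeta> = 0" by (rule left_nondeg)
  then show ?thesis by simp
qed

text \<open>Real independence of Hermitian matrices gives complex independence, by separating the
  Hermitian from the anti-Hermitian part.\<close>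

lemma dot_levi_nondeg: assumes "\<And>z \<zeta>. dot \<phi> (B z \<zeta>) = 0" shows "\<phi> = 0"
proof -
  have h: "cnj (H j $ \<alpha> $ \<beta>) = H j $ \<beta> $ \<alpha>" for j \<alpha> \<beta>
    using nondeg unfolding nondegenerate_def hermitian_matrix_def by (metis complex_cnj_cnj)
  have s: "(\<Sum>j\<in>UNIV. \<phi> $ j * H j $ \<alpha> $ \<beta>) = 0" for \<alpha> \<beta>
    using assms[of "axis \<beta> 1" "axis \<alpha> 1"] by (simp add: dot_def levi_axis_axis)
  have s': "(\<Sum>j\<in>UNIV. cnj (\<phi> $ j) * H j $ \<alpha> $ \<beta>) = 0" for \<alpha> \<beta>
    using arg_cong[OF s[of \<beta> \<alpha>], of cnj] by (simp add: h)
  have re: "(\<Sum>j\<in>UNIV. complex_of_real (Re (\<phi> $ j)) * H j $ \<alpha> $ \<beta>) = 0" for \<alpha> \<beta>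
  proof -
    have "(\<Sum>j\<in>UNIV. (\<phi> $ j + cnj (\<phi> $ j)) * H j $ \<alpha> $ \<beta>) = 0"
      using s[of \<alpha> \<beta>] s'[of \<alpha> \<beta>] by (simp add: distrib_right sum.distrib)
    then have "2 * (\<Sum>j\<in>UNIV. complex_of_real (Re (\<phi> $ j)) * H j $ \<alpha> $ \<beta>) = 0"
      by (simp add: complex_add_cnj sum_distrib_left algebra_simps)
    then show ?thesis by simp
  qed
  have im: "(\<Sum>j\<in>UNIV. complex_of_real (Im (\<phi> $ j)) * H j $ \<alpha> $ \<beta>) = 0" for \<alpha> \<beta>
  proof -
    have "(\<Sum>j\<in>UNIV. (\<phi> $ j - cnj (\<phi> $ j)) * H j $ \<alpha> $ \<beta>) = 0"
      using s[of \<alpha> \<beta>] s'[of \<alpha> \<beta>] by (simp add: left_diff_distrib sum_subtractf)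
    then have "2 * \<i> * (\<Sum>j\<in>UNIV. complex_of_real (Im (\<phi> $ j)) * H j $ \<alpha> $ \<beta>) = 0"
      by (simp add: complex_diff_cnj sum_distrib_left algebra_simps)
    then show ?thesis by simp
  qed
  have ind: "(\<forall>j. c j = 0)" if "\<And>\<alpha> \<beta>. (\<Sum>j\<in>UNIV. complex_of_real (c j) * H j $ \<alpha> $ \<beta>) = 0" for c :: "'k \<Rightarrow> real"
  proof -
    have "(\<Sum>j\<in>UNIV. c j *\<^sub>R H j) = 0"
      using that by (simp add: vec_eq_iff) (simp add: scaleR_conv_of_real)
    then show ?thesis using nondeg by (simp add: nondegenerate_def)
  qed
  show ?thesis using ind[OF re] ind[OF im] by (simp add: vec_eq_iff complex_eq_iff)
qed

text \<open>Otherwise a nonzero functional would vanish on all values of \<open>B\<close>, against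
  the independence of the \<open>H j\<close>.\<close>

lemma span_levi: "vec.span {B z \<zeta> |z \<zeta>. True} = UNIV"
proof (rule ccontr)
  assume "vec.span {B z \<zeta> |z \<zeta>. True} \<noteq> UNIV"
  then obtain w where "w \<notin> vec.span {B z \<zeta> |z \<zeta>. True}" by auto
  from exists_dot_separating[OF this] obtain \<phi> where "\<And>z \<zeta>. dot \<phi> (B z \<zeta>) = 0" "dot \<phi> w = 1" by blast
  then show False using dot_levi_nondeg[of \<phi>] by (simp add: dot_def)
qed

end

section \<open>Vanishing of the prolongation\<close>

lemma eq_0_if_add_sub_0:
  fixes x y :: "complex^'m"
  assumes "x + y = 0" "x - y = 0"
  shows "x = 0"
proof -
  have "x $ i = 0" for i
    using arg_cong[OF assms(1), of "\<lambda>v. v $ i"] arg_cong[OF assms(2), of "\<lambda>v. v $ i"] by simp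
  then show ?thesis by (simp add: vec_eq_iff)
qed

locale levi_null = levi_form H for H :: "'k::finite \<Rightarrow> complex^'n::finite^'n" +
  fixes a :: "complex^'k \<Rightarrow> complex^'k \<Rightarrow> complex^'n"
  assumes a_add: "a (u + v) w = a u w + a v w"
    and a_scale: "a (c *s u) w = c *s a u w"
    and a_sym: "a u v = a v u"
    and a_null: "B z (a (B z \<zeta>) (B z \<eta>)) = 0"
begin

lemma a_simps [simp]: "a 0 w = 0" "a w 0 = 0" "a (- u) w = - a u w" "a w (- u) = - a w u"
  "a (u - v) w = a u w - a v w" "a w (u - v) = a w u - a w v"
  "a (u + v) w = a u w + a v w" "a w (u + v) = a w u + a w v"
  "a (c *s u) w = c *s a u w" "a w (c *s u) = c *s a w u"
proof -
  have z: "a 0 w = 0" for w using a_scale[of 0 0 w] by simp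
  then show "a 0 w = 0" .
  show "a w 0 = 0" using z a_sym by metis
  have m: "a (- u) w = - a u w" for u w using a_scale[of "-1" u w] by simp
  then show "a (- u) w = - a u w" .
  show "a w (- u) = - a w u" using m a_sym by metis
  have d: "a (u - v) w = a u w - a v w" for u v w using a_add[of u "- v" w] m by simp
  then show "a (u - v) w = a u w - a v w" .
  show "a w (u - v) = a w u - a w v" using d a_sym by metis
  show "a (u + v) w = a u w + a v w" by (rule a_add)
  show "a w (u + v) = a w u + a w v" using a_add a_sym by metis
  show "a (c *s u) w = c *s a u w" by (rule a_scale)
  show "a w (c *s u) = c *s a w u" using a_scale a_sym by metis
qed

lemma a_span_zero:
  assumes "\<And>u v. u \<in> S \<Longrightarrow> v \<in> S \<Longrightarrow> a u v = 0" "u \<in> vec.span S" "v \<in> vec.span S"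
  shows "a u v = 0"
proof -
  have 1: "a x y = 0" if x: "x \<in> vec.span S" and y: "y \<in> S" for x y
    using x by (induction rule: vec.span_induct_alt) (auto simp: assms(1) y)
  show ?thesis using assms(3)
    by (induction rule: vec.span_induct_alt) (auto simp: 1[OF assms(2)])
qed

lemma a_zero_if_levi_zero:
  assumes "\<And>z \<zeta> y \<eta>. a (B z \<zeta>) (B y \<eta>) = 0"
  shows "a u v = 0"
  by (rule a_span_zero[of "{B z \<zeta> |z \<zeta>. True}"]) (use assms span_levi in auto)

text \<open>The expression in \<open>a_null\<close> is cubic in the base point. Its values at
  \<open>z + y\<close> and \<open>z - y\<close> separate the part linear in \<open>y\<close> from
  \<open>?T2\<close>, the part quadratic in \<open>y\<close>.\<close>

lemma a_null_polarized:
  "B y (a (B z \<zeta>) (B z \<eta>)) + B z (a (B y \<zeta>) (B z \<eta>)) + B z (a (B z \<zeta>) (B y \<eta>)) = 0" (is "?T1 = 0")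
proof -
  let ?T2 = "B z (a (B y \<zeta>) (B y \<eta>)) + B y (a (B y \<zeta>) (B z \<eta>)) + B y (a (B z \<zeta>) (B y \<eta>))"
  have "?T1 + ?T2 = 0" using a_null[of "z + y" \<zeta> \<eta>] a_null[of z \<zeta> \<eta>] a_null[of y \<zeta> \<eta>]
    by (simp add: algebra_simps)
  moreover have "?T1 - ?T2 = 0" using a_null[of "z - y" \<zeta> \<eta>] a_null[of z \<zeta> \<eta>] a_null[of y \<zeta> \<eta>]
    by (simp add: algebra_simps)
  ultimately show ?thesis by (rule eq_0_if_add_sub_0)
qed

text \<open>Surjectivity turns \<open>a_null\<close> into \<open>B z (a u v) = 0\<close> for all
  \<open>u\<close>, \<open>v\<close>. The last two terms of the polarized identity then vanish, so
  every \<open>B y\<close> kills \<open>a u v\<close>.\<close>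

lemma a_zero_if_surj:
  assumes "\<And>w. \<exists>\<zeta>. B z \<zeta> = w"
  shows "a u v = 0"
proof (rule right_nondeg)
  have z0: "B z (a u v) = 0" for u v using a_null assms by metis
  fix y
  obtain \<zeta> \<eta> where "B z \<zeta> = u" "B z \<eta> = v" using assms by meson
  then show "B y (a u v) = 0" using a_null_polarized[of y z \<zeta> \<eta>] z0 by simp
qed

end

text \<open>In the application \<open>F z y\<close> is, up to a factor, the derivative along
  \<open>y\<close> of the part of \<open>f\<close> quadratic in \<open>z\<close>, so
  \<open>F_pair\<close> records the compatibility of \<open>f\<close> with \<open>a\<close>.\<close>

locale levi_prolongation = levi_null H a
  for H :: "'k::finite \<Rightarrow> complex^'n::finite^'n" and a +
  fixes F :: "complex^'n \<Rightarrow> complex^'k \<Rightarrow> complex^'n"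
  assumes F_pair: "B (F z y) \<zeta> = B z (a y (B z \<zeta>))"
begin

text \<open>An equation \<open>B x (X x) = 0\<close> with \<open>X\<close> homogeneous in \<open>x\<close> forces \<open>X = 0\<close> as soon as \<open>B z\<close> is
  injective for one \<open>z\<close>: expand along \<open>x = z + t y\<close> and solve for the coefficients of \<open>X x\<close>
  successively. This is applied to a quadratic and two linear maps \<open>X\<close>.\<close>

lemma a_zero_if_inj:
  assumes inj: "\<And>\<zeta>. B z \<zeta> = 0 \<Longrightarrow> \<zeta> = 0"
  shows "a u v = 0"
proof -
  have q0: "a (B z \<zeta>) (B z \<eta>) = 0" for \<zeta> \<eta> by (rule inj) (rule a_null)
  have q1: "a (B y \<zeta>) (B z \<eta>) + a (B z \<zeta>) (B y \<eta>) = 0" for y \<zeta> \<eta>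
    by (rule inj) (use a_null_polarized[of y z \<zeta> \<eta>] q0 in simp)
  \<comment> \<open>With \<open>y\<close> and \<open>z\<close> exchanged, the polarized identity
    leaves one new term, since \<open>q1\<close> under \<open>B y\<close> cancels the other
    two.\<close>
  have q2: "a (B y \<zeta>) (B y \<eta>) = 0" for y \<zeta> \<eta>
  proof (rule inj)
    have *: "p + q + r = 0 \<Longrightarrow> r + q = 0 \<Longrightarrow> p = 0" for p q r :: "complex^'k"
      by (metis add.assoc add.commute add_0_right)
    have "B y (a (B y \<zeta>) (B z \<eta>)) + B y (a (B z \<zeta>) (B y \<eta>)) = 0"
      using arg_cong[OF q1[of y \<zeta> \<eta>], of "B y"] by simp
    then show "B z (a (B y \<zeta>) (B y \<eta>)) = 0"
      by (rule *[OF a_null_polarized[of z y \<zeta> \<eta>]])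
  qed
  have anti: "a (B x \<zeta>) (B y \<eta>) = - a (B y \<zeta>) (B x \<eta>)" for x y \<zeta> \<eta>
    using q2[of "x + y" \<zeta> \<eta>] q2[of x \<zeta> \<eta>] q2[of y \<zeta> \<eta>] by (simp add: eq_neg_iff_add_eq_0 add.commute)
  \<comment> \<open>For equal right arguments the value is antisymmetric in the base points by
    \<open>anti\<close> and symmetric by \<open>a_sym\<close>.\<close>
  have diag: "a (B x \<eta>) (B y \<eta>) = 0" for x y \<eta>
  proof -
    have "2 *s a (B x \<eta>) (B y \<eta>) = 0" using anti[of x \<eta> y \<eta>] a_sym[of "B x \<eta>" "B y \<eta>"] 
      by (simp add: vec_eq_iff)
    then show ?thesis by (simp add: vec.scale_eq_0_iff)
  qed
  have Fd: "B (F x (B y \<eta>)) \<eta> = 0" for x y \<eta>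
    using F_pair[of x "B y \<eta>" \<eta>] diag by simp
  \<comment> \<open>Conjugation carries the injectivity of \<open>B z\<close> over to the map
    sending \<open>x\<close> to \<open>B x (cv z)\<close>, so values of \<open>F\<close> can be
    solved for as well.\<close>
  have inj': "x = 0" if "B x (cv z) = 0" for x
    using inj[of "cv x"] cv_B[of x "cv z"] that by simp
  have F0: "F x (B y (cv z)) = 0" for x y by (rule inj') (rule Fd)
  have Flin: "F x (u + v) = F x u + F x v" for x u v
  proof -
    have "F x (u + v) - F x u - F x v = 0"
      by (rule left_nondeg) (simp add: F_pair)
    then show ?thesis by (simp add: algebra_simps)
  qed
  have F1: "F x (B y \<eta>) = 0" for x y \<eta>
  proof (rule inj')
    have "B (F x (B y (cv z + \<eta>))) (cv z + \<eta>) = 0" by (rule Fd)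
    then show "B (F x (B y \<eta>)) (cv z) = 0" by (simp add: Flin F0 Fd)
  qed
  have X: "B x (a (B y \<eta>) (B x \<zeta>)) = 0" for x y \<eta> \<zeta>
    using F_pair[of x "B y \<eta>" \<zeta>] F1 by simp
  have X0: "a (B y \<eta>) (B z \<zeta>) = 0" for y \<eta> \<zeta> by (rule inj) (rule X)
  have "a (B y \<eta>) (B x \<zeta>) = 0" for x y \<eta> \<zeta>
  proof (rule inj)
    have "B (z + x) (a (B y \<eta>) (B (z + x) \<zeta>)) = 0" by (rule X)
    then show "B z (a (B y \<eta>) (B x \<zeta>)) = 0" using X X0 by simp
  qed
  then show ?thesis by (rule a_zero_if_levi_zero)
qed

end

text \<open>Independence is stated for the family, so a triple with a repeated vector is not
  free.\<close>

definition free3 :: "complex^'m \<Rightarrow> complex^'m \<Rightarrow> complex^'m \<Rightarrow> bool" where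
  "free3 a b c \<longleftrightarrow> (\<forall>x y z. x *s a + y *s b + z *s c = 0 \<longrightarrow> x = 0 \<and> y = 0 \<and> z = 0)"

lemma free3_iff: "free3 a b c \<longleftrightarrow> c \<noteq> 0 \<and> b \<notin> vec.span {c} \<and> a \<notin> vec.span {b, c}"
proof
  assume f: "free3 a b c"
  have "c \<noteq> 0" using f unfolding free3_def
      by (metis add.left_neutral vec.scale_zero_left vec.scale_zero_right zero_neq_one)
  moreover have "b \<notin> vec.span {c}"
  proof
    assume "b \<in> vec.span {c}"
    then obtain x where "b = x *s c" by (auto simp: in_span1)
    then have "0 *s a + 1 *s b + (- x) *s c = 0" by simp
    then show False using f unfolding free3_def by (metis zero_neq_one)
  qed
  moreover have "a \<notin> vec.span {b, c}"
  proof
    assume "a \<in> vec.span {b, c}"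
    then obtain x y where "a = x *s b + y *s c" by (auto simp: in_span2)
    then have "1 *s a + (- x) *s b + (- y) *s c = 0" by simp
    then show False using f unfolding free3_def by (metis zero_neq_one)
  qed
  ultimately show "c \<noteq> 0 \<and> b \<notin> vec.span {c} \<and> a \<notin> vec.span {b, c}" by blast
next
  assume A: "c \<noteq> 0 \<and> b \<notin> vec.span {c} \<and> a \<notin> vec.span {b, c}"
  show "free3 a b c" unfolding free3_def
  proof (intro allI impI)
    fix x y z assume e: "x *s a + y *s b + z *s c = 0"
    have x: "x = 0"
    proof (rule ccontr)
      assume "x \<noteq> 0"
      then have "a + ((y / x) *s b + (z / x) *s c) = 0"
        using arg_cong[OF e, of "\<lambda>v. (1 / x) *s v"] by (simp add: vector_add_ldistrib add.assoc)
      then have "a = - ((y / x) *s b + (z / x) *s c)" by (rule eq_neg_iff_add_eq_0[THEN iffD2])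
      then have "a = (- (y / x)) *s b + (- (z / x)) *s c" by simp
      then show False using A unfolding in_span2 by blast
    qed
    have y: "y = 0"
    proof (rule ccontr)
      assume "y \<noteq> 0"
      then have "b = (- (z / y)) *s c"
        using arg_cong[OF e, of "\<lambda>v. (1 / y) *s v"] x by (simp add: vector_add_ldistrib eq_neg_iff_add_eq_0)
      then show False using A unfolding in_span1 by blast
    qed
    show "x = 0 \<and> y = 0 \<and> z = 0" using A e x y by auto
  qed
qed

lemma free3_independent:
  assumes "free3 a b c"
  shows "vec.independent {a, b, c}" "card {a, b, c} = 3"
proof -
  have A: "c \<noteq> 0" "b \<notin> vec.span {c}" "a \<notin> vec.span {b, c}" using assms free3_iff by auto
  have "vec.independent {c}" using A by simp
  then have "vec.independent {b, c}" using A vec.independent_insertI by blast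
  then show "vec.independent {a, b, c}" using A vec.independent_insertI by blast
  have "b \<noteq> c" "a \<noteq> b" "a \<noteq> c" using A vec.span_base[of b "{b, c}"] vec.span_base[of c "{b,
      c}"] vec.span_base[of c "{c}"] by auto
  then show "card {a, b, c} = 3" by simp
qed

lemma free3_spans:
  fixes a b c :: "complex^'m::finite"
  assumes "free3 a b c" "CARD('m) \<le> 3"
  shows "w \<in> vec.span {a, b, c}"
proof -
  have "vec.dim (UNIV :: (complex^'m) set) \<le> card {a, b, c}"
    using free3_independent[OF assms(1)] assms(2) by (simp add: card_cart_basis)
  then show ?thesis
    using vec.card_ge_dim_independent[of "{a, b, c}" UNIV] free3_independent[OF assms(1)] by auto
qed

text \<open>Together with \<open>free3_rotate\<close> this gives the three functionals of a dual
  basis, in which minors of \<open>B x\<close> are computed.\<close>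

lemma free3_dual:
  assumes "free3 a b c"
  shows "\<exists>\<phi>. dot \<phi> a = 1 \<and> dot \<phi> b = 0 \<and> dot \<phi> c = 0"
proof -
  have "a \<notin> vec.span {b, c}" using assms free3_iff by blast
  from exists_dot_separating[OF this] show ?thesis by auto
qed

lemma free3_rotate: assumes "free3 a b c" shows "free3 b c a"
  unfolding free3_def
proof (intro allI impI)
  fix x y z assume "x *s b + y *s c + z *s a = 0"
  then have "z *s a + x *s b + y *s c = 0" by (simp add: add.commute add.left_commute)
  then show "x = 0 \<and> y = 0 \<and> z = 0" using assms unfolding free3_def by blast
qed

section \<open>Levi maps of rank at most two\<close>

context levi_form begin

text \<open>Preimages of independent vectors are independent, so \<open>p\<close>, \<open>q\<close>,
  \<open>s\<close> would span the whole domain, including \<open>\<kappa>\<close>; as its image is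
  zero, its coefficients would all vanish.\<close>

lemma not_free3_if_not_inj:
  assumes "CARD('n) \<le> 3" and ni: "\<kappa> \<noteq> 0" "B z \<kappa> = 0"
  shows "\<not> free3 (B z p) (B z q) (B z s)"
proof
  assume f: "free3 (B z p) (B z q) (B z s)"
  have "free3 p q s"
    unfolding free3_def
  proof (intro allI impI)
    fix c1 c2 c3 assume "c1 *s p + c2 *s q + c3 *s s = 0"
    then have "B z (c1 *s p + c2 *s q + c3 *s s) = 0" by simp
    then have "c1 *s B z p + c2 *s B z q + c3 *s B z s = 0" by simp
    then show "c1 = 0 \<and> c2 = 0 \<and> c3 = 0" using f unfolding free3_def by blast
  qed
  then have "\<kappa> \<in> vec.span {p, q, s}" using free3_spans assms(1) by blast
  then obtain c1 c2 c3 where c: "\<kappa> = c1 *s p + c2 *s q + c3 *s s" by (auto simp: in_span3)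
  then have "c1 *s B z p + c2 *s B z q + c3 *s B z s = 0" using ni(2) by simp
  then have "c1 = 0 \<and> c2 = 0 \<and> c3 = 0" using f unfolding free3_def by blast
  then show False using c ni(1) by simp
qed

lemma not_free3_if_not_surj:
  assumes "CARD('k) \<le> 3" and ns: "\<And>\<zeta>. B z \<zeta> \<noteq> w"
  shows "\<not> free3 (B z p) (B z q) (B z s)"
proof
  assume f: "free3 (B z p) (B z q) (B z s)"
  then have "w \<in> vec.span {B z p, B z q, B z s}" using free3_spans assms(1) by blast
  then obtain c1 c2 c3 where "w = c1 *s B z p + c2 *s B z q + c3 *s B z s" by (auto simp: in_span3)
  then have "w = B z (c1 *s p + c2 *s q + c3 *s s)" by simp
  then show False using ns by metis
qed

text \<open>The rank condition becomes a polynomial equation in \<open>x\<close>, which can be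
  expanded along lines.\<close>

lemma det3_levi_zero:
  assumes "\<not> free3 (B x p) (B x q) (B x s)"
  shows "det3 (dot \<phi> (B x p)) (dot \<psi> (B x p)) (dot \<rho> (B x p))
    (dot \<phi> (B x q)) (dot \<psi> (B x q)) (dot \<rho> (B x q))
    (dot \<phi> (B x s)) (dot \<psi> (B x s)) (dot \<rho> (B x s)) = 0"
proof -
  obtain c1 c2 c3 where c: "c1 \<noteq> 0 \<or> c2 \<noteq> 0 \<or> c3 \<noteq> 0"
    and e: "c1 *s B x p + c2 *s B x q + c3 *s B x s = 0"
    using assms unfolding free3_def by blast
  have "c1 * dot \<phi> (B x p) + c2 * dot \<phi> (B x q) + c3 * dot \<phi> (B x s) = 0" for \<phi>
    using arg_cong[OF e, of "dot \<phi>"] by simp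
  then show ?thesis using det3_eq_0[OF c] by blast
qed

abbreviation "L \<equiv> \<lambda>z. B z (cv z)"

lemma cv_L: "cv (L z) = L z"
  by (simp add: cv_B)

text \<open>If \<open>L\<close> vanished, its values at \<open>x + y\<close> and
  \<open>x + \<i> *s y\<close> would give the symmetric and the antisymmetric part of
  \<open>B\<close> as zero, against the independence of the forms.\<close>

lemma exists_L_nonzero: "\<exists>z. L z \<noteq> 0"
proof (rule ccontr)
  assume "\<not> ?thesis"
  then have 0: "B z (cv z) = 0" for z by blast
  have "B x (cv y) = 0" for x y
  proof -
    have "B x (cv y) + B y (cv x) = 0" using 0[of "x + y"] 0[of x] 0[of y] by (simp add: add.commute)
    moreover have "(- \<i>) *s B x (cv y) + \<i> *s B y (cv x) = 0"
      using 0[of "x + \<i> *s y"] 0[of x] 0[of y] by simp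
    then have "\<i> *s ((- \<i>) *s B x (cv y) + \<i> *s B y (cv x)) = 0" by simp
    then have "B x (cv y) - B y (cv x) = 0" by (simp add: vector_add_ldistrib)
    ultimately show ?thesis by (rule eq_0_if_add_sub_0)
  qed
  then have "B x \<zeta> = 0" for x \<zeta> using cv_cv by metis
  then have "dot 1 (B x \<zeta>) = 0" for x \<zeta> by simp
  then have "(1 :: complex^'k) = 0" using dot_levi_nondeg[of 1] by blast
  then show False by (simp add: vec_eq_iff)
qed

text \<open>If \<open>B z\<close> had rank one whenever \<open>L z \<noteq> 0\<close>, its image line would be constant by continuity.\<close>

lemma exists_rank_two:
  assumes "\<And>z. \<exists>w. \<forall>\<zeta>. B z \<zeta> \<noteq> w"
  shows "\<exists>z p. L z \<noteq> 0 \<and> B z p \<notin> vec.span {L z}"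
proof (rule ccontr)
  assume "\<not> ?thesis"
  then have r1: "B z p \<in> vec.span {L z}" if "L z \<noteq> 0" for z p using that by blast
  obtain z where z: "L z \<noteq> 0" using exists_L_nonzero by blast
  have K: "B y \<kappa> \<in> vec.span {L z}" if \<kappa>: "B z \<kappa> = 0" for y \<kappa>
  proof (rule ccontr)
    assume no: "B y \<kappa> \<notin> vec.span {L z}"
    then have n0: "B y \<kappa> \<noteq> 0" using vec.span_zero by metis
    have "L z \<notin> vec.span {B y \<kappa>}"
    proof
      assume "L z \<in> vec.span {B y \<kappa>}"
      then obtain c where c: "L z = c *s B y \<kappa>" by (auto simp: in_span1)
      then have "c \<noteq> 0" using z by auto
      then have "B y \<kappa> = (1/c) *s L z" using c by simp
      then show False using no by (auto simp: in_span1)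
    qed
    from exists_dot_separating[OF this] obtain \<phi> where p: "dot \<phi> (B y \<kappa>) = 0" "dot \<phi> (L z) = 1" by auto
    \<comment> \<open>As \<open>B z\<close> kills \<open>\<kappa>\<close>, the image of
      \<open>\<kappa>\<close> at the base point \<open>z + t y\<close> is
      \<open>t *s B y \<kappa>\<close>. It is nonzero, is killed by \<open>\<phi>\<close>, and spans
      the same line as \<open>L (z + t y)\<close> when the latter is nonzero.\<close>
    have van: "dot \<phi> (L (z + of_real t *s y)) = 0" if t: "t \<noteq> 0" for t :: real
    proof (cases "L (z + of_real t *s y) = 0")
      case False
      from r1[OF this, of \<kappa>] obtain c where c: "of_real t *s B y \<kappa> = c *s L (z + of_real t *s y)"
        using \<kappa> by (auto simp: in_span1)
      have "of_real t *s B y \<kappa> \<noteq> 0" using t n0 by (simp add: vec.scale_eq_0_iff)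
      then have "c \<noteq> 0" using c by auto
      have "c * dot \<phi> (L (z + of_real t *s y)) = 0"
        using arg_cong[OF c, of "dot \<phi>"] p(1) unfolding dot_simps by simp
      then show ?thesis using \<open>c \<noteq> 0\<close> by simp
    qed (simp only: dot_simps)
    define e f where "e = dot \<phi> (B z (cv y)) + dot \<phi> (B y (cv z))" and "f = dot \<phi> (L y)"
    have E: "1 + of_real t * e + (of_real t)^2 * f = 0" if "t \<noteq> 0" for t :: real
      using van[OF that] p(2) by (simp add: e_def f_def algebra_simps power2_eq_square)
    \<comment> \<open>A quadratic polynomial in \<open>t\<close> with constant term 1 cannot vanish
      at 1, -1 and 2.\<close>
    have "1 + e + f = 0" "1 - e + f = 0" "1 + 2 * e + 4 * f = 0"
      using E[of 1] E[of "-1"] E[of 2] by (simp_all add: algebra_simps)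
    then have "(3 :: complex) = 0" by algebra
    then show False by simp
  qed
  have y0: "B y (cv z) \<in> vec.span {L z}" for y
  proof -
    obtain c where "B z (cv y) = c *s L z" using r1[OF z] by (auto simp: in_span1)
    then have "cv (B z (cv y)) = cv (c *s L z)" by simp
    then have "B y (cv z) = cnj c *s L z" by (simp add: cv_B)
    then show ?thesis by (auto simp: in_span1)
  qed
  have all: "B y \<zeta> \<in> vec.span {L z}" for y \<zeta>
  proof -
    obtain c where "B z \<zeta> = c *s L z" using r1[OF z] by (auto simp: in_span1)
    then have "B z (\<zeta> - c *s cv z) = 0" by simp
    then have "B y (\<zeta> - c *s cv z) \<in> vec.span {L z}" by (rule K)
    moreover have "c *s B y (cv z) \<in> vec.span {L z}" using y0 vec.span_scale by blast
    ultimately have "B y (\<zeta> - c *s cv z) + c *s B y (cv z) \<in> vec.span {L z}" by (rule vec.span_add)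
    then show ?thesis by simp
  qed
  have "vec.span {B x \<zeta> |x \<zeta>. True} \<subseteq> vec.span {L z}"
    by (rule vec.span_minimal) (use all in auto)
  then have "w \<in> vec.span {L z}" for w using span_levi by auto
  then have "\<exists>\<zeta>. B z \<zeta> = w" for w using in_span1[of w "L z"] by (metis levi_simps(10))
  then show False using assms[of z] by metis
qed

end

text \<open>A cubic is determined by its values at 1, -1, 2 and -2. The point 0 is left out so that
  an identity may first be divided by \<open>t\<close>.\<close>

lemma poly3_zero:
  fixes a b c d :: complex
  assumes "\<And>t::real. t \<noteq> 0 \<Longrightarrow> a + of_real t * b + of_real t ^ 2 * c + of_real t ^ 3 * d = 0"
  shows "a = 0" "b = 0" "c = 0" "d = 0"
proof -
  have e: "a + b + c + d = 0" "a - b + c - d = 0" "a + 2 * b + 4 * c + 8 * d = 0" "a - 2 * b + 4 * c - 8 * d = 0"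
    using assms[of 1] assms[of "-1"] assms[of 2] assms[of "-2"] by (simp_all add: algebra_simps)
  have ac: "a + c = 0" "b + d = 0" "a + 4 * c = 0" "b + 4 * d = 0" using e by algebra+
  have "3 * c = 0" "3 * d = 0" using ac by algebra+
  then show "c = 0" "d = 0" by auto
  then show "a = 0" "b = 0" using ac by auto
qed

text \<open>The image of \<open>B z\<close> is the plane spanned by \<open>v\<close> and
  \<open>u\<close> as abbreviated below. Since \<open>cv\<close> fixes \<open>v\<close>, the two
  cases to come are whether this plane contains \<open>cv u\<close> or not.\<close>

locale levi_rank_two = levi_form H for H :: "'k::finite \<Rightarrow> complex^'n::finite^'n" +
  fixes z e :: "complex^'n"
  assumes rk: "\<not> free3 (B x p) (B x q) (B x s)"
    and L_nz: "L z \<noteq> 0"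
    and e_indep: "B z (cv e) \<notin> vec.span {L z}"
begin

abbreviation "v \<equiv> L z"
abbreviation "u \<equiv> B z (cv e)"

lemma u_conj: "B e (cv z) = cv u"
  by (simp add: cv_B)

lemma cv_v: "cv v = v" by (rule cv_L)

lemma uv_indep: assumes "a *s u + b *s v = 0" shows "a = 0" "b = 0"
proof -
  show a: "a = 0"
  proof (rule ccontr)
    assume "a \<noteq> 0"
    then have "u = (- (b / a)) *s v"
      using arg_cong[OF assms, of "\<lambda>x. (1 / a) *s x"] by (simp add: vector_add_ldistrib eq_neg_iff_add_eq_0)
    then show False using e_indep unfolding in_span1 by blast
  qed
  show "b = 0" using assms a L_nz by (simp add: vec.scale_eq_0_iff)
qed

lemma image_z: "B z \<zeta> \<in> vec.span {v, u}"
proof (rule ccontr)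
  assume "B z \<zeta> \<notin> vec.span {v, u}"
  moreover have "u \<noteq> 0" using uv_indep[of 1 0] by auto
  moreover have "v \<notin> vec.span {u}" using uv_indep[of "- c" 1 for c] by (auto simp: in_span1)
  ultimately have "free3 (B z \<zeta>) v u" by (simp add: free3_iff)
  then show False using rk by blast
qed

text \<open>The rank cannot grow near \<open>z\<close>: were \<open>B y \<kappa>\<close> independent
  of \<open>v\<close> and \<open>u\<close>, the minor of \<open>B (z + t y)\<close> on
  \<open>cv z\<close>, \<open>cv e\<close>, \<open>\<kappa>\<close> would be \<open>t\<close> times
  a polynomial with constant term 1.\<close>

lemma image_kernel:
  assumes \<kappa>: "B z \<kappa> = 0"
  shows "B y \<kappa> \<in> vec.span {v, u}"
proof (rule ccontr)
  assume "B y \<kappa> \<notin> vec.span {v, u}"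
  moreover have "u \<noteq> 0" using uv_indep[of 1 0] by auto
  moreover have "v \<notin> vec.span {u}" using uv_indep[of "- c" 1 for c] by (auto simp: in_span1)
  ultimately have f: "free3 (B y \<kappa>) v u" by (simp add: free3_iff)
  obtain \<phi> where p: "dot \<phi> (B y \<kappa>) = 1" "dot \<phi> v = 0" "dot \<phi> u = 0" using free3_dual[OF f] by blast
  obtain \<psi> where q: "dot \<psi> (B y \<kappa>) = 0" "dot \<psi> v = 1" "dot \<psi> u = 0" 
    using free3_dual[OF free3_rotate[OF f]] by blast
  obtain \<rho> where r: "dot \<rho> (B y \<kappa>) = 0" "dot \<rho> v = 0" "dot \<rho> u = 1"
    using free3_dual[OF free3_rotate[OF free3_rotate[OF f]]] by blast
  define a1 a2 a3 b1 b2 b3 where "a1 = dot \<phi> (B y (cv z))" "a2 = dot \<psi> (B y (cv z))" "a3 = dot \<rho> (B y (cv z))"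
    "b1 = dot \<phi> (B y (cv e))" "b2 = dot \<psi> (B y (cv e))" "b3 = dot \<rho> (B y (cv e))"
  note defs = a1_a2_a3_b1_b2_b3_def
  have "1 + of_real t * (a2 + b3) + of_real t ^ 2 * (a2 * b3 - a3 * b2) + of_real t ^ 3 * 0 = 0" if t: "t \<noteq> 0"
      for t :: real
  proof -
    have "det3 (dot \<psi> (B (z + of_real t *s y) (cv z))) (dot \<rho> (B (z
        + of_real t *s y) (cv z))) (dot \<phi> (B (z + of_real t *s y) (cv z)))
      (dot \<psi> (B (z + of_real t *s y) (cv e))) (dot \<rho> (B (z + of_real t *s y) (cv e))) (dot \<phi> (B (z
          + of_real t *s y) (cv e)))
      (dot \<psi> (B (z + of_real t *s y) \<kappa>)) (dot \<rho> (B (z + of_real t *s y) \<kappa>)) (dot \<phi> (B (z + of_real t *s y) \<kappa>)) = 0"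
      by (rule det3_levi_zero[OF rk])
    then have "of_real t * (1 + of_real t * (a2 + b3) + of_real t ^ 2 * (a2 * b3 - a3 * b2)) = 0"
      using p q r \<kappa> by (simp add: det3_def defs algebra_simps power2_eq_square)
    then show ?thesis using t by simp
  qed
  from poly3_zero(1)[OF this] show False by simp
qed

lemma decompose: "\<exists>s t. B z (\<zeta> - s *s cv z - t *s cv e) = 0"
proof -
  obtain s t where "B z \<zeta> = s *s v + t *s u" using image_z in_span2 by meson
  then have "B z (\<zeta> - s *s cv z - t *s cv e) = 0" by simp
  then show ?thesis by blast
qed

lemma decompose_left: "\<exists>s t \<nu>. B z (cv \<nu>) = 0 \<and> x = s *s z + t *s e + \<nu>"
proof -
  obtain s t where d: "B z (cv x - s *s cv z - t *s cv e) = 0" using decompose by blast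
  define \<nu> where "\<nu> = cv (cv x - s *s cv z - t *s cv e)"
  have "B z (cv \<nu>) = 0" using d by (simp add: \<nu>_def)
  moreover have "x = cnj s *s z + cnj t *s e + \<nu>" by (simp add: \<nu>_def)
  ultimately show ?thesis by blast
qed

text \<open>By \<open>decompose_left\<close> the vectors \<open>z\<close>, \<open>e\<close> and the
  conjugates of the kernel of \<open>B z\<close> span the space, so these tests suffice for
  \<open>right_nondeg\<close>.\<close>

lemma kernel_zero:
  assumes "B z \<kappa> = 0" "B e \<kappa> = 0" "\<And>\<nu>. B z (cv \<nu>) = 0 \<Longrightarrow> B \<nu> \<kappa> = 0"
  shows "\<kappa> = 0"
proof (rule right_nondeg)
  fix x
  obtain s t \<nu> where "B z (cv \<nu>) = 0" and x: "x = s *s z + t *s e + \<nu>" using decompose_left by blast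
  then show "B x \<kappa> = 0" using assms by simp
qed

lemma kernel_left: "B z (cv \<nu>) = 0 \<Longrightarrow> B \<nu> (cv z) = 0"
  using cv_B[of z "cv \<nu>"] by simp

lemma kernel_left_e: "B \<nu> (cv e) = cv (B e (cv \<nu>))"
  by (simp add: cv_B)

text \<open>At \<open>x = z + t e + \<nu>\<close> the minor of \<open>B x\<close> on
  \<open>cv z\<close>, \<open>cv e\<close>, \<open>\<kappa>\<close>, taken in the basis dual to
  \<open>L e\<close>, \<open>v\<close>, \<open>u\<close>, is \<open>- t\<close> times a quadratic
  polynomial in \<open>t\<close>. Its three coefficients give the three identities.\<close>

lemma real_plane_identities:
  assumes w: "cv u = \<gamma> *s v + \<delta> *s u" and f: "free3 (L e) v u"
    and \<kappa>: "B z \<kappa> = 0" and \<nu>: "B z (cv \<nu>) = 0"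
    and e\<kappa>: "B e \<kappa> = \<alpha> *s v + \<beta> *s u" and \<nu>\<kappa>: "B \<nu> \<kappa> = h *s v + g *s u"
  shows "g = 0" "\<beta> = \<delta> * h" "\<gamma> * \<beta> = \<delta> * \<alpha>"
proof -
  obtain \<rho> where r: "dot \<rho> (L e) = 1" "dot \<rho> v = 0" "dot \<rho> u = 0" using free3_dual[OF f] by blast
  obtain \<phi> where p: "dot \<phi> (L e) = 0" "dot \<phi> v = 1" "dot \<phi> u = 0" 
    using free3_dual[OF free3_rotate[OF f]] by blast
  obtain \<psi> where q: "dot \<psi> (L e) = 0" "dot \<psi> v = 0" "dot \<psi> u = 1"
    using free3_dual[OF free3_rotate[OF free3_rotate[OF f]]] by blast
  obtain s1 s2 where s: "B e (cv \<nu>) = s1 *s v + s2 *s u" using image_kernel[OF \<nu>] in_span2 by meson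
  have \<nu>e: "B \<nu> (cv e) = cnj s1 *s v + cnj s2 *s (\<gamma> *s v + \<delta> *s u)"
    unfolding kernel_left_e[of \<nu>] s w[symmetric] by (simp add: cv_v)
  have "g + of_real t * (\<beta> + \<gamma> * g - \<delta> * h)
      + of_real t ^ 2 * (\<gamma> * \<beta> - \<delta> * \<alpha>) + of_real t ^ 3 * 0 = 0" if t: "t \<noteq> 0" for t :: real
  proof -
    define x where "x = z + of_real t *s e + \<nu>"
    have R1: "B x (cv z) = v + of_real t *s (\<gamma> *s v + \<delta> *s u)"
      by (simp add: x_def u_conj w kernel_left[OF \<nu>])
    have R2: "B x (cv e) = u + of_real t *s L e + (cnj s1 *s v + cnj s2 *s (\<gamma> *s v + \<delta> *s u))"
      by (simp add: x_def \<nu>e)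
    have R3: "B x \<kappa> = of_real t *s (\<alpha> *s v + \<beta> *s u) + (h *s v + g *s u)"
      by (simp add: x_def \<kappa> e\<kappa> \<nu>\<kappa>)
    have "det3 (dot \<phi> (B x (cv z))) (dot \<psi> (B x (cv z))) (dot \<rho> (B x (cv z)))
      (dot \<phi> (B x (cv e))) (dot \<psi> (B x (cv e))) (dot \<rho> (B x (cv e)))
      (dot \<phi> (B x \<kappa>)) (dot \<psi> (B x \<kappa>)) (dot \<rho> (B x \<kappa>)) = 0"
      by (rule det3_levi_zero[OF rk])
    then have "- of_real t * (g + of_real t * (\<beta> + \<gamma> * g - \<delta> * h) + of_real t ^ 2 * (\<gamma> * \<beta> - \<delta> * \<alpha>)) = 0"
      unfolding R1 R2 R3 dot_simps p q r det3_def by (simp add: algebra_simps power2_eq_square)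
    then show ?thesis using t by simp
  qed
  from poly3_zero[OF this] show "g = 0" "\<beta> = \<delta> * h" "\<gamma> * \<beta> = \<delta> * \<alpha>" by auto
qed

text \<open>When the plane is closed under conjugation, \<open>L e\<close> lies outside it;
  otherwise the plane would contain all values of \<open>B\<close> and \<open>B z\<close> would be
  onto. The identities, first with \<open>\<nu> = 0\<close>, then show that every \<open>B x\<close>
  kills \<open>\<kappa>\<close>.\<close>

lemma real_plane_impossible:
  assumes w: "cv u \<in> vec.span {v, u}" and ns: "\<And>\<zeta>. B z \<zeta> \<noteq> w0"
    and \<kappa>: "B z \<kappa> = 0"
  shows "\<kappa> = 0"
proof -
  obtain \<gamma> \<delta> where w: "cv u = \<gamma> *s v + \<delta> *s u" using assms(1) in_span2 by meson
  have \<delta>: "\<delta> \<noteq> 0"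
  proof
    assume "\<delta> = 0"
    then have "cv (cv u) = cv (\<gamma> *s v)" using w by simp
    then have "u = cnj \<gamma> *s v" by (simp add: cv_v)
    then show False using e_indep unfolding in_span1 by blast
  qed
  have cl: "cv x \<in> vec.span {v, u}" if x: "x \<in> vec.span {v, u}" for x
  proof -
    obtain a b where "x = a *s v + b *s u" using x unfolding in_span2 by blast
    then have "cv x = cnj a *s v + cnj b *s cv u" by (simp add: cv_v)
    then show ?thesis using assms(1) by (simp add: vec.span_add vec.span_scale vec.span_base)
  qed
  have vu: "v \<in> vec.span {v, u}" "u \<in> vec.span {v, u}" by (auto intro: vec.span_base)
  have E: "L e \<notin> vec.span {v, u}"
  proof
    assume E: "L e \<in> vec.span {v, u}"
    have e: "B e \<zeta> \<in> vec.span {v, u}" for \<zeta>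
    proof -
      obtain s t where d: "B z (\<zeta> - s *s cv z - t *s cv e) = 0" using decompose by blast
      have "B e (\<zeta> - s *s cv z - t *s cv e) + s *s cv u + t *s L e \<in> vec.span {v, u}"
        by (intro vec.span_add vec.span_scale image_kernel d E assms(1))
      then show ?thesis by (simp add: u_conj)
    qed
    have all: "B x \<zeta> \<in> vec.span {v, u}" for x \<zeta>
    proof -
      obtain s t \<nu> where \<nu>: "B z (cv \<nu>) = 0" and x: "x = s *s z + t *s e + \<nu>" using decompose_left by blast
      have "B \<nu> \<zeta> = cv (B (cv \<zeta>) (cv \<nu>))" by (simp add: cv_B)
      then have "B \<nu> \<zeta> \<in> vec.span {v, u}" using cl image_kernel[OF \<nu>] by metis
      then have "s *s B z \<zeta> + t *s B e \<zeta> + B \<nu> \<zeta> \<in> vec.span {v, u}"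
        by (intro vec.span_add vec.span_scale image_z e)
      then show ?thesis by (simp add: x)
    qed
    have "vec.span {B x \<zeta> |x \<zeta>. True} \<subseteq> vec.span {v, u}"
      by (rule vec.span_minimal) (use all in auto)
    then have "w0 \<in> vec.span {v, u}" using span_levi by auto
    then obtain c d where "w0 = c *s v + d *s u" using in_span2 by meson
    then have "B z (c *s cv z + d *s cv e) = w0" by simp
    then show False using ns by blast
  qed
  have f: "free3 (L e) v u"
  proof -
    have "u \<noteq> 0" using uv_indep[of 1 0] by auto
    moreover have "v \<notin> vec.span {u}" using uv_indep[of "- c" 1 for c] by (auto simp: in_span1)
    ultimately show ?thesis using E by (simp add: free3_iff)
  qed
  obtain \<alpha> \<beta> where e\<kappa>: "B e \<kappa> = \<alpha> *s v + \<beta> *s u" using image_kernel[OF \<kappa>] in_span2 by meson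
  have ab: "\<beta> = 0" "\<alpha> = 0"
    using real_plane_identities(2,3)[OF w f \<kappa> _ e\<kappa>, of 0 0 0] \<delta> by auto
  show ?thesis
  proof (rule kernel_zero[OF \<kappa>])
    show "B e \<kappa> = 0" using e\<kappa> ab by simp
    fix \<nu> assume \<nu>: "B z (cv \<nu>) = 0"
    obtain h g where \<nu>\<kappa>: "B \<nu> \<kappa> = h *s v + g *s u" using image_kernel[OF \<kappa>] in_span2 by meson
    show "B \<nu> \<kappa> = 0" using real_plane_identities[OF w f \<kappa> \<nu> e\<kappa> \<nu>\<kappa>] \<delta> ab \<nu>\<kappa> by simp
  qed
qed

end

text \<open>The multiplication table of the cross product on \<open>\<complex>\<^sup>3\<close>, in a basis adapted to the Hermitian
  structure; it belongs to the quadric \<open>Im w = \<i> z \<times> \<bar>z\<close>.\<close>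

definition (in levi_form) cross_table :: "complex^'n \<Rightarrow> complex^'n \<Rightarrow> complex^'n \<Rightarrow> complex^'k \<Rightarrow> complex^'k \<Rightarrow> complex^'k \<Rightarrow> bool" where
  "cross_table x y e v u w \<longleftrightarrow> free3 v u w \<and>
     B x (cv x) = v \<and> B x (cv y) = 0 \<and> B x (cv e) = u \<and>
     B y (cv x) = 0 \<and> B y (cv y) = - v \<and> B y (cv e) = w \<and>
     B e (cv x) = w \<and> B e (cv y) = u \<and> B e (cv e) = 0 \<and>
     (\<forall>\<zeta>. \<exists>p q r. \<zeta> = p *s cv x + q *s cv y + r *s cv e)"

context levi_rank_two begin

text \<open>The same minor as in \<open>real_plane_identities\<close>, now expanded in the basis
  dual to \<open>v\<close>, \<open>u\<close>, \<open>cv u\<close>.\<close>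

lemma complex_plane_identities:
  assumes f: "free3 v u (cv u)"
    and \<kappa>: "B z \<kappa> = 0" and \<nu>: "B z (cv \<nu>) = 0"
    and e\<kappa>: "B e \<kappa> = \<alpha> *s v + \<beta> *s u" and \<nu>\<kappa>: "B \<nu> \<kappa> = h *s v"
    and e\<nu>: "B e (cv \<nu>) = \<alpha>' *s v + \<beta>' *s u"
    and p: "dot \<phi> v = 1" "dot \<phi> u = 0" "dot \<phi> (cv u) = 0"
    and q: "dot \<psi> v = 0" "dot \<psi> u = 1" "dot \<psi> (cv u) = 0"
    and r: "dot \<rho> v = 0" "dot \<rho> u = 0" "dot \<rho> (cv u) = 1"
  shows "h = - \<beta> * cnj \<beta>'" "\<beta> * dot \<rho> (L e) + \<alpha> + dot \<psi> (L e) * h = \<beta> * cnj \<alpha>'"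
    "\<beta> * dot \<phi> (L e) = dot \<psi> (L e) * \<alpha>"
proof -
  define c0 c1 c2 where "c0 = dot \<phi> (L e)" "c1 = dot \<psi> (L e)" "c2 = dot \<rho> (L e)"
  have \<nu>e: "B \<nu> (cv e) = cnj \<alpha>' *s v + cnj \<beta>' *s cv u"
    unfolding kernel_left_e[of \<nu>] e\<nu> by (simp add: cv_v)
  have "(h + \<beta> * cnj \<beta>') + of_real t * (\<beta> * c2 + \<alpha> + c1 * h - \<beta> * cnj \<alpha>')
      + of_real t ^ 2 * (c1 * \<alpha> - \<beta> * c0) + of_real t ^ 3 * 0 = 0" if t: "t \<noteq> 0" for t :: real
  proof -
    define x where "x = z + of_real t *s e + \<nu>"
    have R1: "B x (cv z) = v + of_real t *s cv u"
      by (simp add: x_def u_conj kernel_left[OF \<nu>])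
    have R2: "B x (cv e) = u + of_real t *s L e + (cnj \<alpha>' *s v + cnj \<beta>' *s cv u)"
      by (simp add: x_def \<nu>e)
    have R3: "B x \<kappa> = of_real t *s (\<alpha> *s v + \<beta> *s u) + h *s v"
      by (simp add: x_def \<kappa> e\<kappa> \<nu>\<kappa>)
    have "det3 (dot \<phi> (B x (cv z))) (dot \<psi> (B x (cv z))) (dot \<rho> (B x (cv z)))
      (dot \<phi> (B x (cv e))) (dot \<psi> (B x (cv e))) (dot \<rho> (B x (cv e)))
      (dot \<phi> (B x \<kappa>)) (dot \<psi> (B x \<kappa>)) (dot \<rho> (B x \<kappa>)) = 0"
      by (rule det3_levi_zero[OF rk])
    then have "- of_real t * ((h + \<beta> * cnj \<beta>') + of_real t * (\<beta> * c2 + \<alpha>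
        + c1 * h - \<beta> * cnj \<alpha>') + of_real t ^ 2 * (c1 * \<alpha> - \<beta> * c0)) = 0"
      unfolding R1 R2 R3 dot_simps p q r det3_def c0_c1_c2_def by (simp add: algebra_simps power2_eq_square)
    then show ?thesis using t by simp
  qed
  from poly3_zero[OF this] show "h = - \<beta> * cnj \<beta>'" "\<beta> * dot \<rho> (L e) + \<alpha> + dot \<psi> (L e) * h = \<beta> * cnj \<alpha>'"
    "\<beta> * dot \<phi> (L e) = dot \<psi> (L e) * \<alpha>" by (auto simp: c0_c1_c2_def algebra_simps eq_neg_iff_add_eq_0)
qed

text \<open>The identities force the kernel of \<open>B z\<close> to be a line. A generator
  \<open>\<kappa>\<close>, scaled so that \<open>B e \<kappa>\<close> has
  \<open>u\<close>-coefficient 1, gives \<open>y = cv \<kappa>\<close>, and shifting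
  \<open>e\<close> by a multiple of \<open>z\<close> normalizes the table.\<close>

lemma complex_plane:
  assumes w: "cv u \<notin> vec.span {v, u}" and \<kappa>1: "B z \<kappa>1 = 0" "\<kappa>1 \<noteq> 0"
  shows "\<exists>y e' u'. cross_table z y e' v u' (cv u')"
proof -
  have "free3 (cv u) v u"
  proof -
    have "u \<noteq> 0" using uv_indep[of 1 0] by auto
    moreover have "v \<notin> vec.span {u}" using uv_indep[of "- c" 1 for c] by (auto simp: in_span1)
    ultimately show ?thesis using w by (simp add: free3_iff)
  qed
  then have f: "free3 v u (cv u)" by (rule free3_rotate)
  obtain \<phi> where p: "dot \<phi> v = 1" "dot \<phi> u = 0" "dot \<phi> (cv u) = 0" using free3_dual[OF f] by blast
  obtain \<psi> where q: "dot \<psi> v = 0" "dot \<psi> u = 1" "dot \<psi> (cv u) = 0"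
    using free3_dual[OF free3_rotate[OF f]] by blast
  obtain \<rho> where r: "dot \<rho> v = 0" "dot \<rho> u = 0" "dot \<rho> (cv u) = 1"
    using free3_dual[OF free3_rotate[OF free3_rotate[OF f]]] by blast
  \<comment> \<open>\<open>B \<nu> \<kappa>\<close> lies in the plane of \<open>v\<close>,
    \<open>u\<close> and, by conjugation, in that of \<open>v\<close>, \<open>cv u\<close>; these
    meet in the line of \<open>v\<close>.\<close>
  have line: "\<exists>h. B \<nu> \<kappa> = h *s v" if \<kappa>: "B z \<kappa> = 0" and \<nu>: "B z (cv \<nu>) = 0" for \<nu> \<kappa>
  proof -
    obtain a b where ab: "B \<nu> \<kappa> = a *s v + b *s u" using image_kernel[OF \<kappa>] in_span2 by meson
    obtain c d where "B (cv \<kappa>) (cv \<nu>) = c *s v + d *s u" using image_kernel[OF \<nu>] in_span2 by meson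
    then have "cv (B (cv \<kappa>) (cv \<nu>)) = cnj c *s v + cnj d *s cv u" by (simp add: cv_v)
    then have "B \<nu> \<kappa> = cnj c *s v + cnj d *s cv u" by (simp add: cv_B)
    then have "dot \<psi> (B \<nu> \<kappa>) = 0" using q by simp
    then have "b = 0" using ab q by simp
    then show ?thesis using ab by auto
  qed
  note ids = complex_plane_identities[OF f _ _ _ _ _ p q r]
  have \<beta>_zero: "\<kappa> = 0" if \<kappa>: "B z \<kappa> = 0" and e\<kappa>: "B e \<kappa> = \<alpha> *s v" for \<kappa> \<alpha>
  proof (rule kernel_zero[OF \<kappa>])
    have "\<alpha> = 0" using ids(2)[OF \<kappa>, of 0 \<alpha> 0 0 0 0] e\<kappa> by simp
    then show "B e \<kappa> = 0" using e\<kappa> by simp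
    fix \<nu> assume \<nu>: "B z (cv \<nu>) = 0"
    obtain h where h: "B \<nu> \<kappa> = h *s v" using line[OF \<kappa> \<nu>] by blast
    obtain \<alpha>' \<beta>' where "B e (cv \<nu>) = \<alpha>' *s v + \<beta>' *s u" using image_kernel[OF \<nu>] in_span2 by meson
    then have "h = 0" using ids(1)[OF \<kappa> \<nu>, of \<alpha> 0 h] e\<kappa> h by simp
    then show "B \<nu> \<kappa> = 0" using h by simp
  qed
  obtain \<alpha>1 \<beta>1 where e\<kappa>1: "B e \<kappa>1 = \<alpha>1 *s v + \<beta>1 *s u" using image_kernel[OF \<kappa>1(1)] in_span2 by meson
  have "\<beta>1 \<noteq> 0" using \<beta>_zero[OF \<kappa>1(1)] e\<kappa>1 \<kappa>1(2) by fastforce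
  define \<kappa> where "\<kappa> = (1 / \<beta>1) *s \<kappa>1"
  define \<alpha> where "\<alpha> = \<alpha>1 / \<beta>1"
  have \<kappa>: "B z \<kappa> = 0" and e\<kappa>: "B e \<kappa> = \<alpha> *s v + 1 *s u"
    using \<kappa>1(1) e\<kappa>1 \<open>\<beta>1 \<noteq> 0\<close> by (auto simp: \<kappa>_def \<alpha>_def vector_add_ldistrib)
  define y where "y = cv \<kappa>"
  have y: "B z (cv y) = 0" "B e (cv y) = \<alpha> *s v + 1 *s u" using \<kappa> e\<kappa> by (simp_all add: y_def)
  obtain h where h: "B y \<kappa> = h *s v" using line[OF \<kappa> y(1)] by blast
  have h1: "h = - 1" using ids(1)[OF \<kappa> y(1) e\<kappa> h y(2)] by simp
  \<comment> \<open>A functional \<open>\<tau>\<close> detecting a fourth direction would make the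
    minor at \<open>z + e\<close> equal to -1.\<close>
  have E: "L e \<in> vec.span {v, u, cv u}"
  proof (rule ccontr)
    assume "L e \<notin> vec.span {v, u, cv u}"
    from exists_dot_separating[OF this] obtain \<tau> where t: "dot \<tau> v = 0" "dot \<tau> u
        = 0" "dot \<tau> (cv u) = 0" "dot \<tau> (L e) = 1"
      by auto
    have R: "B (z + e) (cv z) = v + cv u" "B (z + e) (cv e) = u + L e" "B (z + e) \<kappa> = \<alpha> *s v + 1 *s u"
      using u_conj \<kappa> e\<kappa> by simp_all
    have "det3 (dot \<phi> (B (z + e) (cv z))) (dot \<psi> (B (z + e) (cv z))) (dot \<tau> (B (z + e) (cv z)))
      (dot \<phi> (B (z + e) (cv e))) (dot \<psi> (B (z + e) (cv e))) (dot \<tau> (B (z + e) (cv e)))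
      (dot \<phi> (B (z + e) \<kappa>)) (dot \<psi> (B (z + e) \<kappa>)) (dot \<tau> (B (z + e) \<kappa>)) = 0"
      by (rule det3_levi_zero[OF rk])
    then show False unfolding R dot_simps p q t det3_def by simp
  qed
  then obtain c0 c1 c2 where E: "L e = c0 *s v + c1 *s u + c2 *s cv u" using in_span3 by meson
  have "cv (L e) = cnj c0 *s v + cnj c1 *s cv u + cnj c2 *s u" unfolding E by (simp add: cv_v)
  then have E': "L e = cnj c0 *s v + cnj c1 *s cv u + cnj c2 *s u" by (simp only: cv_L)
  have c1: "c1 = dot \<psi> (L e)" and c2: "c2 = dot \<rho> (L e)" and c0: "c0 = dot \<phi> (L e)" unfolding E using p q r by simp_all
  \<comment> \<open>Since conjugation fixes \<open>L e\<close>, its coefficients at \<open>u\<close>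
    and \<open>cv u\<close> are conjugate.\<close>
  have "dot \<rho> (L e) = cnj c1" unfolding E' using r by simp
  then have c2': "c2 = cnj c1" using c2 by simp
  have \<alpha>: "\<alpha> = - c2" using ids(2)[OF \<kappa> _ e\<kappa>, of 0 0 0 0] by (simp add: c2[symmetric] eq_neg_iff_add_eq_0 add.commute)
  have c0': "c0 = - c1 * c2" using ids(3)[OF \<kappa> _ e\<kappa>, of 0 0 0 0] \<alpha> by (simp add: c0[symmetric] c1[symmetric])
  \<comment> \<open>The shift completes the square: with \<open>c2 = cnj c1\<close> and
    \<open>c0 = - c1 * c2\<close> it makes \<open>B e' (cv e')\<close> vanish, and
    \<open>\<alpha> = - c2\<close> makes \<open>B e' (cv y)\<close> equal to
    \<open>u'\<close>.\<close>
  define e' where "e' = e - c1 *s z"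
  define u' where "u' = u - c2 *s v"
  have cve': "cv e' = cv e - c2 *s cv z" by (simp add: e'_def c2')
  have cvu': "cv u' = cv u - c1 *s v" by (simp add: u'_def c2' cv_v)
  have f': "free3 v u' (cv u')" unfolding free3_def
  proof (intro allI impI)
    fix a b c assume "a *s v + b *s u' + c *s cv u' = 0"
    then have 0: "a *s v + b *s u - (b * c2) *s v + c *s cv u - (c * c1) *s v = 0"
      unfolding u'_def[symmetric] cvu' by (simp add: u'_def vector_ssub_ldistrib algebra_simps)
    have "b = 0" using arg_cong[OF 0, of "dot \<psi>"] q by simp
    moreover have "c = 0" using arg_cong[OF 0, of "dot \<rho>"] r by simp
    moreover have "a = 0" using arg_cong[OF 0, of "dot \<phi>"] p calculation by simp
    ultimately show "a = 0 \<and> b = 0 \<and> c = 0" by simp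
  qed
  have ez: "B e' (cv z) = cv u'" unfolding e'_def cvu' by (simp add: u_conj)
  have ey: "B e' (cv y) = u'" unfolding e'_def u'_def using y \<alpha> by simp
  have ee: "B e' (cv e') = 0"
  proof -
    have "B e' (cv e') = L e - c2 *s cv u - c1 *s u + (c1 * c2) *s v"
      unfolding cve' by (simp add: e'_def u_conj algebra_simps)
    also have "\<dots> = 0" unfolding E c0' by (simp add: vec_eq_iff algebra_simps)
    finally show ?thesis .
  qed
  have ye: "B y (cv e') = cv u'" using cv_B[of e' "cv y"] ey by simp
  have ze: "B z (cv e') = u'" unfolding cve' u'_def by simp
  have dec: "\<exists>p q r. \<zeta> = p *s cv z + q *s cv y + r *s cv e'" for \<zeta>
  proof -
    obtain s t where d: "B z (\<zeta> - s *s cv z - t *s cv e) = 0" using decompose by blast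
    let ?k = "\<zeta> - s *s cv z - t *s cv e"
    obtain a b where ab: "B e ?k = a *s v + b *s u" using image_kernel[OF d] in_span2 by meson
    have "?k - b *s \<kappa> = 0"
    proof (rule \<beta>_zero)
      show "B z (?k - b *s \<kappa>) = 0" using d \<kappa> by simp
      have "B e (?k - b *s \<kappa>) = B e ?k - b *s B e \<kappa>" by (simp only: levi_simps)
      then show "B e (?k - b *s \<kappa>) = (a - b * \<alpha>) *s v" unfolding ab e\<kappa> by (simp add: vec_eq_iff algebra_simps)
    qed
    then have "\<zeta> = s *s cv z + t *s cv e + b *s \<kappa>" by (simp add: algebra_simps)
    also have "\<dots> = (s + t * c2) *s cv z + b *s cv y + t *s cv e'"
      by (simp add: cve' y_def vec_eq_iff algebra_simps)
    finally show ?thesis by blast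
  qed
  have "cross_table z y e' v u' (cv u')"
    unfolding cross_table_def using f' ez ey ee ye ze y(1) kernel_left[OF y(1)] h h1 dec by (simp add: y_def)
  then show ?thesis by blast
qed

end

section \<open>Vanishing of \<open>a\<close> for \<open>n\<close> or \<open>k\<close> at most
  three\<close>

context levi_prolongation begin

text \<open>Each of \<open>v\<close>, \<open>u\<close>, \<open>w\<close>, \<open>v + u\<close>,
  \<open>v + w\<close>, \<open>u + w\<close> is a value of \<open>B\<close> at two base points whose
  kernels meet only in 0. By \<open>a_null\<close> both kernels contain the value of
  \<open>a\<close> at that vector taken twice, and these six values determine a symmetric bilinear
  map on the span.\<close>

lemma a_zero_if_cross:
  assumes "cross_table x y e v u w"
  shows "a s t = 0"
proof -
  have f: "free3 v u w" and xx: "B x (cv x) = v" and xy: "B x (cv y) = 0" and xe: "B x (cv e) = u"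
    and yx: "B y (cv x) = 0" and yy: "B y (cv y) = - v" and ye: "B y (cv e) = w"
    and ex: "B e (cv x) = w" and ey: "B e (cv y) = u" and ee: "B e (cv e) = 0"
    and dec: "\<And>\<zeta>. \<exists>p q r. \<zeta> = p *s cv x + q *s cv y + r *s cv e"
    using assms unfolding cross_table_def by auto
  note table = xx xy xe yx yy ye ex ey ee
  have indep: "p = 0" "q = 0" "r = 0" if "p *s v + q *s u + r *s w = 0" for p q r
    using f that unfolding free3_def by auto
  \<comment> \<open>The hypothesis \<open>n\<close> expresses in coordinates that the two kernels
    meet only in 0.\<close>
  have zero: "\<zeta> = 0" if z: "B (p1 *s x + p2 *s y + p3 *s e) \<zeta> = 0" "B (q1 *s x + q2 *s y + q3 *s e) \<zeta> = 0"
    and n: "\<And>r1 r2 r3. p1 * r1 = p2 * r2 \<Longrightarrow> p1 * r3 + p3 * r2 = 0 \<Longrightarrow> p2 * r3 + p3 * r1 = 0 \<Longrightarrow>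
       q1 * r1 = q2 * r2 \<Longrightarrow> q1 * r3 + q3 * r2 = 0 \<Longrightarrow> q2 * r3 + q3 * r1 = 0 \<Longrightarrow> r1 = 0 \<and> r2 = 0 \<and> r3 = 0"
    for p1 p2 p3 q1 q2 q3 \<zeta>
  proof -
    obtain r1 r2 r3 where \<zeta>: "\<zeta> = r1 *s cv x + r2 *s cv y + r3 *s cv e" using dec by blast
    have e: "B (p1 *s x + p2 *s y + p3 *s e) \<zeta> = (p1 * r1 - p2 * r2) *s v + (p1 * r3 + p3 * r2) *s u + (p2 * r3
        + p3 * r1) *s w"
      for p1 p2 p3 unfolding \<zeta> by (simp add: table vec_eq_iff algebra_simps)
    have "r1 = 0 \<and> r2 = 0 \<and> r3 = 0"
      by (rule n) (use indep[OF z(1)[unfolded e]] indep[OF z(2)[unfolded e]] in auto)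
    then show ?thesis using \<zeta> by simp
  qed
  have van: "a t t = 0" if "t = B (p1 *s x + p2 *s y + p3 *s e) \<zeta>" "t = B (q1 *s x + q2 *s y + q3 *s e) \<eta>"
    and n: "\<And>r1 r2 r3. p1 * r1 = p2 * r2 \<Longrightarrow> p1 * r3 + p3 * r2 = 0 \<Longrightarrow> p2 * r3 + p3 * r1 = 0 \<Longrightarrow>
       q1 * r1 = q2 * r2 \<Longrightarrow> q1 * r3 + q3 * r2 = 0 \<Longrightarrow> q2 * r3 + q3 * r1 = 0 \<Longrightarrow> r1 = 0 \<and> r2 = 0 \<and> r3 = 0"
    for t \<zeta> \<eta> p1 p2 p3 q1 q2 q3
    by (rule zero[of p1 p2 p3 _ q1 q2 q3]) (use that a_null in metis, use that a_null in metis, use n in blast)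
  \<comment> \<open>The parameters give, twice, the coordinates of a base point followed by the
    right argument that produces the vector.\<close>
  have vv: "a v v = 0" by (rule van[of _ 1 0 0 "cv x" 0 1 0 "- cv y"]) (simp_all add: table)
  have uu: "a u u = 0" by (rule van[of _ 1 0 0 "cv e" 0 0 1 "cv y"]) (simp_all add: table)
  have ww: "a w w = 0" by (rule van[of _ 0 1 0 "cv e" 0 0 1 "cv x"]) (simp_all add: table)
  have "a (v + u) (v + u) = 0" by (rule van[of _ 1 0 0 "cv x + cv e" 0 "-1" 1 "cv y"]) (simp_all add: table)
  then have vu: "a v u + a u v = 0" using vv uu by (simp add: add.commute)
  have "a (v + w) (v + w) = 0" by (rule van[of _ 0 1 0 "- cv y + cv e" 1 0 1 "cv x"]) (simp_all add: table)
  then have vw: "a v w + a w v = 0" using vv ww by (simp add: add.commute)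
  have "a (u + w) (u + w) = 0" by (rule van[of _ 0 0 1 "cv y + cv x" 1 1 0 "cv e"]) (simp_all add: table)
  then have uw: "a u w + a w u = 0" using uu ww by (simp add: add.commute)
  have half: "a p q = 0" "a q p = 0" if "a p q + a q p = 0" for p q
    using eq_0_if_add_sub_0[OF that] a_sym[of p q] by simp_all
  have span: "B z \<zeta> \<in> vec.span {v, u, w}" for z \<zeta>
  proof -
    obtain p1 p2 p3 where "cv z = p1 *s cv x + p2 *s cv y + p3 *s cv e" using dec by blast
    then have "cv (cv z) = cv (p1 *s cv x + p2 *s cv y + p3 *s cv e)" by simp
    then have z: "z = cnj p1 *s x + cnj p2 *s y + cnj p3 *s e" by simp
    obtain r1 r2 r3 where \<zeta>: "\<zeta> = r1 *s cv x + r2 *s cv y + r3 *s cv e" using dec by blast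
    have "B z \<zeta> = (cnj p1 * r1 - cnj p2 * r2) *s v + (cnj p1 * r3 + cnj p3 * r2) *s u + (cnj p2 * r3
        + cnj p3 * r1) *s w"
      unfolding z \<zeta> by (simp add: table vec_eq_iff algebra_simps)
    then show ?thesis unfolding in_span3 by blast
  qed
  have "a p q = 0" if "p \<in> {v, u, w}" "q \<in> {v, u, w}" for p q
    using that vv uu ww half[OF vu] half[OF vw] half[OF uw] by auto
  then have "a (B z \<zeta>) (B z' \<zeta>') = 0" for z \<zeta> z' \<zeta>' using a_span_zero[of "{v, u, w}"] span by blast
  then show ?thesis by (rule a_zero_if_levi_zero)
qed

text \<open>If \<open>a\<close> were nonzero, no \<open>B z\<close> would be injective or
  surjective, so all ranks are at most two. A point of rank two with \<open>L z\<close> nonzero then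
  yields either an injective \<open>B z\<close> or the cross product table, and both are
  excluded.\<close>

lemma a_zero_if_small:
  assumes "CARD('n) \<le> 3 \<or> CARD('k) \<le> 3"
  shows "a s t = 0"
proof (rule ccontr)
  assume nz: "a s t \<noteq> 0"
  have ninj: "\<exists>\<kappa>. \<kappa> \<noteq> 0 \<and> B z \<kappa> = 0" for z using a_zero_if_inj[of z s t] nz by blast
  have nsurj: "\<exists>w. \<forall>\<zeta>. B z \<zeta> \<noteq> w" for z using a_zero_if_surj[of z s t] nz by blast
  have rk: "\<not> free3 (B x p) (B x q) (B x r)" for x p q r
    using not_free3_if_not_inj not_free3_if_not_surj ninj[of x] nsurj[of x] assms by metis
  obtain z p where "L z \<noteq> 0" "B z p \<notin> vec.span {L z}" using exists_rank_two[OF nsurj] by blast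
  then interpret levi_rank_two H z "cv p"
    by unfold_locales (use rk in auto)
  obtain \<kappa> where \<kappa>: "\<kappa> \<noteq> 0" "B z \<kappa> = 0" using ninj by blast
  have "cv u \<notin> vec.span {v, u}" using real_plane_impossible nsurj \<kappa> by metis
  from complex_plane[OF this \<kappa>(2,1)] a_zero_if_cross nz show False by blast
qed

end

section \<open>Codimension at least \<open>n^2 - n\<close>\<close>

context levi_form begin

lemma levi_eq_sum: "levi H z \<zeta> $ j = (\<Sum>\<alpha>\<in>UNIV. \<Sum>\<beta>\<in>UNIV. H j $ \<alpha> $ \<beta> * (\<zeta> $ \<alpha> * z $ \<beta>))"
  by (simp add: levi_def matrix_vector_mult_def sum_distrib_right sum_distrib_left algebra_simps)

text \<open>If every \<open>B z\<close> had a kernel vector \<open>\<zeta>\<^sub>z\<close>, the annihilator of the \<open>H j\<close>, of dimension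
  \<open>n\<^sup>2 - k \<le> n\<close>, would contain all the rank-one matrices \<open>\<zeta>\<^sub>z z\<^sup>T\<close>. Those at the unit vectors
  would span it, and comparison with the one at \<open>(1, \<dots>, 1)\<close> shows that all \<open>\<zeta>\<^sub>z\<close> are parallel.\<close>

lemma exists_inj_if_large:
  assumes large: "CARD('n)\<^sup>2 - CARD('n) \<le> CARD('k)"
  shows "\<exists>z. \<forall>\<zeta>. B z \<zeta> = 0 \<longrightarrow> \<zeta> = 0"
proof (rule ccontr)
  assume "\<not> ?thesis"
  then have "\<forall>z. \<exists>\<zeta>. \<zeta> \<noteq> 0 \<and> B z \<zeta> = 0" by blast
  then obtain \<zeta> where \<zeta>: "\<And>z. \<zeta> z \<noteq> 0" "\<And>z. B z (\<zeta> z) = 0" by metis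
  \<comment> \<open>\<open>T\<close> extends \<open>B\<close> from the rank-one matrices
    \<open>rk1 z y\<close> to a linear map on all matrices.\<close>
  define T where "T = (\<lambda>M :: complex^'n^'n. (\<chi> j. \<Sum>\<alpha>\<in>UNIV. \<Sum>\<beta>\<in>UNIV. H j $ \<alpha> $ \<beta> * M $ \<alpha> $ \<beta>) :: complex^'k)"
  define rk1 where "rk1 = (\<lambda>z \<zeta>. (\<chi> \<alpha> \<beta>. \<zeta> $ \<alpha> * z $ \<beta>) :: complex^'n^'n)"
  define sc where "sc = (\<lambda>c (M :: complex^'n^'n). (\<chi> \<alpha> \<beta>. c * M $ \<alpha> $ \<beta>))"
  have T_rk1: "T (rk1 z y) = B z y" for z y
    by (simp add: T_def rk1_def vec_eq_iff levi_eq_sum)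
  have T_add: "T (M + N) = T M + T N" for M N
    by (simp add: T_def vec_eq_iff sum.distrib distrib_left)
  have T_sc: "T (sc c M) = c *s T M" for c M
    by (simp add: T_def sc_def vec_eq_iff sum_distrib_left algebra_simps)
  have T_0: "T 0 = 0" by (simp add: T_def vec_eq_iff)
  have T_sum: "T (\<Sum>i\<in>I. f i) = (\<Sum>i\<in>I. T (f i))" for f and I :: "'i set"
    by (induction I rule: infinite_finite_induct) (simp_all add: T_0 T_add)
  have "\<exists>M. T M = w" for w
  proof -
    have "w \<in> vec.span {B z \<zeta> |z \<zeta>. True}" by (simp only: span_levi UNIV_I)
    then show ?thesis
    proof (induction rule: vec.span_induct_alt)
      case base
      show ?case using T_0 by blast
    next
      case (step c x y)
      then show ?case using T_rk1 T_sc T_add by (smt (verit) mem_Collect_eq)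
    qed
  qed
  then obtain l where l: "\<And>w. T (l w) = w" by metis
  let ?one = "(\<chi> i. 1) :: complex^'n"
  \<comment> \<open>The components parametrize the kernel matrices at the unit vectors, the one at
    the all-ones vector, and a section of \<open>T\<close>. Injectivity of \<open>g\<close> then
    bounds \<open>n + 1 + k\<close> by \<open>n^2\<close>, against \<open>large\<close>.\<close>
  define g where "g = (\<lambda>(c :: complex^'n, c' :: complex, d :: complex^'k).
     (\<chi> \<alpha> \<beta>. c $ \<beta> * \<zeta> (axis \<beta> 1) $ \<alpha>) + sc c' (rk1 ?one (\<zeta> ?one)) + (\<Sum>j\<in>UNIV. sc (d $ j) (l (axis j 1))))"
  have units: "(\<chi> \<alpha> \<beta>. c $ \<beta> * \<zeta> (axis \<beta> 1) $ \<alpha>)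
      = (\<Sum>i\<in>UNIV. sc (c $ i) (rk1 (axis i 1) (\<zeta> (axis i 1))))" for c :: "complex^'n"
  proof -
    have "c $ \<beta> * \<zeta> (axis \<beta> 1) $ \<alpha> = (\<Sum>i\<in>UNIV. if i = \<beta> then c $ i * \<zeta> (axis i 1) $ \<alpha> else 0)" for \<alpha> \<beta>
      by simp
    also have "\<dots> \<alpha> \<beta> = (\<Sum>i\<in>UNIV. c $ i * (\<zeta> (axis i 1) $ \<alpha> * axis i 1 $ \<beta>))" for \<alpha> \<beta>
      by (intro sum.cong) (auto simp: axis_def)
    finally show ?thesis by (simp add: vec_eq_iff sc_def rk1_def)
  qed
  have Tg: "T (g (c, c', d)) = d" for c c' d
  proof -
    have "T (g (c, c', d)) = (\<Sum>j\<in>UNIV. d $ j *s axis j 1)"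
      by (simp add: g_def units T_add T_sum T_sc T_rk1 \<zeta> l)
    then show ?thesis by (simp add: basis_expansion)
  qed
  have lin: "linear g"
    by (rule linearI) (auto simp: g_def sc_def vec_eq_iff algebra_simps sum.distrib scaleR_sum_right)
  have "inj g"
  proof (rule linear_injective_0[OF lin, THEN iffD2], intro allI impI)
    fix p assume p: "g p = 0"
    obtain c c' d where p': "p = (c, c', d)" by (cases p) auto
    have d: "d = 0" using Tg[of c c' d] p p' T_0 by simp
    have e: "c $ \<beta> * \<zeta> (axis \<beta> 1) $ \<alpha> + c' * \<zeta> ?one $ \<alpha> = 0" for \<alpha> \<beta>
      using p by (simp add: p' g_def d sc_def rk1_def vec_eq_iff)
    \<comment> \<open>If \<open>c'\<close> is nonzero, \<open>\<zeta> ?one\<close> is a multiple of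
      each \<open>\<zeta> (axis \<beta> 1)\<close>, hence killed by every
      \<open>B (axis \<beta> 1)\<close>, against \<open>right_nondeg\<close>.\<close>
    have c': "c' = 0"
    proof (rule ccontr)
      assume c': "c' \<noteq> 0"
      have 1: "c' *s \<zeta> ?one = (- c $ \<beta>) *s \<zeta> (axis \<beta> 1)" for \<beta>
        using e[of \<beta>] by (simp add: vec_eq_iff eq_neg_iff_add_eq_0 add.commute)
      have "c' *s B (axis \<beta> 1) (\<zeta> ?one) = 0" for \<beta>
        using arg_cong[OF 1[of \<beta>], of "B (axis \<beta> 1)"] by (simp add: \<zeta>)
      then have 2: "B (axis \<beta> 1) (\<zeta> ?one) = 0" for \<beta>
        using c' by (simp add: vec.scale_eq_0_iff)
      have sum: "levi H (\<Sum>i\<in>I. f i) y = (\<Sum>i\<in>I. B (f i) y)" for f y and I :: "'n set"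
        by (induction I rule: infinite_finite_induct) simp_all
      have "B z (\<zeta> ?one) = 0" for z
      proof -
        have "B z (\<zeta> ?one) = B (\<Sum>i\<in>UNIV. z $ i *s axis i 1) (\<zeta> ?one)" by (simp add: basis_expansion)
        then show ?thesis by (simp only: sum levi_simps 2) simp
      qed
      then show False using right_nondeg \<zeta> by blast
    qed
    have "c $ \<beta> = 0" for \<beta>
    proof -
      obtain \<alpha> where "\<zeta> (axis \<beta> 1) $ \<alpha> \<noteq> 0" using \<zeta>(1)[of "axis \<beta> 1"] by (auto simp: vec_eq_iff)
      then show ?thesis using e[of \<beta> \<alpha>] c' by simp
    qed
    then show "p = 0" using p' c' d by (simp add: vec_eq_iff zero_prod_def)
  qed
  then have "dim (g ` UNIV) = dim (UNIV :: ((complex^'n) \<times> complex \<times> (complex^'k)) set)"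
    by (intro dim_image_eq[OF lin]) simp
  moreover have "dim (g ` UNIV) \<le> DIM(complex^'n^'n)" by (rule dim_subset_UNIV)
  ultimately have "CARD('n) + CARD('k) + 1 \<le> CARD('n)\<^sup>2" by (simp add: power2_eq_square)
  then show False using large by linarith
qed

end

lemma (in levi_prolongation) a_zero:
  assumes "CARD('n) \<le> 3 \<or> CARD('k) \<le> 3 \<or> CARD('n)\<^sup>2 - CARD('n) \<le> CARD('k)"
  shows "a s t = 0"
  using assms a_zero_if_small exists_inj_if_large a_zero_if_inj by metis

section \<open>Polynomial functions and directional derivatives\<close>

text \<open>Conjugation is not among the generators, so these are the holomorphic polynomials; the
  inductive form lets the rules for derivatives be proved by structural induction.\<close>

inductive polyf :: "((complex^'n::finite) \<times> (complex^'k::finite) \<Rightarrow> complex) \<Rightarrow> bool" where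
  polyf_const: "polyf (\<lambda>_. c)"
| polyf_fst: "polyf (\<lambda>p. fst p $ \<alpha>)"
| polyf_snd: "polyf (\<lambda>p. snd p $ j)"
| polyf_add: "polyf f \<Longrightarrow> polyf g \<Longrightarrow> polyf (\<lambda>p. f p + g p)"
| polyf_mult: "polyf f \<Longrightarrow> polyf g \<Longrightarrow> polyf (\<lambda>p. f p * g p)"

lemma polyf_minus: "polyf f \<Longrightarrow> polyf (\<lambda>p. - f p)"
  using polyf_mult[OF polyf_const[of "-1"]] by fastforce

lemma polyf_diff: "polyf f \<Longrightarrow> polyf g \<Longrightarrow> polyf (\<lambda>p. f p - g p)"
  using polyf_add[OF _ polyf_minus] by fastforce

lemma polyf_sum: "(\<And>i. i \<in> I \<Longrightarrow> polyf (f i)) \<Longrightarrow> polyf (\<lambda>p. \<Sum>i\<in>I. f i p)"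
  by (induction I rule: infinite_finite_induct) (auto intro: polyf.intros)

lemma polyf_prod: "(\<And>i. i \<in> I \<Longrightarrow> polyf (f i)) \<Longrightarrow> polyf (\<lambda>p. \<Prod>i\<in>I. f i p)"
  by (induction I rule: infinite_finite_induct) (auto intro: polyf.intros)

lemma polyf_power: "polyf f \<Longrightarrow> polyf (\<lambda>p. f p ^ m)"
  by (induction m) (auto intro: polyf.intros)

lemmas polyf_intros = polyf.intros polyf_minus polyf_diff polyf_sum polyf_prod polyf_power

lemma polyf_zw_monomial: "polyf (zw_monomial ab)"
proof -
  obtain a b where "ab = (a, b)" by (cases ab)
  then have "zw_monomial ab = (\<lambda>p. (\<Prod>\<alpha>\<in>UNIV. fst p $ \<alpha> ^ a \<alpha>) * (\<Prod>j\<in>UNIV. snd p $ j ^ b j))"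
    by (auto simp: zw_monomial_def)
  then show ?thesis by (simp add: polyf_intros)
qed

lemma polyf_comp:
  assumes "polyf g" "\<And>\<alpha>. polyf (\<lambda>p. fst (G p) $ \<alpha>)" "\<And>j. polyf (\<lambda>p. snd (G p) $ j)"
  shows "polyf (\<lambda>p. g (G p))"
  using assms(1) by induction (auto intro: polyf_intros assms(2,3))

lemma polyf_cnj: "polyf g \<Longrightarrow> polyf (\<lambda>p. cnj (g (cv (fst p), cv (snd p))))"
  by (induction rule: polyf.induct) (simp_all add: polyf_intros)

definition polyc :: "(complex \<Rightarrow> complex) \<Rightarrow> bool" where
  "polyc g \<longleftrightarrow> (\<exists>q. \<forall>t. g t = poly q t)"

lemma polyc_const: "polyc (\<lambda>_. c)"
  unfolding polyc_def by (rule exI[of _ "[:c:]"]) simp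

lemma polyc_id: "polyc (\<lambda>t. t)"
  unfolding polyc_def by (rule exI[of _ "[:0, 1:]"]) simp

lemma polyc_add: "polyc f \<Longrightarrow> polyc g \<Longrightarrow> polyc (\<lambda>t. f t + g t)"
  unfolding polyc_def by (metis poly_add)

lemma polyc_mult: "polyc f \<Longrightarrow> polyc g \<Longrightarrow> polyc (\<lambda>t. f t * g t)"
  unfolding polyc_def by (metis poly_mult)

lemma polyc_diff: "polyc f \<Longrightarrow> polyc g \<Longrightarrow> polyc (\<lambda>t. f t - g t)"
  unfolding polyc_def by (metis poly_diff)

lemma polyc_power: "polyc f \<Longrightarrow> polyc (\<lambda>t. f t ^ m)"
  by (induction m) (auto intro: polyc_const polyc_mult)

lemma polyc_sum: "(\<And>i. i \<in> I \<Longrightarrow> polyc (f i)) \<Longrightarrow> polyc (\<lambda>p. \<Sum>i\<in>I. f i p)"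
  by (induction I rule: infinite_finite_induct) (auto intro: polyc_const polyc_add)

lemmas polyc_intros = polyc_const polyc_id polyc_add polyc_mult polyc_diff polyc_power polyc_sum

lemma polyc_comp:
  assumes "polyf g" "\<And>\<alpha>. polyc (\<lambda>t. x t $ \<alpha>)" "\<And>j. polyc (\<lambda>t. y t $ j)"
  shows "polyc (\<lambda>t. g (x t, y t))"
  using assms(1) by induction (auto intro: polyc_intros assms(2,3))

text \<open>The polynomial has infinitely many real zeros near 0.\<close>

lemma polyc_zero:
  assumes "polyc g" "\<forall>\<^sub>F t :: real in at 0. g (of_real t) = 0"
  shows "g t = 0"
proof -
  obtain q where q: "\<And>t. g t = poly q t" using assms(1) unfolding polyc_def by blast
  obtain d where d: "d > 0" "\<And>t :: real. t \<noteq> 0 \<Longrightarrow> \<bar>t\<bar> < d \<Longrightarrow> g (of_real t) = 0"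
    using assms(2) unfolding eventually_at by (auto simp: dist_real_def)
  have "complex_of_real ` {0<..<d} \<subseteq> {t. poly q t = 0}"
    using d(2) q by auto
  moreover have "infinite (complex_of_real ` {0<..<d})"
    using d(1) by (subst finite_image_iff) (auto simp: inj_on_def)
  ultimately have "q = 0" using poly_roots_finite finite_subset by blast
  then show ?thesis using q by simp
qed

section \<open>Directional derivatives and Taylor formulas along lines\<close>

definition ddir :: "'v::real_normed_vector \<Rightarrow> ('v \<Rightarrow> complex) \<Rightarrow> 'v \<Rightarrow> complex" where
  "ddir x g p = frechet_derivative g (at p) x"

lemma ddir_eq: "(g has_derivative g') (at p) \<Longrightarrow> ddir x g p = g' x"
  unfolding ddir_def using frechet_derivative_at by metis

lemma has_derivative_fst_nth: "((\<lambda>p. fst p $ \<alpha>) has_derivative (\<lambda>x. fst x $ \<alpha>)) (at p)"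
  by (rule bounded_linear_imp_has_derivative)
     (rule bounded_linear_compose[OF bounded_linear_vec_nth bounded_linear_fst])

lemma has_derivative_snd_nth: "((\<lambda>p. snd p $ \<alpha>) has_derivative (\<lambda>x. snd x $ \<alpha>)) (at p)"
  by (rule bounded_linear_imp_has_derivative)
     (rule bounded_linear_compose[OF bounded_linear_vec_nth bounded_linear_snd])

lemma polyf_differentiable: "polyf g \<Longrightarrow> g differentiable (at p)"
proof (induction rule: polyf.induct)
  case (polyf_fst \<alpha>)
  then show ?case using has_derivative_fst_nth differentiable_def by blast
next
  case (polyf_snd j)
  then show ?case using has_derivative_snd_nth differentiable_def by blast
qed (auto intro: differentiable_add differentiable_mult)

lemma polyf_has_derivative: "polyf g \<Longrightarrow> (g has_derivative (\<lambda>x. ddir x g p)) (at p)"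
  using polyf_differentiable[of g p] frechet_derivative_works unfolding ddir_def by metis

lemma ddir_const: "ddir x (\<lambda>_. c) = (\<lambda>_. 0)"
  by (rule ext) (rule ddir_eq[OF has_derivative_const])

lemma ddir_fst: "ddir x (\<lambda>p. fst p $ \<alpha>) = (\<lambda>_. fst x $ \<alpha>)"
  by (rule ext) (rule ddir_eq[OF has_derivative_fst_nth])

lemma ddir_snd: "ddir x (\<lambda>p. snd p $ \<alpha>) = (\<lambda>_. snd x $ \<alpha>)"
  by (rule ext) (rule ddir_eq[OF has_derivative_snd_nth])

lemma ddir_add: "polyf f \<Longrightarrow> polyf g \<Longrightarrow> ddir x (\<lambda>p. f p + g p) = (\<lambda>p. ddir x f p + ddir x g p)"
  by (rule ext) (rule ddir_eq[OF has_derivative_add[OF polyf_has_derivative polyf_has_derivative]])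

lemma ddir_mult: "polyf f \<Longrightarrow> polyf g \<Longrightarrow> ddir x (\<lambda>p. f p * g p) = (\<lambda>p. f p * ddir x g p + ddir x f p * g p)"
  by (rule ext) (rule ddir_eq[OF has_derivative_mult[OF polyf_has_derivative polyf_has_derivative]])

lemma polyf_ddir: "polyf g \<Longrightarrow> polyf (ddir x g)"
  by (induction rule: polyf.induct)
     (auto simp: ddir_const ddir_fst ddir_snd ddir_add ddir_mult intro: polyf_intros)

lemma ddir_commute: "polyf g \<Longrightarrow> ddir x (ddir y g) = ddir y (ddir x g)"
  by (induction rule: polyf.induct)
     (auto simp: ddir_const ddir_fst ddir_snd ddir_add ddir_mult polyf_ddir polyf_intros algebra_simps)

lemma ddir_add_dir: "polyf g \<Longrightarrow> ddir (x + y) g = (\<lambda>p. ddir x g p + ddir y g p)"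
  by (rule ext) (use has_derivative_bounded_linear[OF polyf_has_derivative] linear_add bounded_linear.linear in blast)

text \<open>This is the Cauchy-Riemann condition, which passes from the generators of
  \<open>polyf\<close> to sums and products.\<close>

lemma ddir_cscale: "polyf g \<Longrightarrow> ddir (cscale c x) g = (\<lambda>p. c * ddir x g p)"
  by (induction rule: polyf.induct)
     (auto simp: ddir_const ddir_fst ddir_snd ddir_add ddir_mult polyf_intros algebra_simps cscale_def split: prod.split)

lemma ddir_cmult: "polyf g \<Longrightarrow> ddir x (\<lambda>p. c * g p) = (\<lambda>p. c * ddir x g p)"
  using ddir_mult[OF polyf_const, of g x c] by (simp add: ddir_const)

lemma ddir_sum:
  "finite I \<Longrightarrow> (\<And>i. i \<in> I \<Longrightarrow> polyf (f i)) \<Longrightarrow> ddir x (\<lambda>p. \<Sum>i\<in>I. f i p) = (\<lambda>p. \<Sum>i\<in>I. ddir x (f i) p)"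
  by (induction I rule: finite_induct) (simp_all add: ddir_const ddir_add polyf_sum)

lemma ddir_line:
  assumes "polyf g"
  shows "((\<lambda>s::real. g (p + s *\<^sub>R x)) has_vector_derivative ddir x g (p + s *\<^sub>R x)) (at s)"
proof -
  have "((\<lambda>s::real. p + s *\<^sub>R x) has_derivative (\<lambda>h. h *\<^sub>R x)) (at s)"
    by (auto intro!: derivative_eq_intros)
  from has_derivative_compose[OF this polyf_has_derivative[OF assms]]
  have "((\<lambda>s. g (p + s *\<^sub>R x)) has_derivative (\<lambda>h. ddir (h *\<^sub>R x) g (p + s *\<^sub>R x))) (at s)" .
  moreover have "ddir (h *\<^sub>R x) g (p + s *\<^sub>R x) = h *\<^sub>R ddir x g (p + s *\<^sub>R x)" for h
    using has_derivative_bounded_linear[OF polyf_has_derivative[OF assms]] linear_cmul bounded_linear.linear by blast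
  ultimately show ?thesis by (simp add: has_vector_derivative_def)
qed

lemma ddir_shift:
  assumes "polyf g"
  shows "ddir x (\<lambda>p. g (p + q)) p = ddir x g (p + q)"
proof -
  have "((\<lambda>p. p + q) has_derivative (\<lambda>h. h)) (at p)"
    by (auto intro!: derivative_eq_intros)
  from has_derivative_compose[OF this polyf_has_derivative[OF assms]] show ?thesis
    by (rule ddir_eq)
qed

lemma ddir_zero_on_line:
  assumes "polyf g" "\<And>s::real. g (p + s *\<^sub>R x) = 0"
  shows "ddir x g p = 0"
proof -
  have "((\<lambda>s::real. g (p + s *\<^sub>R x)) has_vector_derivative ddir x g (p + 0 *\<^sub>R x)) (at 0)"
    by (rule ddir_line[OF assms(1)])
  then have "((\<lambda>s::real. 0) has_vector_derivative ddir x g p) (at 0)" using assms(2) by simp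
  then show ?thesis using vector_derivative_unique_at has_vector_derivative_const by metis
qed

lemma constant_on_line:
  assumes "polyf g" "\<And>p. ddir x g p = 0"
  shows "g (p + s *\<^sub>R x) = g p"
proof -
  have "((\<lambda>s::real. g (p + s *\<^sub>R x)) has_derivative (\<lambda>h. 0)) (at s within UNIV)" for s
    using ddir_line[OF assms(1), of p x s] assms(2) by (simp add: has_vector_derivative_def)
  then obtain c where "\<And>s. g (p + s *\<^sub>R x) = c"
    using has_derivative_zero_constant[of UNIV "\<lambda>s::real. g (p + s *\<^sub>R x)"] by auto
  then show ?thesis by (metis add.right_neutral scaleR_zero_left)
qed

lemma affine_on_line:
  assumes g: "polyf g" and z: "\<And>p. ddir x (ddir x g) p = 0"
  shows "g (p + s *\<^sub>R x) = g p + of_real s * ddir x g p"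
proof -
  have c: "ddir x g (p + s *\<^sub>R x) = ddir x g p" for s
    by (rule constant_on_line[OF polyf_ddir[OF g] z])
  have "((\<lambda>s::real. g (p + s *\<^sub>R x) - of_real s * ddir x g p) has_derivative (\<lambda>h. 0)) (at s within UNIV)" for s
    using ddir_line[OF g, of p x s] unfolding c has_vector_derivative_def
    by (auto intro!: derivative_eq_intros simp: scaleR_conv_of_real)
  then obtain k where k: "\<And>s. g (p + s *\<^sub>R x) - of_real s * ddir x g p = k"
    using has_derivative_zero_constant[of UNIV "\<lambda>s::real. g (p + s *\<^sub>R x) - of_real s * ddir x g p"] by auto
  show ?thesis using k[of s] k[of 0] by (simp add: algebra_simps)
qed

lemma quadratic_on_line:
  assumes g: "polyf g" and z: "\<And>p. ddir x (ddir x (ddir x g)) p = 0"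
  shows "g (p + s *\<^sub>R x) = g p + of_real s * ddir x g p + of_real s ^ 2 * (ddir x (ddir x g) p / 2)"
proof -
  have c: "ddir x g (p + s *\<^sub>R x) = ddir x g p + of_real s * ddir x (ddir x g) p" for s
    by (rule affine_on_line[OF polyf_ddir[OF g] z])
  have "((\<lambda>s::real. g (p
      + s *\<^sub>R x) - of_real s * ddir x g p - of_real s ^ 2 * (ddir x (ddir x g) p / 2)) has_derivative (\<lambda>h. 0)) (at s within UNIV)" for s
    using ddir_line[OF g, of p x s] unfolding c has_vector_derivative_def
    by (auto intro!: derivative_eq_intros simp: scaleR_conv_of_real algebra_simps)
  then obtain k where k: "\<And>s. g (p + s *\<^sub>R x) - of_real s * ddir x g p - of_real s ^ 2 * (ddir x (ddir x g) p / 2) = k"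
    using has_derivative_zero_constant[of UNIV "\<lambda>s::real. g (p
        + s *\<^sub>R x) - of_real s * ddir x g p - of_real s ^ 2 * (ddir x (ddir x g) p / 2)"] by auto
  show ?thesis using k[of s] k[of 0] by (simp add: algebra_simps)
qed

section \<open>The complexified tangency equation\<close>

lemma ddir_minus: "polyf f \<Longrightarrow> ddir x (\<lambda>p. - f p) = (\<lambda>p. - ddir x f p)"
  using ddir_cmult[of f x "-1"] by simp

lemma ddir_diff: "polyf f \<Longrightarrow> polyf g \<Longrightarrow> ddir x (\<lambda>p. f p - g p) = (\<lambda>p. ddir x f p - ddir x g p)"
  using ddir_add[OF _ polyf_minus, of f g x] by (simp add: ddir_minus)

definition vpolyf :: "((complex^'n::finite) \<times> (complex^'k::finite) \<Rightarrow> complex^'m) \<Rightarrow> bool" where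
  "vpolyf g \<longleftrightarrow> (\<forall>\<alpha>. polyf (\<lambda>p. g p $ \<alpha>))"

definition vddir :: "'v::real_normed_vector \<Rightarrow> ('v \<Rightarrow> complex^'m) \<Rightarrow> 'v \<Rightarrow> complex^'m" where
  "vddir x g p = (\<chi> \<alpha>. ddir x (\<lambda>q. g q $ \<alpha>) p)"

lemma vpolyf_nth: "vpolyf g \<Longrightarrow> polyf (\<lambda>p. g p $ \<alpha>)"
  by (simp add: vpolyf_def)

lemma vddir_nth: "(\<lambda>p. vddir x g p $ \<alpha>) = ddir x (\<lambda>p. g p $ \<alpha>)"
  by (simp add: vddir_def)

lemma vpolyf_vddir: "vpolyf g \<Longrightarrow> vpolyf (vddir x g)"
  by (simp add: vpolyf_def vddir_nth polyf_ddir)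

lemma vddir_add_dir: "vpolyf g \<Longrightarrow> vddir (x + y) g = (\<lambda>p. vddir x g p + vddir y g p)"
  by (simp add: fun_eq_iff vec_eq_iff vddir_def ddir_add_dir vpolyf_nth)

lemma vddir_cscale: "vpolyf g \<Longrightarrow> vddir (cscale c x) g = (\<lambda>p. c *s vddir x g p)"
  by (simp add: fun_eq_iff vec_eq_iff vddir_def ddir_cscale vpolyf_nth)

lemma vddir_commute: "vpolyf g \<Longrightarrow> vddir x (vddir y g) = vddir y (vddir x g)"
  by (simp add: fun_eq_iff vec_eq_iff vddir_def[of x "vddir y g"] vddir_def[of y "vddir x g"] vddir_nth)
     (metis ddir_commute vpolyf_nth)

lemma vddir_add: "vpolyf f \<Longrightarrow> vpolyf g \<Longrightarrow> vddir x (\<lambda>p. f p + g p) = (\<lambda>p. vddir x f p + vddir x g p)"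
  by (simp add: fun_eq_iff vec_eq_iff vddir_def ddir_add vpolyf_nth)

lemma vddir_smult: "vpolyf g \<Longrightarrow> vddir x (\<lambda>p. c *s g p) = (\<lambda>p. c *s vddir x g p)"
  by (simp add: fun_eq_iff vec_eq_iff vddir_def ddir_cmult vpolyf_nth)

lemma vddir_shift: "vpolyf g \<Longrightarrow> vddir x (\<lambda>p. g (p + q)) = (\<lambda>p. vddir x g (p + q))"
  by (simp add: fun_eq_iff vec_eq_iff vddir_def ddir_shift[OF vpolyf_nth])

lemma vpolyf_comp:
  assumes "vpolyf g" "\<And>\<alpha>. polyf (\<lambda>p. fst (G p) $ \<alpha>)" "\<And>j. polyf (\<lambda>p. snd (G p) $ j)"
  shows "vpolyf (\<lambda>p. g (G p))"
  unfolding vpolyf_def using polyf_comp[OF vpolyf_nth[OF assms(1)] assms(2,3)] by blast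

lemma vpolyf_add: "vpolyf f \<Longrightarrow> vpolyf g \<Longrightarrow> vpolyf (\<lambda>p. f p + g p)"
  by (simp add: vpolyf_def polyf_intros)

lemma vpolyf_diff: "vpolyf f \<Longrightarrow> vpolyf g \<Longrightarrow> vpolyf (\<lambda>p. f p - g p)"
  by (simp add: vpolyf_def polyf_intros)

lemma vpolyf_smult: "vpolyf g \<Longrightarrow> vpolyf (\<lambda>p. c *s g p)"
  by (simp add: vpolyf_def polyf_intros)

lemma polyf_levi_left: "vpolyf f \<Longrightarrow> polyf (\<lambda>p. levi H (f p) \<zeta> $ j)"
  by (simp add: levi_def matrix_vector_mult_def vpolyf_def polyf_intros)

lemma polyf_levi_right: "vpolyf g \<Longrightarrow> polyf (\<lambda>p. levi H z (g p) $ j)"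
  by (simp add: levi_def matrix_vector_mult_def vpolyf_def polyf_intros)

lemma vpolyf_levi_left: "vpolyf f \<Longrightarrow> vpolyf (\<lambda>p. levi H (f p) \<zeta>)"
  unfolding vpolyf_def[of "\<lambda>p. levi H (f p) \<zeta>"] using polyf_levi_left by blast

lemma vpolyf_levi_right: "vpolyf g \<Longrightarrow> vpolyf (\<lambda>p. levi H z (g p))"
  unfolding vpolyf_def[of "\<lambda>p. levi H z (g p)"] using polyf_levi_right by blast

lemma vddir_levi_right:
  assumes "vpolyf g"
  shows "vddir x (\<lambda>p. levi H z (g p)) = (\<lambda>p. levi H z (vddir x g p))"
  by (simp add: fun_eq_iff vec_eq_iff vddir_def levi_def ddir_sum ddir_cmult polyf_intros vpolyf_nth[OF assms])

lemma vddir_levi_left: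
  assumes "vpolyf f"
  shows "vddir x (\<lambda>p. levi H (f p) \<zeta>) = (\<lambda>p. levi H (vddir x f p) \<zeta>)"
proof -
  have e: "levi H y \<zeta> $ j = (\<Sum>\<alpha>\<in>UNIV. \<Sum>\<beta>\<in>UNIV. H j $ \<alpha> $ \<beta> * \<zeta> $ \<alpha> * y $ \<beta>)" for y j
    by (simp add: levi_def matrix_vector_mult_def sum_distrib_right sum_distrib_left algebra_simps)
  show ?thesis
    by (simp add: fun_eq_iff vec_eq_iff vddir_def e ddir_sum ddir_cmult polyf_intros vpolyf_nth[OF assms])
qed

lemma vddir_zero_on_line:
  assumes "vpolyf g" "\<And>s::real. g (p + s *\<^sub>R x) = 0"
  shows "vddir x g p = 0"
  using ddir_zero_on_line[OF vpolyf_nth[OF assms(1)]] assms(2) by (simp add: vddir_def vec_eq_iff)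

text \<open>These are the first and second derivatives at \<open>s = 0\<close> of the function
  assumed constant.\<close>

lemma taylor2_line:
  assumes U: "polyf U" and V: "polyf V" and k: "\<And>s::real. U (p + s *\<^sub>R x) + of_real s * V (p + s *\<^sub>R x) = k"
  shows "ddir x U p + V p = 0" "ddir x (ddir x U) p + 2 * ddir x V p = 0"
proof -
  have *: "ddir x U (p + s *\<^sub>R x) + V (p + s *\<^sub>R x) + of_real s * ddir x V (p + s *\<^sub>R x) = 0"
    if U: "polyf U" and V: "polyf V" and k: "\<And>s::real. U (p + s *\<^sub>R x) + of_real s * V (p + s *\<^sub>R x) = k"
    for U V k and s :: real
  proof -
    have "((\<lambda>s::real. U (p + s *\<^sub>R x) + of_real s * V (p + s *\<^sub>R x)) has_vector_derivative
        ddir x U (p + s *\<^sub>R x) + (of_real s * ddir x V (p + s *\<^sub>R x) + 1 * V (p + s *\<^sub>R x))) (at s)"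
      by (intro has_vector_derivative_add has_vector_derivative_mult ddir_line U V)
         (auto intro!: derivative_eq_intros simp: has_vector_derivative_def scaleR_conv_of_real)
    then have "((\<lambda>s::real. k) has_vector_derivative
        ddir x U (p + s *\<^sub>R x) + (of_real s * ddir x V (p + s *\<^sub>R x) + 1 * V (p + s *\<^sub>R x))) (at s)"
      using k by simp
    then have "ddir x U (p + s *\<^sub>R x) + (of_real s * ddir x V (p + s *\<^sub>R x) + 1 * V (p + s *\<^sub>R x)) = 0"
      using vector_derivative_unique_at has_vector_derivative_const by blast
    then show ?thesis by (simp add: algebra_simps)
  qed
  show "ddir x U p + V p = 0" using *[OF U V k, of 0] by simp
  define U1 where "U1 = (\<lambda>q. ddir x U q + V q)"
  have U1: "polyf U1" unfolding U1_def by (intro polyf_intros polyf_ddir U V)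
  have "U1 (p + s *\<^sub>R x) + of_real s * ddir x V (p + s *\<^sub>R x) = 0" for s
    using *[OF U V k] by (simp add: U1_def)
  from *[OF U1 polyf_ddir[OF V] this, of 0] have "ddir x U1 p + ddir x V p = 0" by simp
  then show "ddir x (ddir x U) p + 2 * ddir x V p = 0"
    by (simp add: U1_def ddir_add polyf_ddir U V add.assoc)
qed

abbreviation ii :: complex where "ii \<equiv> 2 * \<i>"

text \<open>The complexified tangency condition: \<open>(g, l)\<close> plays the role of the conjugate of \<open>(f, h)\<close>
  and \<open>\<zeta>\<close> that of the conjugate of \<open>z\<close>.\<close>

definition cr_solution ::
    "('k::finite \<Rightarrow> complex^'n::finite^'n) \<Rightarrow>
     ((complex^'n) \<times> (complex^'k) \<Rightarrow> complex^'n) \<Rightarrow> ((complex^'n) \<times> (complex^'k) \<Rightarrow> complex^'k) \<Rightarrow>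
     ((complex^'n) \<times> (complex^'k) \<Rightarrow> complex^'n) \<Rightarrow> ((complex^'n) \<times> (complex^'k) \<Rightarrow> complex^'k) \<Rightarrow> bool" where
  "cr_solution H f h g l \<longleftrightarrow> vpolyf f \<and> vpolyf h \<and> vpolyf g \<and> vpolyf l \<and>
     (\<forall>z \<zeta> w. h (z, w) - l (\<zeta>, w - ii *s levi H z \<zeta>) =
        ii *s (levi H (f (z, w)) \<zeta> + levi H z (g (\<zeta>, w - ii *s levi H z \<zeta>))))"

lemma polyf_levi_fst: "polyf (\<lambda>p :: (complex^'n::finite) \<times> (complex^'k::finite). levi H (fst p) \<zeta> $ j)"
  by (rule polyf_levi_left) (simp add: vpolyf_def polyf_intros)

text \<open>Replacing \<open>\<zeta>\<close> by \<open>\<zeta> + \<pi>\<close> and \<open>w\<close>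
  by \<open>w + ii *s levi H z \<pi>\<close> preserves the relation between the points of
  evaluation. The extra term with \<open>levi H (f _) \<pi>\<close> is absorbed into
  \<open>h'\<close>.\<close>

lemma cr_solution_translate:
  fixes H :: "'k::finite \<Rightarrow> complex^'n::finite^'n"
  assumes "cr_solution H f h g l"
  shows "\<exists>h' l'. cr_solution H (\<lambda>(z, w). f (z, w + ii *s levi H z \<pi>)) h' (\<lambda>p. g (p + (\<pi>, 0))) l'"
proof -
  have s: "vpolyf f" "vpolyf h" "vpolyf g" "vpolyf l"
    and e: "\<And>z \<zeta> w. h (z, w) - l (\<zeta>, w - ii *s levi H z \<zeta>) =
        ii *s (levi H (f (z, w)) \<zeta> + levi H z (g (\<zeta>, w - ii *s levi H z \<zeta>)))"
    using assms unfolding cr_solution_def by auto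
  define G where "G = (\<lambda>p :: (complex^'n) \<times> (complex^'k). (fst p, snd p + ii *s levi H (fst p) \<pi>))"
  have G: "vpolyf q \<Longrightarrow> vpolyf (\<lambda>p. q (G p))" for q :: "(complex^'n) \<times> (complex^'k) \<Rightarrow> complex^'m"
    by (rule vpolyf_comp) (auto simp: G_def intro!: polyf_intros polyf_levi_fst)
  have T: "vpolyf q \<Longrightarrow> vpolyf (\<lambda>p. q (p + (\<pi>, 0)))" for q :: "(complex^'n) \<times> (complex^'k) \<Rightarrow> complex^'m"
    by (rule vpolyf_comp) (auto intro!: polyf_intros)
  define h' where "h' = (\<lambda>p. h (G p) - ii *s levi H (f (G p)) \<pi>)"
  have "cr_solution H (\<lambda>p. f (G p)) h' (\<lambda>p. g (p + (\<pi>, 0))) (\<lambda>p. l (p + (\<pi>, 0)))"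
    unfolding cr_solution_def
  proof (intro conjI allI)
    show "vpolyf h'" unfolding h'_def by (intro vpolyf_diff vpolyf_smult vpolyf_levi_left G s)
    fix z \<zeta> w
    have "w - ii *s levi H z \<zeta> = (w + ii *s levi H z \<pi>) - ii *s levi H z (\<zeta> + \<pi>)"
      by (simp add: vector_add_ldistrib)
    then show "h' (z, w) - l ((\<zeta>, w - ii *s levi H z \<zeta>) + (\<pi>, 0)) =
        ii *s (levi H (f (G (z, w))) \<zeta> + levi H z (g ((\<zeta>, w - ii *s levi H z \<zeta>) + (\<pi>, 0))))"
      using e[of z "w + ii *s levi H z \<pi>" "\<zeta> + \<pi>"]
      by (simp add: h'_def G_def vector_add_ldistrib algebra_simps)
  qed (intro G T s)+
  moreover have "(\<lambda>p. f (G p)) = (\<lambda>(z, w). f (z, w + ii *s levi H z \<pi>))"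
    by (auto simp: G_def)
  ultimately show ?thesis by metis
qed

context levi_form begin

text \<open>Replace \<open>\<zeta>\<close> by \<open>s \<zeta>\<close> in the tangency equation and compare the coefficients of \<open>s\<close> and \<open>s\<^sup>2\<close>.\<close>

lemma cr_solution_jets:
  assumes "cr_solution H f h g l"
  defines "v \<equiv> \<lambda>z \<zeta>. (0, B z \<zeta>) :: (complex^'n) \<times> (complex^'k)"
  shows "\<exists>k0 k1. \<forall>r::real. B (f (of_real r *s z, w)) \<zeta> =
      k0 + of_real r *s k1 + (of_real r)\<^sup>2 *s (ii *s B z (vddir (v z \<zeta>) g (0, w)))" (is ?th1)
    and "B z (vddir (v z \<zeta>) (vddir (v z \<zeta>) g) (0, w)) = 0" (is ?th2)
proof -
  have s: "vpolyf f" "vpolyf h" "vpolyf g" "vpolyf l"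
    and e: "\<And>z \<zeta> w. h (z, w) - l (\<zeta>, w - ii *s B z \<zeta>) =
        ii *s (B (f (z, w)) \<zeta> + B z (g (\<zeta>, w - ii *s B z \<zeta>)))"
    using assms(1) unfolding cr_solution_def by auto
  define p where "p = (0 :: complex^'n, w)"
  define A where "A = (\<lambda>q :: (complex^'n) \<times> (complex^'k). f (0, snd q))"
  define b where "b = (\<lambda>q :: (complex^'n) \<times> (complex^'k). h (0, snd q))"
  have vA: "vpolyf A" unfolding A_def by (rule vpolyf_comp[OF s(1)]) (auto intro: polyf_intros)
  have vb: "vpolyf b" unfolding b_def by (rule vpolyf_comp[OF s(2)]) (auto intro: polyf_intros)
  have hz: "h (z, w) = b (0, w) + ii *s B z (g (0, w))" for z w
    using e[of z w 0] e[of 0 w 0] by (simp add: b_def algebra_simps)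
  have lz: "l (\<zeta>, w) = b (0, w) - ii *s B (A (0, w)) \<zeta>" for \<zeta> w
    using e[of 0 w \<zeta>] by (simp add: b_def A_def algebra_simps)
  define D where "D = (\<zeta>, 0 :: complex^'k)"
  let ?V = "v z \<zeta>"
  \<comment> \<open>Up to constant factors, these are the coefficients of \<open>t\<close> and
    \<open>t^2\<close> after \<open>z\<close> and \<open>\<zeta>\<close> are replaced by
    \<open>r *s z\<close> and \<open>t *s \<zeta>\<close>. The first is later solved for
    \<open>f\<close>; the second is a cubic polynomial in \<open>r\<close>.\<close>
  have main: "- (vddir D b p $ j) + ii * (r * vddir ?V b p $ j) - ii * (r * B z (vddir D g p) $ j)
        + ii\<^sup>2 * (r\<^sup>2 * B z (vddir ?V g p) $ j) + ii * (B (A p) \<zeta> $ j - B (f (r *s z, w)) \<zeta> $ j) = 0" (is ?m1)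
    "- (vddir D (vddir D b) p $ j) + 2 * ii * r * vddir D (vddir ?V b) p $ j - ii\<^sup>2 * r\<^sup>2 * vddir ?V (vddir ?V b) p $ j
      - ii * r * B z (vddir D (vddir D g) p) $ j + 2 * ii\<^sup>2 * r\<^sup>2 * B z (vddir D (vddir ?V g) p) $ j
      - ii^3 * r^3 * B z (vddir ?V (vddir ?V g) p) $ j
      + 2 * ii * B (vddir D A p) \<zeta> $ j - 2 * ii\<^sup>2 * r * B (vddir ?V A p) \<zeta> $ j = 0" (is ?m2)
    for j and r :: complex
  proof -
    \<comment> \<open>\<open>X\<close> is the direction of the line on which the arguments of
      \<open>g\<close> and \<open>l\<close> move.\<close>
    define X where "X = D + cscale (- ii * r) ?V"
    have X: "X = (\<zeta>, - (ii *s B (r *s z) \<zeta>))"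
      by (simp add: X_def D_def v_def cscale_def vec_eq_iff)
    have line: "p + t *\<^sub>R X = (of_real t *s \<zeta>, w - ii *s B (r *s z) (of_real t *s \<zeta>))" for t :: real
      by (simp add: p_def X) (simp add: vec_eq_iff scaleR_conv_of_real[where 'a=complex])
    define G where "G = (\<lambda>q. B (r *s z) (g q))"
    define C where "C = (\<lambda>q. B (A q) \<zeta>)"
    define U where "U = (\<lambda>q. - (b q $ j) - ii * G q $ j)"
    define K where "K = B (f (r *s z, w)) \<zeta> $ j"
    define V where "V = (\<lambda>q. ii * (C q $ j - K))"
    have vG: "vpolyf G" unfolding G_def by (rule vpolyf_levi_right[OF s(3)])
    have vC: "vpolyf C" unfolding C_def by (rule vpolyf_levi_left[OF vA])
    have pU: "polyf U" unfolding U_def by (intro polyf_intros vpolyf_nth vb vG)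
    have pV: "polyf V" unfolding V_def by (intro polyf_intros vpolyf_nth vC)
    have "U (p + t *\<^sub>R X) + of_real t * V (p + t *\<^sub>R X) = U p" for t :: real
    proof -
      define w' where "w' = w - ii *s B (r *s z) (of_real t *s \<zeta>)"
      have l: "p + t *\<^sub>R X = (of_real t *s \<zeta>, w')" unfolding line w'_def ..
      have "b (0, w) + ii *s B (r *s z) (g (0, w)) - (b (0, w') - ii *s B (A (0, w')) (of_real t *s \<zeta>)) =
          ii *s (B (f (r *s z, w)) (of_real t *s \<zeta>) + B (r *s z) (g (of_real t *s \<zeta>, w')))"
        using e[of "r *s z" w "of_real t *s \<zeta>"] unfolding w'_def[symmetric] hz lz .
      then have "(b (0, w) + ii *s B (r *s z) (g (0, w)) - (b (0, w') - ii *s B (A (0, w')) (of_real t *s \<zeta>))) $ j =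
          (ii *s (B (f (r *s z, w)) (of_real t *s \<zeta>) + B (r *s z) (g (of_real t *s \<zeta>, w')))) $ j" by simp
      moreover have "b (of_real t *s \<zeta>, w') = b (0, w')" "A (of_real t *s \<zeta>, w') = A (0, w')" "b p = b (0, w)"
        by (simp_all add: b_def A_def p_def)
      ultimately show ?thesis unfolding l
        by (simp add: U_def V_def G_def C_def K_def algebra_simps p_def)
    qed
    note tay = taylor2_line[OF pU pV this]
    have dU: "ddir x U = (\<lambda>q. - (vddir x b q $ j) - ii * vddir x G q $ j)" for x
      unfolding U_def
      by (simp add: ddir_diff ddir_minus ddir_cmult polyf_intros vpolyf_nth[OF vb] vpolyf_nth[OF vG] vddir_def)
    have dV: "ddir x V = (\<lambda>q. ii * vddir x C q $ j)" for x
      unfolding V_def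
      by (simp add: ddir_diff ddir_cmult ddir_const polyf_intros vpolyf_nth[OF vC] vddir_def)
    have ddU: "ddir x (ddir x U) = (\<lambda>q. - (vddir x (vddir x b) q $ j) - ii * vddir x (vddir x G) q $ j)" for x
      unfolding dU
      by (simp add: ddir_diff ddir_minus ddir_cmult polyf_intros vpolyf_nth[OF vpolyf_vddir[OF vb]]
          vpolyf_nth[OF vpolyf_vddir[OF vG]] vddir_def[of x "vddir x b"] vddir_def[of x "vddir x G"])
    have dG: "vddir x G = (\<lambda>q. B (r *s z) (vddir x g q))" for x
      unfolding G_def by (rule vddir_levi_right[OF s(3)])
    have ddG: "vddir x (vddir y G) = (\<lambda>q. B (r *s z) (vddir x (vddir y g) q))" for x y
      unfolding dG by (rule vddir_levi_right[OF vpolyf_vddir[OF s(3)]])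
    have dC: "vddir x C = (\<lambda>q. B (vddir x A q) \<zeta>)" for x
      unfolding C_def by (rule vddir_levi_left[OF vA])
    have dX: "vddir X q = (\<lambda>p. vddir D q p + (- ii * r) *s vddir ?V q p)"
      if "vpolyf q" for q :: "(complex^'n) \<times> (complex^'k) \<Rightarrow> complex^'m"
      unfolding X_def by (simp add: vddir_add_dir vddir_cscale that)
    have ddX: "vddir X (vddir X q) = (\<lambda>p. vddir D (vddir D q) p + (- ii * r * 2) *s vddir D (vddir ?V q) p
        + (ii\<^sup>2 * r\<^sup>2) *s vddir ?V (vddir ?V q) p)"
      if q: "vpolyf q" for q :: "(complex^'n) \<times> (complex^'k) \<Rightarrow> complex^'m"
    proof -
      have "vddir X (vddir X q) = (\<lambda>p. vddir X (vddir D q) p + (- ii * r) *s vddir X (vddir ?V q) p)"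
        unfolding dX[OF q] by (simp only: vddir_add vddir_smult vpolyf_vddir q vpolyf_smult)
      also have "\<dots> = (\<lambda>p. vddir D (vddir D q) p + (- ii * r) *s vddir ?V (vddir D q) p
          + (- ii * r) *s (vddir D (vddir ?V q) p + (- ii * r) *s vddir ?V (vddir ?V q) p))"
        by (simp only: dX vpolyf_vddir q)
      also have "vddir ?V (vddir D q) = vddir D (vddir ?V q)" by (rule vddir_commute[OF q])
      finally show ?thesis
        by (simp add: fun_eq_iff vec_eq_iff algebra_simps power2_eq_square)
    qed
    show ?m1 using tay(1) unfolding dU dG dX[OF vb] dX[OF s(3)]
      by (simp add: V_def K_def C_def algebra_simps power2_eq_square)
    show ?m2 using tay(2) unfolding ddU dV ddG dC ddX[OF vb] ddX[OF s(3)] dX[OF vA]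
      by (simp add: algebra_simps power2_eq_square power3_eq_cube)
  qed
  define k0 where "k0 = B (A p) \<zeta> - (1 / ii) *s vddir D b p"
  define k1 where "k1 = vddir ?V b p - B z (vddir D g p)"
  have "B (f (r *s z, w)) \<zeta> $ j = (k0 + r *s k1 + r\<^sup>2 *s (ii *s B z (vddir ?V g (0, w)))) $ j" for r :: complex and j
  proof -
    have "ii * B (f (r *s z, w)) \<zeta> $ j = ii * (k0 + r *s k1 + r\<^sup>2 *s (ii *s B z (vddir ?V g (0, w)))) $ j"
      using main(1)[of j r] unfolding p_def[symmetric]
      by (simp add: k0_def k1_def algebra_simps power2_eq_square)
    then show ?thesis by simp
  qed
  then show ?th1 by (metis vec_eq_iff)
  show ?th2
  proof -
    have "B z (vddir ?V (vddir ?V g) (0, w)) $ j = 0" for j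
    proof -
      let ?c0 = "- (vddir D (vddir D b) p $ j) + 2 * ii * B (vddir D A p) \<zeta> $ j"
      let ?c1 = "2 * ii * vddir D (vddir ?V b) p $ j - ii * B z (vddir D (vddir D g) p) $ j - 2 * ii\<^sup>2 * B (vddir ?V A p) \<zeta> $ j"
      let ?c2 = "- (ii\<^sup>2 * vddir ?V (vddir ?V b) p $ j) + 2 * ii\<^sup>2 * B z (vddir D (vddir ?V g) p) $ j"
      let ?c3 = "- (ii ^ 3 * B z (vddir ?V (vddir ?V g) p) $ j)"
      have "?c0 + of_real r * ?c1 + of_real r ^ 2 * ?c2 + of_real r ^ 3 * ?c3 = 0" for r :: real
        using main(2)[of j "of_real r"] by (simp add: algebra_simps)
      then have "?c3 = 0" by (rule poly3_zero(4))
      then show ?thesis by (simp add: p_def)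
    qed
    then show ?thesis by (simp add: vec_eq_iff)
  qed
qed

end

section \<open>Degrees along real lines\<close>

definition pdeg :: "nat \<Rightarrow> (real \<Rightarrow> complex) \<Rightarrow> bool" where
  "pdeg N \<phi> \<longleftrightarrow> (\<exists>q. degree q \<le> N \<and> (\<forall>s. \<phi> s = poly q (of_real s)))"

lemma pdeg_add: "pdeg N \<phi> \<Longrightarrow> pdeg N \<psi> \<Longrightarrow> pdeg N (\<lambda>s. \<phi> s + \<psi> s)"
  unfolding pdeg_def by (metis degree_add_le poly_add)

lemma pdeg_mult: "pdeg N \<phi> \<Longrightarrow> pdeg M \<psi> \<Longrightarrow> pdeg (N + M) (\<lambda>s. \<phi> s * \<psi> s)"
  unfolding pdeg_def by (metis add_mono degree_mult_le order_trans poly_mult)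

lemma pdeg_mono: "pdeg N \<phi> \<Longrightarrow> N \<le> M \<Longrightarrow> pdeg M \<phi>"
  unfolding pdeg_def by (meson order_trans)

lemma pdeg_const: "pdeg N (\<lambda>_. c)"
  unfolding pdeg_def by (rule exI[of _ "[:c:]"]) simp

lemma pdeg_power: "pdeg m (\<lambda>s. of_real s ^ m)"
  unfolding pdeg_def by (rule exI[of _ "monom 1 m"]) (simp add: poly_monom degree_monom_eq)

lemma pdeg_power_mult: "pdeg N \<phi> \<Longrightarrow> N + m \<le> M \<Longrightarrow> pdeg M (\<lambda>s. of_real s ^ m * \<phi> s)"
  by (rule pdeg_mono[OF pdeg_mult[OF pdeg_power]]) (assumption, linarith)

lemma pdeg_square:
  assumes "pdeg N \<phi>" shows "pdeg (2 * N) (\<lambda>s. \<phi> (s\<^sup>2))"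
proof -
  obtain q where q: "degree q \<le> N" "\<And>s. \<phi> s = poly q (of_real s)" using assms unfolding pdeg_def by blast
  have "degree (pcompose q (monom 1 2)) \<le> 2 * N"
    using q(1) by (simp add: degree_pcompose degree_monom_eq)
  moreover have "\<phi> (s\<^sup>2) = poly (pcompose q (monom 1 2)) (of_real s)" for s
    by (simp add: q poly_pcompose poly_monom)
  ultimately show ?thesis unfolding pdeg_def by blast
qed

lemma pdeg_monom_zero:
  assumes "pdeg N (\<lambda>s. of_real s ^ m * C)" "N < m"
  shows "C = 0"
proof (rule ccontr)
  assume "C \<noteq> 0"
  obtain q where q: "degree q \<le> N" "\<And>s::real. of_real s ^ m * C = poly q (of_real s)"
    using assms unfolding pdeg_def by blast
  let ?r = "q - monom C m"
  have "range complex_of_real \<subseteq> {t. poly ?r t = 0}" using q(2) by (auto simp: poly_monom mult.commute)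
  moreover have "infinite (range complex_of_real)"
    by (subst finite_image_iff) (auto simp: inj_on_def infinite_UNIV_char_0)
  ultimately have "?r = 0" using poly_roots_finite finite_subset by blast
  then have "degree q = m" using \<open>C \<noteq> 0\<close> by (simp add: degree_monom_eq)
  then show False using q(1) assms(2) by simp
qed

text \<open>Along the newly inserted direction \<open>q\<close> is quadratic, and the induction
  hypothesis applies to \<open>q\<close> and its first two derivatives in this direction, since
  derivatives commute.\<close>

lemma pdeg_multi_quadratic:
  fixes q :: "(complex^'n::finite) \<times> (complex^'k::finite) \<Rightarrow> complex"
  assumes "finite S" "polyf q"
    and "\<And>x p. x \<in> S \<Longrightarrow> ddir (0, x) (ddir (0, x) (ddir (0, x) q)) p = 0"
  shows "pdeg (2 * card S) (\<lambda>s. q (p + s *\<^sub>R (0, \<Sum>x\<in>S. c x *s x)))"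
  using assms
proof (induction S arbitrary: p q rule: finite_induct)
  case empty
  then show ?case by (simp add: zero_prod_def[symmetric] pdeg_const)
next
  case (insert y S)
  define X where "X = cscale (c y) (0 :: complex^'n, y)"
  define D where "D = ddir (0 :: complex^'n, y)"
  define b where "b = (\<lambda>s. p + s *\<^sub>R (0, \<Sum>x\<in>S. c x *s x))"
  have q: "polyf q" by fact
  have pD: "polyf (D q)" "polyf (D (D q))" unfolding D_def by (intro polyf_ddir q)+
  have comm: "D (ddir x r) = ddir x (D r)" if "polyf r" for x r
    unfolding D_def by (rule ddir_commute[OF that])
  have dX: "ddir X r = (\<lambda>p. c y * D r p)" if "polyf r" for r
    unfolding X_def D_def by (rule ddir_cscale[OF that])
  have dX2: "ddir X (ddir X q) = (\<lambda>p. c y * (c y * D (D q) p))"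
    unfolding dX[OF q] by (simp add: ddir_cmult pD dX[OF pD(1)])
  have dX3: "ddir X (ddir X (ddir X q)) p = 0" for p
    unfolding dX2 using insert.prems(2)[of y p] ddir_cmult[OF pD(2), of X "c y * c y"] dX[OF pD(2)]
    by (simp add: D_def mult.assoc)
  have S3: "ddir (0, x) (ddir (0, x) (ddir (0, x) r)) p = 0" if "x \<in> S" "r \<in> {q, D q, D (D q)}" for x r p
  proof -
    have z: "ddir (0, x) (ddir (0, x) (ddir (0, x) q)) = (\<lambda>_. 0)" using insert.prems(2) that(1) by blast
    have D0: "D (\<lambda>_. 0) = (\<lambda>_. 0)" unfolding D_def by (rule ddir_const)
    have 1: "ddir (0, x) (ddir (0, x) (ddir (0, x) (D q))) = (\<lambda>_. 0)"
      using comm[OF q, of "(0, x)"] comm[OF polyf_ddir[OF q], of "(0, x)" "(0, x)"]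
        comm[OF polyf_ddir[OF polyf_ddir[OF q]], of "(0, x)" "(0, x)" "(0, x)"] z D0 by simp
    have 2: "ddir (0, x) (ddir (0, x) (ddir (0, x) (D (D q)))) = (\<lambda>_. 0)"
      using comm[OF pD(1), of "(0, x)"] comm[OF polyf_ddir[OF pD(1)], of "(0, x)" "(0, x)"]
        comm[OF polyf_ddir[OF polyf_ddir[OF pD(1)]], of "(0, x)" "(0, x)" "(0, x)"] 1 D0 by simp
    show ?thesis using that(2) z 1 2 by auto
  qed
  have IH: "pdeg (2 * card S) (\<lambda>s. r (b s))" if "r \<in> {q, D q, D (D q)}" for r
    unfolding b_def by (rule insert.IH) (use that q pD S3 in auto)
  have e: "q (p + s *\<^sub>R (0, \<Sum>x\<in>insert y S. c x *s x)) =
      q (b s) + of_real s ^ 1 * (c y * D q (b s)) + of_real s ^ 2 * ((c y)\<^sup>2 / 2 * D (D q) (b s))" for s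
  proof -
    have "p + s *\<^sub>R (0, \<Sum>x\<in>insert y S. c x *s x) = b s + s *\<^sub>R X"
      using insert.hyps by (simp add: b_def X_def cscale_def scaleR_add_right[symmetric] add.assoc add.commute)
    then show ?thesis
      using quadratic_on_line[OF q dX3, of "b s" s] dX[OF q] dX2 by (simp add: power2_eq_square)
  qed
  have "pdeg (2 * card S + 2) (\<lambda>s. q (b s) + of_real s ^ 1 * (c y * D q (b s))
      + of_real s ^ 2 * ((c y)\<^sup>2 / 2 * D (D q) (b s)))"
  proof (intro pdeg_add)
    show "pdeg (2 * card S + 2) (\<lambda>s. q (b s))" by (rule pdeg_mono[OF IH]) simp_all
    have c: "pdeg (2 * card S) (\<lambda>s. k * r (b s))" if "r \<in> {q, D q, D (D q)}" for k r
      using pdeg_mult[OF pdeg_const[of 0 k] IH[OF that]] by simp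
    show "pdeg (2 * card S + 2) (\<lambda>s. of_real s ^ 1 * (c y * D q (b s)))"
      by (rule pdeg_power_mult[OF c]) simp_all
    show "pdeg (2 * card S + 2) (\<lambda>s. of_real s ^ 2 * ((c y)\<^sup>2 / 2 * D (D q) (b s)))"
      by (rule pdeg_power_mult[OF c]) simp_all
  qed
  then show ?case unfolding e using insert.hyps by simp
qed

context levi_form begin

text \<open>Pairing with any \<open>\<zeta>\<close> gives a quadratic polynomial in
  \<open>r\<close>; the coefficients are the Lagrange polynomials for the nodes 0, 1, -1.\<close>

lemma cr_quadratic:
  assumes "cr_solution H f h g l"
  shows "f (of_real r *s z, w) = of_real (1 - r\<^sup>2) *s f (0, w) + of_real ((r\<^sup>2 + r) / 2) *s f (z, w)
    + of_real ((r\<^sup>2 - r) / 2) *s f (- z, w)" (is "?l = ?r")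
proof -
  have "B (?l - ?r) \<zeta> = 0" for \<zeta>
  proof -
    obtain k0 k1 k2 where k: "\<And>r::real. B (f (of_real r *s z, w)) \<zeta> = k0 + of_real r *s k1 + (of_real r)\<^sup>2 *s k2"
      using cr_solution_jets(1)[OF assms, of z w \<zeta>] by blast
    have v: "B (f (0, w)) \<zeta> = k0" "B (f (z, w)) \<zeta> = k0 + k1 + k2" "B (f (- z, w)) \<zeta> = k0 - k1 + k2"
      using k[of 0] k[of 1] k[of "-1"] by simp_all
    show ?thesis unfolding levi_simps k v
      by (simp add: vec_eq_iff algebra_simps add_divide_distrib diff_divide_distrib)
  qed
  then have "?l - ?r = 0" by (rule left_nondeg)
  then show ?thesis by simp
qed

lemma cr_even_part:
  assumes "cr_solution H f h g l"
  shows "B ((1/2) *s (f (z, w) + f (- z, w)) - f (0, w)) \<zeta> = ii *s B z (vddir (0, B z \<zeta>) g (0, w))"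
proof -
  let ?k2 = "ii *s B z (vddir (0, B z \<zeta>) g (0, w))"
  obtain k0 k1 where k: "\<And>r::real. B (f (of_real r *s z, w)) \<zeta> = k0 + of_real r *s k1 + (of_real r)\<^sup>2 *s ?k2"
    using cr_solution_jets(1)[OF assms, of z w \<zeta>] by blast
  have v: "B (f (0, w)) \<zeta> = k0" "B (f (z, w)) \<zeta> = k0 + k1 + ?k2" "B (f (- z, w)) \<zeta> = k0 - k1 + ?k2"
    using k[of 0] k[of 1] k[of "-1"] by simp_all
  show ?thesis unfolding levi_simps v by (simp add: vec_eq_iff algebra_simps)
qed

lemma zero_pair_add: "(0 :: complex^'n, x + y :: complex^'k) = (0, x) + (0, y)"
  by simp

lemma zero_pair_scale: "(0 :: complex^'n, c *s x :: complex^'k) = cscale c (0, x)"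
  by (simp add: cscale_def)

text \<open>\<open>cr_solution_jets\<close> gives \<open>a_null\<close> for equal arguments;
  polarization in \<open>\<zeta>\<close> and the symmetry of second derivatives give the
  rest.\<close>

lemma cr_null:
  assumes "cr_solution H f h g l"
  shows "levi_null H (\<lambda>x y. vddir (0, x) (vddir (0, y) g) (0, w))"
proof unfold_locales
  have g: "vpolyf g" using assms by (simp add: cr_solution_def)
  let ?a = "\<lambda>x y. vddir (0, x) (vddir (0, y) g) (0, w)"
  have add: "?a (u + v) x = ?a u x + ?a v x" for u v x
    unfolding zero_pair_add by (simp only: vddir_add_dir vpolyf_vddir g)
  then show "?a (u + v) x = ?a u x + ?a v x" for u v x .
  show "?a (c *s u) x = c *s ?a u x" for c u x
    unfolding zero_pair_scale by (simp only: vddir_cscale vpolyf_vddir g)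
  have sym: "?a u v = ?a v u" for u v by (simp only: vddir_commute[OF g, of "(0, u)"])
  then show "?a u v = ?a v u" for u v .
  have add': "?a x (u + v) = ?a x u + ?a x v" for u v x using add sym by metis
  fix z \<zeta> \<eta>
  have d: "B z (?a (B z \<zeta>) (B z \<zeta>)) = 0" for \<zeta> by (rule cr_solution_jets(2)[OF assms])
  have "B z (?a (B z \<zeta>) (B z \<eta>)) + B z (?a (B z \<eta>) (B z \<zeta>)) = 0"
    using d[of "\<zeta> + \<eta>"] d[of \<zeta>] d[of \<eta>] unfolding levi_simps add add' by (simp add: add.commute)
  then show "B z (?a (B z \<zeta>) (B z \<eta>)) = 0"
    by (rule eq_0_if_add_sub_0) (simp add: sym[of "B z \<zeta>" "B z \<eta>"])
qed

text \<open>Differentiating \<open>cr_even_part\<close> along \<open>y\<close> in the variable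
  \<open>w\<close> gives \<open>F_pair\<close>, because the left argument of \<open>B\<close> there
  does not depend on \<open>\<zeta>\<close>.\<close>

lemma cr_prolongation:
  assumes "cr_solution H f h g l"
  shows "\<exists>F. levi_prolongation H (\<lambda>x y. vddir (0, x) (vddir (0, y) g) (0, w)) F"
proof -
  have s: "vpolyf f" "vpolyf g" using assms by (simp_all add: cr_solution_def)
  interpret levi_null H "\<lambda>x y. vddir (0, x) (vddir (0, y) g) (0, w)" by (rule cr_null[OF assms])
  define Q where "Q = (\<lambda>z (p :: (complex^'n) \<times> (complex^'k)). (1/2) *s (f (z, snd p) + f (- z, snd p)) - f (0, snd p))"
  have fz: "vpolyf (\<lambda>p :: (complex^'n) \<times> (complex^'k). f (z, snd p))" for z
    by (rule vpolyf_comp[OF s(1)]) (auto intro: polyf_intros)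
  have vQ: "vpolyf (Q z)" for z unfolding Q_def by (intro vpolyf_diff vpolyf_smult vpolyf_add fz)
  define F where "F = (\<lambda>z y. (1 / ii) *s vddir (0, y) (Q z) (0, w))"
  have "B (F z y) \<zeta> = B z (vddir (0, y) (vddir (0, B z \<zeta>) g) (0, w))" for z y \<zeta>
  proof -
    let ?v = "(0, B z \<zeta>) :: (complex^'n) \<times> (complex^'k)"
    have vq: "vpolyf (\<lambda>p. B (Q z p) \<zeta>)" by (rule vpolyf_levi_left[OF vQ])
    have vg: "vpolyf (\<lambda>p. (- ii) *s B z (vddir ?v g p))"
      by (intro vpolyf_smult vpolyf_levi_right vpolyf_vddir s)
    have "vddir (0, y) (\<lambda>p. B (Q z p) \<zeta> + (- ii) *s B z (vddir ?v g p)) (0, w) = 0"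
    proof (rule vddir_zero_on_line)
      show "vpolyf (\<lambda>p. B (Q z p) \<zeta> + (- ii) *s B z (vddir ?v g p))" by (rule vpolyf_add[OF vq vg])
      fix t :: real
      have "(0, w) + t *\<^sub>R (0, y) = (0 :: complex^'n, w + t *\<^sub>R y)" by simp
      then show "B (Q z ((0, w) + t *\<^sub>R (0, y))) \<zeta> + (- ii) *s B z (vddir ?v g ((0, w) + t *\<^sub>R (0, y))) = 0"
        using cr_even_part[OF assms, of z "w + t *\<^sub>R y" \<zeta>] unfolding Q_def by simp
    qed
    then have "B (vddir (0, y) (Q z) (0, w)) \<zeta> + (- ii) *s B z (vddir (0, y) (vddir ?v g) (0, w)) = 0"
      unfolding vddir_add[OF vq vg] vddir_levi_left[OF vQ]
        vddir_smult[OF vpolyf_levi_right[OF vpolyf_vddir[OF s(2)]]] vddir_levi_right[OF vpolyf_vddir[OF s(2)]] .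
    then have "B (vddir (0, y) (Q z) (0, w)) \<zeta> = ii *s B z (vddir (0, y) (vddir ?v g) (0, w))" by simp
    then show ?thesis unfolding F_def by simp
  qed
  then have "levi_prolongation H (\<lambda>x y. vddir (0, x) (vddir (0, y) g) (0, w)) F"
    by unfold_locales
  then show ?thesis by blast
qed

text \<open>Fixing one slot of the symmetric third derivative \<open>T\<close> gives another map as
  in \<open>levi_null\<close>. Polarized at \<open>B z \<eta>\<close> in all slots, its identity has
  two terms with \<open>T (B y \<eta>)\<close>, which vanish, so every \<open>B y\<close> kills the
  remaining value.\<close>

lemma cr_third_derivative:
  assumes "cr_solution H f h g l"
  shows "vddir (0, B z \<eta>) (vddir (0, B z \<eta>) (vddir (0, B z \<eta>) g)) (0, w) = 0"
proof -
  have g: "vpolyf g" using assms by (simp add: cr_solution_def)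
  define T where "T = (\<lambda>x y u. vddir (0, x) (vddir (0, y) (vddir (0, u) g)) (0 :: complex^'n, w))"
  have c2: "vddir (0, u) (vddir (0, v) g) = vddir (0, v) (vddir (0, u) g)" for u v by (rule vddir_commute[OF g])
  have c1: "T u v x = T v u x" for u v x unfolding T_def by (simp only: vddir_commute[OF vpolyf_vddir[OF g], of "(0,
      u)"])
  have c3: "T x u v = T x v u" for u v x unfolding T_def c2[of u v] ..
  have null: "B z (T x (B z \<zeta>) (B z \<eta>)) = 0" for x z \<zeta> \<eta>
  proof -
    have "vddir (0, x) (\<lambda>p. B z (vddir (0, B z \<zeta>) (vddir (0, B z \<eta>) g) p)) (0, w) = 0"
    proof (rule vddir_zero_on_line)
      show "vpolyf (\<lambda>p. B z (vddir (0, B z \<zeta>) (vddir (0, B z \<eta>) g) p))"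
        by (intro vpolyf_levi_right vpolyf_vddir g)
      fix t :: real
      interpret levi_null H "\<lambda>x y. vddir (0, x) (vddir (0, y) g) (0, w + t *\<^sub>R x')" for x'
        by (rule cr_null[OF assms])
      have "(0, w) + t *\<^sub>R (0, x) = (0 :: complex^'n, w + t *\<^sub>R x)" by simp
      then show "B z (vddir (0, B z \<zeta>) (vddir (0, B z \<eta>) g) ((0, w) + t *\<^sub>R (0, x))) = 0"
        using a_null by simp
    qed
    then show ?thesis unfolding T_def vddir_levi_right[OF vpolyf_vddir[OF vpolyf_vddir[OF g]]] .
  qed
  have "levi_null H (T x)" for x
  proof unfold_locales
    show "T x (u + v) y = T x u y + T x v y" for u v y
      unfolding c1[of x] unfolding T_def zero_pair_add by (simp only: vddir_add_dir vpolyf_vddir g)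
    show "T x (c *s u) y = c *s T x u y" for c u y
      unfolding c1[of x] unfolding T_def zero_pair_scale by (simp only: vddir_cscale vpolyf_vddir g)
  qed (rule c3, rule null)
  then interpret T: levi_null H "T x" for x .
  let ?v = "B z \<eta>"
  have "T ?v ?v ?v = 0"
  proof (rule right_nondeg)
    fix y
    have "T ?v (B y \<eta>) ?v = T (B y \<eta>) ?v ?v" "T ?v ?v (B y \<eta>) = T (B y \<eta>) ?v ?v"
      using c1 c3 by metis+
    then show "B y (T ?v ?v ?v) = 0"
      using T.a_null_polarized[of y ?v z \<eta> \<eta>] null[of z "B y \<eta>" \<eta> \<eta>] by simp
  qed
  then show ?thesis unfolding T_def .
qed

lemma cr_third_derivative_everywhere:
  assumes "cr_solution H f h g l"
  shows "vddir (0, B z \<eta>) (vddir (0, B z \<eta>) (vddir (0, B z \<eta>) g)) p = 0"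
proof -
  have g: "vpolyf g" using assms by (simp add: cr_solution_def)
  obtain \<pi> w where p: "p = (0, w) + (\<pi>, 0)" by (cases p) auto
  obtain f' h' l' where "cr_solution H f' h' (\<lambda>p. g (p + (\<pi>, 0))) l'"
    using cr_solution_translate[OF assms] by blast
  from cr_third_derivative[OF this, of z \<eta> w] show ?thesis
    unfolding p by (simp only: vddir_shift vpolyf_vddir g)
qed

lemma cr_second_derivative_everywhere:
  assumes "cr_solution H f h g l"
    and "CARD('n) \<le> 3 \<or> CARD('k) \<le> 3 \<or> CARD('n)\<^sup>2 - CARD('n) \<le> CARD('k)"
  shows "vddir (0, x) (vddir (0, y) g) p = 0"
proof -
  have g: "vpolyf g" using assms by (simp add: cr_solution_def)
  obtain \<pi> w where p: "p = (0, w) + (\<pi>, 0)" by (cases p) auto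
  obtain f' h' l' where t: "cr_solution H f' h' (\<lambda>p. g (p + (\<pi>, 0))) l'"
    using cr_solution_translate[OF assms(1)] by blast
  obtain F where "levi_prolongation H (\<lambda>x y. vddir (0, x) (vddir (0, y) (\<lambda>p. g (p + (\<pi>, 0)))) (0, w)) F"
    using cr_prolongation[OF t] by blast
  then interpret levi_prolongation H "\<lambda>x y. vddir (0, x) (vddir (0, y) (\<lambda>p. g (p + (\<pi>, 0)))) (0, w)" F .
  show ?thesis using a_zero[OF assms(2), of x y]
    unfolding p by (simp only: vddir_shift vpolyf_vddir g)
qed

end

section \<open>Weights of infinitesimal automorphisms\<close>

lemma scaleR_eq_smult: "s *\<^sub>R (x :: complex^'m) = of_real s *s x"
  by (simp add: vec_eq_iff scaleR_conv_of_real[where 'a=complex])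

context levi_form begin

text \<open>\<open>h\<close> does not depend on \<open>z\<close> and is invariant under translation
  of \<open>w\<close> by all values of \<open>B\<close>. These span, so \<open>h\<close> is
  constant.\<close>

lemma cr_h_zero:
  assumes "cr_solution H f h g l" "\<And>p. f p = 0" "\<And>p. g p = 0" "h (0, 0) = 0"
  shows "h p = 0"
proof -
  have e: "h (z, w) = l (\<zeta>, w - ii *s B z \<zeta>)" for z w \<zeta>
    using assms(1-3) unfolding cr_solution_def by simp
  have h0: "h (z, w) = h (0, w)" for z w using e[of z w 0] e[of 0 w 0] by simp
  have l0: "l (\<zeta>, w) = h (0, w)" for \<zeta> w using e[of 0 w \<zeta>] by simp
  have per: "h (0, w) = h (0, w + c *s B z \<zeta>)" for w c z \<zeta>
    using e[of z "w + c *s B z \<zeta>" "(c / ii) *s \<zeta>"] by (simp add: h0[of z] l0)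
  have "h (0, w + x) = h (0, w)" for w x
  proof -
    have "x \<in> vec.span {B z \<zeta> |z \<zeta>. True}" by (simp only: span_levi UNIV_I)
    then show ?thesis
    proof (induction arbitrary: w rule: vec.span_induct_alt)
      case (step c x y)
      then obtain z \<zeta> where x: "x = B z \<zeta>" by blast
      have "h (0, (w + c *s x) + y) = h (0, w + c *s x)" by (rule step.IH)
      then show ?case using per[of w c z \<zeta>] by (simp add: x add.assoc)
    qed simp
  qed
  from this[of 0] have "h (0, w) = 0" for w using assms(4) by simp
  then show ?thesis using h0 by (cases p) simp
qed

end

locale cr_weighted = levi_form H for H :: "'k::finite \<Rightarrow> complex^'n::finite^'n" +
  fixes f h g l and m :: nat
  assumes sol: "cr_solution H f h g l"
    and conj: "g p = cv (f (cv (fst p), cv (snd p)))"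
    and hom: "f (of_real s *s z, of_real (s\<^sup>2) *s w) = of_real s ^ m *s f (z, w)"
begin

lemma g_poly: "vpolyf g" using sol by (simp add: cr_solution_def)

lemma g_hom: "g (of_real s *s z, of_real (s\<^sup>2) *s w) = of_real s ^ m *s g (z, w)"
  using hom[of s "cv z" "cv w"] by (simp add: conj)

lemma g_quadratic:
  "g (of_real r *s z, w) = of_real (1 - r\<^sup>2) *s g (0, w) + of_real ((r\<^sup>2 + r) / 2) *s g (z, w)
    + of_real ((r\<^sup>2 - r) / 2) *s g (- z, w)"
  using cr_quadratic[OF sol, of r "cv z" "cv w"] by (simp add: conj)

lemma f_zero_if_g_zero: "(\<And>p. g p = 0) \<Longrightarrow> f p = 0"
  using conj[of "(cv (fst p), cv (snd p))"] by simp

text \<open>Along the weighted curve \<open>w\<close> enters through \<open>s^2\<close>, which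
  doubles the degree, and the quadratic dependence on the first argument adds 2.\<close>

lemma pdeg_g_line:
  assumes d: "\<And>\<pi> t. pdeg N (\<lambda>t. g (\<pi>, of_real t *s w) $ \<alpha>)"
  shows "pdeg (2 * N + 2) (\<lambda>s. g (of_real s *s \<pi>, of_real (s\<^sup>2) *s w) $ \<alpha>)"
proof -
  have sq: "pdeg (2 * N) (\<lambda>s. g (\<pi>, of_real (s\<^sup>2) *s w) $ \<alpha>)" for \<pi>
    using pdeg_square[OF d] by simp
  have "pdeg 2 (\<lambda>s. (1 - of_real s ^ 2 :: complex))" "pdeg 2 (\<lambda>s. (of_real s ^ 2 + of_real s) / 2 :: complex)"
    "pdeg 2 (\<lambda>s. (of_real s ^ 2 - of_real s) / 2 :: complex)"
    unfolding pdeg_def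
    by (rule exI[of _ "[:1, 0, -1:]"], simp add: power2_eq_square)
       (rule exI[of _ "[:0, 1/2, 1/2:]"], simp add: power2_eq_square algebra_simps add_divide_distrib,
        rule exI[of _ "[:0, -1/2, 1/2:]"], simp add: power2_eq_square algebra_simps diff_divide_distrib)
  from this[THEN pdeg_mult[OF _ sq]]
  have "pdeg (2 + 2 * N) (\<lambda>s. (1 - of_real s ^ 2) * g (0, of_real (s\<^sup>2) *s w) $ \<alpha>
     + (of_real s ^ 2 + of_real s) / 2 * g (\<pi>, of_real (s\<^sup>2) *s w) $ \<alpha>
     + (of_real s ^ 2 - of_real s) / 2 * g (- \<pi>, of_real (s\<^sup>2) *s w) $ \<alpha>)"
    by (intro pdeg_add)
  then show ?thesis unfolding g_quadratic[of _ \<pi>] by (simp add: algebra_simps)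
qed

text \<open>Along weighted curves \<open>g\<close> has degree at most \<open>4 * card S + 2\<close>,
  whereas homogeneity makes it a multiple of \<open>s ^ m\<close>.\<close>

lemma g_zero_if_large:
  assumes S: "finite S" "S \<subseteq> {B z \<zeta> |z \<zeta>. True}" "vec.span S = UNIV" and m: "4 * card S + 2 < m"
  shows "g p = 0"
proof -
  have line: "pdeg (2 * card S) (\<lambda>t. g (\<pi>, of_real t *s w) $ \<alpha>)" for \<pi> w \<alpha>
  proof -
    obtain c where w: "w = (\<Sum>x\<in>S. c x *s x)"
      using vec.span_finite[OF S(1)] S(3) by blast
    have "pdeg (2 * card S) (\<lambda>t. (\<lambda>p. g p $ \<alpha>) ((\<pi>, 0) + t *\<^sub>R (0, \<Sum>x\<in>S. c x *s x)))"
    proof (rule pdeg_multi_quadratic[OF S(1) vpolyf_nth[OF g_poly]])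
      fix x p assume "x \<in> S"
      then obtain z \<zeta> where x: "x = B z \<zeta>" using S(2) by blast
      show "ddir (0, x) (ddir (0, x) (ddir (0, x) (\<lambda>p. g p $ \<alpha>))) p = 0"
        using arg_cong[OF cr_third_derivative_everywhere[OF sol, of z \<zeta> p], of "\<lambda>v. v $ \<alpha>"]
        by (simp add: x[symmetric] vddir_nth[symmetric])
    qed
    then show ?thesis by (simp add: w[symmetric] scaleR_eq_smult)
  qed
  have "g (\<pi>, w) $ \<alpha> = 0" for \<pi> w \<alpha>
  proof (rule pdeg_monom_zero)
    show "pdeg (2 * (2 * card S) + 2) (\<lambda>s. of_real s ^ m * g (\<pi>, w) $ \<alpha>)"
      using pdeg_g_line[OF line] unfolding g_hom by simp
  qed (use m in simp)
  then show ?thesis by (cases p) (simp add: vec_eq_iff)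
qed

text \<open>Here \<open>g\<close> is affine in \<open>w\<close>, so \<open>pdeg_g_line\<close> alone
  gives only degree 4. First \<open>g (0, _)\<close> vanishes, having degree 2 along the curve; this
  removes the even part in the first argument, so \<open>g\<close> is linear in it and the degree
  drops to 3.\<close>

lemma g_zero_if_small:
  assumes small: "CARD('n) \<le> 3 \<or> CARD('k) \<le> 3 \<or> CARD('n)\<^sup>2 - CARD('n) \<le> CARD('k)" and m: "3 < m"
  shows "g p = 0"
proof -
  have line: "pdeg 1 (\<lambda>t. g (\<pi>, of_real t *s w) $ \<alpha>)" for \<pi> w \<alpha>
  proof -
    let ?x = "(0, w) :: (complex^'n) \<times> (complex^'k)"
    have z: "ddir ?x (ddir ?x (\<lambda>p. g p $ \<alpha>)) p = 0" for p
      using arg_cong[OF cr_second_derivative_everywhere[OF sol small, of w w p], of "\<lambda>v. v $ \<alpha>"]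
      by (simp add: vddir_nth[symmetric])
    have "pdeg 1 (\<lambda>t. g (\<pi>, 0) $ \<alpha> + of_real t ^ 1 * ddir ?x (\<lambda>p. g p $ \<alpha>) (\<pi>, 0))"
      by (intro pdeg_add pdeg_const pdeg_power_mult[OF pdeg_const[of 0]]) simp
    then show ?thesis
      using affine_on_line[OF vpolyf_nth[OF g_poly] z, of "(\<pi>, 0)"] by (simp add: scaleR_eq_smult)
  qed
  have g0: "g (0, w) = 0" for w
  proof -
    have "g (0, w) $ \<alpha> = 0" for \<alpha>
    proof (rule pdeg_monom_zero)
      have "pdeg (2 * 1) (\<lambda>s. g (0, of_real (s\<^sup>2) *s w) $ \<alpha>)"
        using pdeg_square[OF line] by simp
      then show "pdeg 2 (\<lambda>s. of_real s ^ m * g (0, w) $ \<alpha>)"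
        using g_hom[of _ 0 w] by simp
    qed (use m in simp)
    then show ?thesis by (simp add: vec_eq_iff)
  qed
  have f0: "f (0, w) = 0" for w
    using g0[of "cv w"] by (simp add: conj)
  have odd: "f (z, w) + f (- z, w) = 0" for z w
  proof (rule left_nondeg)
    fix \<zeta>
    have "vddir (0, B z \<zeta>) g (0, w) = 0"
      by (rule vddir_zero_on_line[OF g_poly]) (simp add: g0)
    then have "B ((1/2) *s (f (z, w) + f (- z, w))) \<zeta> = 0"
      using cr_even_part[OF sol, of z w \<zeta>] f0 by simp
    then have "2 *s B ((1/2) *s (f (z, w) + f (- z, w))) \<zeta> = 0" by simp
    then show "B (f (z, w) + f (- z, w)) \<zeta> = 0" by (simp add: vector_add_ldistrib)
  qed
  have godd: "g (- z, w) = - g (z, w)" for z w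
    using odd[of "cv z" "cv w"] by (simp add: conj add_eq_0_iff)
  have g1: "g (of_real r *s z, w) = of_real r *s g (z, w)" for r z w
    unfolding g_quadratic godd g0 by (simp add: vec_eq_iff algebra_simps add_divide_distrib diff_divide_distrib)
  have "g (\<pi>, w) $ \<alpha> = 0" for \<pi> w \<alpha>
  proof (rule pdeg_monom_zero)
    have "pdeg (2 * 1) (\<lambda>s. g (\<pi>, of_real (s\<^sup>2) *s w) $ \<alpha>)"
      using pdeg_square[OF line] by simp
    then have "pdeg 3 (\<lambda>s. of_real s ^ 1 * g (\<pi>, of_real (s\<^sup>2) *s w) $ \<alpha>)"
      by (rule pdeg_power_mult) simp
    then have "pdeg 3 (\<lambda>s. g (of_real s *s \<pi>, of_real (s\<^sup>2) *s w) $ \<alpha>)"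
      unfolding g1 by simp
    then show "pdeg 3 (\<lambda>s. of_real s ^ m * g (\<pi>, w) $ \<alpha>)"
      unfolding g_hom by simp
  qed (use m in simp)
  then show ?thesis by (cases p) (simp add: vec_eq_iff)
qed

end

section \<open>From tangent germs to the complexified equation\<close>

lemma tangent_iff:
  fixes H :: "'k::finite \<Rightarrow> complex^'n::finite^'n"
  shows "frechet_derivative (defining_fun H) (at (z, w)) (a, b) = 0 \<longleftrightarrow>
    (\<forall>j. complex_of_real (Im (b $ j)) = levi H z (cv a) $ j + levi H a (cv z) $ j)"
proof -
  have "frechet_derivative (defining_fun H) (at (z, w)) (a, b) =
     (\<chi> j. complex_of_real (Im (b $ j)) - (levi H z (cv a) $ j + levi H a (cv z) $ j))"
    using frechet_derivative_at[OF defining_fun_has_derivative[of H z w], symmetric]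
    by (simp add: levi_def sum.distrib)
  then show ?thesis by (simp add: vec_eq_iff)
qed

lemma quadric_iff: "(z, w) \<in> quadric H \<longleftrightarrow> (\<forall>j. complex_of_real (Im (w $ j)) = levi H z (cv z) $ j)"
  by (simp add: quadric_def quadric_form_eq_levi vec_eq_iff)

lemma zw_monomial_scale:
  assumes "ab \<in> multi_indices (int m)"
  shows "zw_monomial ab (s *s z, s\<^sup>2 *s w) = s ^ m * zw_monomial ab (z, w)"
proof -
  obtain a b where ab: "ab = (a, b)" by (cases ab)
  have "int ((\<Sum>\<alpha>\<in>UNIV. a \<alpha>) + 2 * (\<Sum>j\<in>UNIV. b j)) = int m"
    using assms unfolding ab multi_indices_def by blast
  then have m: "m = (\<Sum>\<alpha>\<in>UNIV. a \<alpha>) + (\<Sum>j\<in>UNIV. 2 * b j)"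
    by (simp only: of_nat_eq_iff sum_distrib_left)
  show ?thesis unfolding m
    by (simp add: ab zw_monomial_def power_mult_distrib prod.distrib power_add power_sum power_mult)
qed

lemma polyc_levi:
  assumes "\<And>\<alpha>. polyc (\<lambda>t. x t $ \<alpha>)" "\<And>\<alpha>. polyc (\<lambda>t. y t $ \<alpha>)"
  shows "polyc (\<lambda>t. levi H (x t) (y t) $ j)"
  by (simp add: levi_def matrix_vector_mult_def polyc_intros assms)

lemma real_form_decompose: "\<exists>x y. x + \<i> *s y = (a :: complex^'m) \<and> cv x + \<i> *s cv y = b"
proof (intro exI conjI)
  let ?x = "(1/2) *s (a + cv b)" and ?y = "(- \<i>/2) *s (a - cv b)"
  show "?x + \<i> *s ?y = a" "cv ?x + \<i> *s cv ?y = b"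
    by (simp_all add: vec_eq_iff field_simps)
qed

context levi_form begin

text \<open>A field of fixed weight is polynomial near 0. Tangency is thus a polynomial identity on
  the real points near 0, and it extends to independent \<open>z\<close>, \<open>\<zeta>\<close>,
  \<open>w\<close>.\<close>

lemma graded_solution:
  assumes "X \<in> graded_component H (int d)"
  shows "\<exists>f h g l. cr_weighted H f h g l (d + 1) \<and> h (0, 0) = 0 \<and> (\<forall>\<^sub>F p in nhds 0. X p = (f p, h p))"
proof -
  have fw: "field_weight X (int d)" and "X \<in> aut_alg H"
    using assms by (auto simp: graded_component_def)
  then obtain U where U: "open U" "0 \<in> U" "tangent_on H X U" unfolding aut_alg_def by blast
  have d12: "int d + 1 = int (d + 1)" "int d + 2 = int (d + 2)" by simp_all
  obtain cf where cf: "\<And>\<alpha>. \<forall>\<^sub>F p in nhds 0. fst (X p) $ \<alpha>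
      = (\<Sum>ab\<in>multi_indices (int (d + 1)). cf \<alpha> ab * zw_monomial ab p)"
    using choice[OF fw[unfolded field_weight_def fun_weight_def d12, THEN conjunct1]] by blast
  obtain ch where ch: "\<And>j. \<forall>\<^sub>F p in nhds 0. snd (X p) $ j = (\<Sum>ab\<in>multi_indices (int (d
      + 2)). ch j ab * zw_monomial ab p)"
    using choice[OF fw[unfolded field_weight_def fun_weight_def d12, THEN conjunct2]] by blast
  define f where "f = (\<lambda>p. (\<chi> \<alpha>. \<Sum>ab\<in>multi_indices (int (d + 1)). cf \<alpha> ab * zw_monomial ab p) :: complex^'n)"
  define h where "h = (\<lambda>p. (\<chi> j. \<Sum>ab\<in>multi_indices (int (d + 2)). ch j ab * zw_monomial ab p) :: complex^'k)"
  define cc where "cc = (\<lambda>p :: (complex^'n) \<times> (complex^'k). (cv (fst p), cv (snd p)))"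
  define g where "g = (\<lambda>p. cv (f (cc p)))"
  define l where "l = (\<lambda>p. cv (h (cc p)))"
  have "\<forall>\<^sub>F p in nhds 0. (\<forall>\<alpha>. fst (X p) $ \<alpha> = f p $ \<alpha>) \<and> (\<forall>j. snd (X p) $ j = h p $ j)"
    using cf ch by (simp add: f_def h_def eventually_conj_iff eventually_all_finite)
  then have Xe: "\<forall>\<^sub>F p in nhds 0. X p = (f p, h p)"
    by eventually_elim (simp add: prod_eq_iff vec_eq_iff)
  have vf: "vpolyf f" and vh: "vpolyf h" unfolding vpolyf_def f_def h_def
    by (simp_all add: polyf_intros polyf_zw_monomial)
  have vg: "vpolyf g" and vl: "vpolyf l"
    using vf vh polyf_cnj by (fastforce simp: vpolyf_def g_def l_def cc_def)+
  have hf: "f (s *s z, s\<^sup>2 *s w) = s ^ (d + 1) *s f (z, w)" for s z w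
    by (simp add: f_def vec_eq_iff zw_monomial_scale sum_distrib_left algebra_simps del: power_Suc of_nat_add of_nat_Suc cong: sum.cong)
  have coeff_w: "h (s *s z, s\<^sup>2 *s w) = s ^ (d + 2) *s h (z, w)" for s z w
    by (simp add: h_def vec_eq_iff zw_monomial_scale sum_distrib_left algebra_simps del: power_Suc of_nat_add of_nat_Suc cong: sum.cong)
  have h0: "h (0, 0) = 0" using coeff_w[of 0 0 0] by simp
  \<comment> \<open>With \<open>w = u + \<i> *s B z \<zeta>\<close>, the real points are those with
    \<open>\<zeta> = cv z\<close> and \<open>u\<close> real.\<close>
  define E where "E = (\<lambda>z \<zeta> u j. h (z, u + \<i> *s B z \<zeta>) $ j - l (\<zeta>, u - \<i> *s B z \<zeta>) $ j
     - ii * (B (f (z, u + \<i> *s B z \<zeta>)) \<zeta> $ j + B z (g (\<zeta>, u - \<i> *s B z \<zeta>)) $ j))"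
  have real: "\<forall>\<^sub>F p in nhds 0. \<forall>z u j. cv u = u \<longrightarrow> p = (z, u + \<i> *s B z (cv z)) \<longrightarrow> E z (cv z) u j = 0"
    using Xe eventually_nhds_in_open[OF U(1,2)]
  proof eventually_elim
    case (elim p)
    show ?case
    proof (intro allI impI)
      fix z u j assume u: "cv u = u" and p: "p = (z, u + \<i> *s B z (cv z))"
      let ?w = "u + \<i> *s B z (cv z)"
      have cw: "cv ?w = u - \<i> *s B z (cv z)" using u by (simp add: cv_B)
      have "(z, ?w) \<in> quadric H"
        unfolding quadric_iff
      proof
        fix j
        have "cnj (u $ j) = u $ j" "cnj (B z (cv z) $ j) = B z (cv z) $ j"
          using u cv_B[of z "cv z"] by (metis cv_cv cv_simps(6))+
        then have "Im (u $ j) = 0" "Im (B z (cv z) $ j) = 0"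
          by (simp_all add: complex_eq_iff)
        then show "complex_of_real (Im (?w $ j)) = B z (cv z) $ j"
          by (simp add: complex_eq_iff)
      qed
      then have "frechet_derivative (defining_fun H) (at (z, ?w)) (X (z, ?w)) = 0"
        using U(3) elim p unfolding tangent_on_def by blast
      then have "frechet_derivative (defining_fun H) (at (z, ?w)) (f (z, ?w), h (z, ?w)) = 0"
        using elim p by simp
      then have t: "complex_of_real (Im (h (z, ?w) $ j)) = B z (cv (f (z, ?w))) $ j + B (f (z, ?w)) (cv z) $ j"
        unfolding tangent_iff by blast
      have "h (z, ?w) $ j - cnj (h (z, ?w) $ j) = ii * complex_of_real (Im (h (z, ?w) $ j))"
        by (simp add: complex_eq_iff)
      moreover have "g (cv z, u - \<i> *s B z (cv z)) = cv (f (z, ?w))" "l (cv z, u - \<i> *s B z (cv z)) $ j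
          = cnj (h (z, ?w) $ j)"
        unfolding cw[symmetric] by (simp_all add: g_def l_def cc_def del: cv_simps(2))
      ultimately show "E z (cv z) u j = 0" unfolding E_def t by (simp add: algebra_simps)
    qed
  qed
  have Ezero: "E z \<zeta> u j = 0" for z \<zeta> u j
  proof -
    \<comment> \<open>For real \<open>t\<close> the curve built from \<open>t z1 + t^2 z2\<close>
      consists of real points; at \<open>t = \<i>\<close> it reaches the given point, because
      \<open>\<i> (z1 + \<i> z2) = z\<close>. A polynomial in \<open>t\<close> that vanishes for
      small real \<open>t\<close> also vanishes at \<open>\<i>\<close>.\<close>
    obtain z1 z2 where z12: "z1 + \<i> *s z2 = (- \<i>) *s z" "cv z1 + \<i> *s cv z2 = (- \<i>) *s \<zeta>"
      using real_form_decompose by blast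
    define u1 u2 where "u1 = (1/2) *s ((- \<i>) *s u + cv ((- \<i>) *s u))" and "u2
        = (- \<i>/2) *s ((- \<i>) *s u - cv ((- \<i>) *s u))"
    have u12: "cv u1 = u1" "cv u2 = u2" "u1 + \<i> *s u2 = (- \<i>) *s u"
      by (simp_all add: u1_def u2_def vec_eq_iff field_simps)
    define cz where "cz = (\<lambda>t. t *s z1 + t\<^sup>2 *s z2)"
    define c\<zeta> where "c\<zeta> = (\<lambda>t. t *s cv z1 + t\<^sup>2 *s cv z2)"
    define cu where "cu = (\<lambda>t. t *s u1 + t\<^sup>2 *s u2)"
    have pz: "polyc (\<lambda>t. cz t $ \<alpha>)" "polyc (\<lambda>t. c\<zeta> t $ \<alpha>)" for \<alpha> unfolding cz_def c\<zeta>_def by (simp_all add: polyc_intros)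
    have pu: "polyc (\<lambda>t. cu t $ j)" for j unfolding cu_def by (simp add: polyc_intros)
    have pB: "polyc (\<lambda>t. B (cz t) (c\<zeta> t) $ j)" for j by (rule polyc_levi[OF pz])
    have pw: "polyc (\<lambda>t. (cu t + \<i> *s B (cz t) (c\<zeta> t)) $ j)" "polyc (\<lambda>t. (cu t - \<i> *s B (cz t) (c\<zeta> t)) $ j)" for j
      by (simp_all add: polyc_intros pu pB)
    have pE: "polyc (\<lambda>t. E (cz t) (c\<zeta> t) (cu t) j)" unfolding E_def
      by (intro polyc_diff polyc_mult[OF polyc_const] polyc_add polyc_levi pz
          polyc_comp[OF vpolyf_nth[OF vf]] polyc_comp[OF vpolyf_nth[OF vh]]
          polyc_comp[OF vpolyf_nth[OF vg]] polyc_comp[OF vpolyf_nth[OF vl]] pw)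
    have "E (cz \<i>) (c\<zeta> \<i>) (cu \<i>) j = 0"
    proof (rule polyc_zero[OF pE])
      define \<gamma> where "\<gamma> = (\<lambda>t::real. (cz (of_real t), cu (of_real t) + \<i> *s B (cz (of_real t)) (c\<zeta> (of_real t))))"
      have tend: "((\<lambda>t::real. q (of_real t)) \<longlongrightarrow> q 0) (at 0)" if pq: "polyc q" for q
      proof -
        obtain r where "\<And>t. q t = poly r t" using pq unfolding polyc_def by blast
        then have "isCont (\<lambda>t::real. q (of_real t)) 0" by (simp add: continuous_intros)
        then show ?thesis by (simp add: isCont_def)
      qed
      have "((\<lambda>t::real. cz (of_real t)) \<longlongrightarrow> cz 0) (at 0)"
        by (rule vec_tendstoI) (rule tend[OF pz(1)])
      moreover have "((\<lambda>t::real. cu (of_real t) + \<i> *s B (cz (of_real t)) (c\<zeta> (of_real t))) \<longlongrightarrow>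
          cu 0 + \<i> *s B (cz 0) (c\<zeta> 0)) (at 0)"
        by (rule vec_tendstoI) (rule tend[OF pw(1)])
      ultimately have "(\<gamma> \<longlongrightarrow> (cz 0, cu 0 + \<i> *s B (cz 0) (c\<zeta> 0))) (at 0)"
        unfolding \<gamma>_def by (rule tendsto_Pair)
      then have "(\<gamma> \<longlongrightarrow> 0) (at 0)" by (simp add: cz_def c\<zeta>_def cu_def zero_prod_def)
      from eventually_compose_filterlim[OF real this]
      show "\<forall>\<^sub>F t::real in at 0. E (cz (of_real t)) (c\<zeta> (of_real t)) (cu (of_real t)) j = 0"
      proof eventually_elim
        case (elim t)
        have "c\<zeta> (of_real t) = cv (cz (of_real t))" "cv (cu (of_real t)) = cu (of_real t)"
          by (simp_all add: c\<zeta>_def cz_def cu_def u12)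
        then show ?case using elim by (simp add: \<gamma>_def)
      qed
    qed
    moreover have "\<i> *s x + \<i>\<^sup>2 *s y = z" if "x + \<i> *s y = (- \<i>) *s z" for x y z :: "complex^'a"
      using arg_cong[OF that, of "\<lambda>v. \<i> *s v"] by (simp add: vector_add_ldistrib)
    then have "cz \<i> = z" "c\<zeta> \<i> = \<zeta>" unfolding cz_def c\<zeta>_def using z12 by blast+
    moreover have "\<i> *s x + \<i>\<^sup>2 *s y = z" if "x + \<i> *s y = (- \<i>) *s z" for x y z :: "complex^'k"
      using arg_cong[OF that, of "\<lambda>v. \<i> *s v"] by (simp add: vector_add_ldistrib)
    then have "cu \<i> = u" unfolding cu_def using u12 by blast
    ultimately show ?thesis by simp
  qed
  have "cr_solution H f h g l"
    unfolding cr_solution_def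
  proof (intro conjI allI vf vh vg vl)
    fix z \<zeta> w
    have s: "w - \<i> *s B z \<zeta> + \<i> *s B z \<zeta> = w" "w - \<i> *s B z \<zeta> - \<i> *s B z \<zeta> = w - ii *s B z \<zeta>"
      by (simp_all add: vec_eq_iff algebra_simps)
    show "h (z, w) - l (\<zeta>, w - ii *s B z \<zeta>) = ii *s (B (f (z, w)) \<zeta> + B z (g (\<zeta>, w - ii *s B z \<zeta>)))"
      using Ezero[of z \<zeta> "w - \<i> *s B z \<zeta>"] unfolding E_def s
      by (simp add: vec_eq_iff distrib_left)
  qed
  then have "cr_weighted H f h g l (d + 1)"
  proof unfold_locales
    show "f (of_real s *s z, of_real (s\<^sup>2) *s w) = of_real s ^ (d + 1) *s f (z, w)" for s z w
      using hf[of "of_real s" z w] by simp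
  qed (assumption, simp add: g_def cc_def)
  then show ?thesis using h0 Xe by blast
qed

lemma zero_germ_if_coefficient_zero:
  assumes "cr_weighted H f h g l m" "h (0, 0) = 0" "\<forall>\<^sub>F p in nhds 0. X p = (f p, h p)" "\<And>p. g p = 0"
  shows "zero_germ X"
proof -
  interpret cr_weighted H f h g l m by fact
  have "f p = 0" "h p = 0" for p
    using f_zero_if_g_zero cr_h_zero[OF sol] assms(2,4) by blast+
  then show ?thesis unfolding zero_germ_def using assms(3) by (simp add: zero_prod_def)
qed

lemma graded_component_zero_if_small:
  assumes "CARD('n) \<le> 3 \<or> CARD('k) \<le> 3 \<or> CARD('n)\<^sup>2 - CARD('n) \<le> CARD('k)" "3 \<le> d"
  shows "\<not> nonzero_component H d"
proof -
  have "zero_germ X" if "X \<in> graded_component H d" for X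
  proof -
    obtain f h g l where w: "cr_weighted H f h g l (nat d + 1)" "h (0, 0) = 0" "\<forall>\<^sub>F p in nhds 0. X p = (f p, h p)"
      using graded_solution[of X "nat d"] \<open>X \<in> _\<close> assms(2) by auto
    interpret cr_weighted H f h g l "nat d + 1" by (rule w)
    show ?thesis by (rule zero_germ_if_coefficient_zero[OF w g_zero_if_small[OF assms(1)]]) (use assms(2) in linarith)
  qed
  then show ?thesis unfolding nonzero_component_def by blast
qed

text \<open>A basis chosen among the values of \<open>B\<close> is finite and supplies the set
  \<open>S\<close> of \<open>g_zero_if_large\<close>.\<close>

lemma graded_component_bounded: "\<exists>D. \<forall>d > D. \<not> nonzero_component H d"
proof -
  obtain S where S: "S \<subseteq> {B z \<zeta> |z \<zeta>. True}" "vec.independent S" "{B z \<zeta> |z \<zeta>. True} \<subseteq> vec.span S"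
    by (rule vec.basis_exists[of "{B z \<zeta> |z \<zeta>. True}"]) (rule that)
  have fin: "finite S" using S(2) vec.finiteI_independent by blast
  have sp: "vec.span S = UNIV" using S(3) span_levi vec.span_minimal[OF S(3) vec.subspace_span] by blast
  have "\<not> nonzero_component H d" if d: "d > int (4 * card S + 2)" for d
  proof -
    have "zero_germ X" if "X \<in> graded_component H d" for X
    proof -
      obtain f h g l where w: "cr_weighted H f h g l (nat d + 1)" "h (0, 0) = 0" "\<forall>\<^sub>F p in nhds 0. X p = (f p, h p)"
        using graded_solution[of X "nat d"] \<open>X \<in> _\<close> d by auto
      interpret cr_weighted H f h g l "nat d + 1" by (rule w)
      show ?thesis by (rule zero_germ_if_coefficient_zero[OF w g_zero_if_large[OF fin S(1) sp]]) (use d in linarith)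
    qed
    then show ?thesis unfolding nonzero_component_def by blast
  qed
  then show ?thesis by blast
qed

text \<open>The weights at least 3 with nonzero component are bounded, and their maximum is the top
  weight.\<close>

lemma exceptional_quadricI:
  assumes "nonzero_component H 3" shows "exceptional_quadric H"
proof -
  obtain D where D: "\<And>d. d > D \<Longrightarrow> \<not> nonzero_component H d" using graded_component_bounded by blast
  let ?W = "{d. 3 \<le> d \<and> nonzero_component H d}"
  have "?W \<subseteq> {3..D}" using D by force
  then have fin: "finite ?W" using finite_subset by blast
  have ne: "?W \<noteq> {}" using assms by auto
  have "Max ?W \<in> ?W" using fin ne by (rule Max_in)
  moreover have "\<not> nonzero_component H d" if "d > Max ?W" for d
  proof
    assume "nonzero_component H d"
    then have "d \<in> ?W" using that \<open>Max ?W \<in> ?W\<close> by auto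
    then show False using that fin Max_ge by fastforce
  qed
  ultimately show ?thesis
    unfolding exceptional_quadric_def is_top_weight_def using nondeg by blast
qed

end

lemma nonexceptional_small:
  assumes "CARD('n::finite) \<le> 3 \<or> CARD('k::finite) \<le> 3 \<or> CARD('n)\<^sup>2 - CARD('n) \<le> CARD('k)"
  shows "nonexceptional_type TYPE('n) TYPE('k)"
  unfolding nonexceptional_type_def exceptional_type_def
proof
  assume "\<exists>H :: 'k \<Rightarrow> complex^'n^'n. exceptional_quadric H"
  then obtain H :: "'k \<Rightarrow> complex^'n^'n" and l where H: "nondegenerate H" "nonzero_component H l" "3 \<le> l"
    unfolding exceptional_quadric_def is_top_weight_def by blast
  interpret levi_form H by unfold_locales (rule H)
  show False using graded_component_zero_if_small[OF assms H(3)] H(2) by blast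
qed

section \<open>Exceptional quadrics\<close>

lemma fun_weight_cong:
  assumes "fun_weight f m" "\<forall>\<^sub>F p in nhds 0. g p = f p" shows "fun_weight g m"
proof -
  obtain c where "\<forall>\<^sub>F p in nhds 0. f p = (\<Sum>ab\<in>multi_indices m. c ab * zw_monomial ab p)"
    using assms(1) unfolding fun_weight_def by blast
  with assms(2) have "\<forall>\<^sub>F p in nhds 0. g p = (\<Sum>ab\<in>multi_indices m. c ab * zw_monomial ab p)"
    by eventually_elim simp
  then show ?thesis unfolding fun_weight_def by blast
qed

lemma fun_weight_monomial:
  assumes "ab \<in> multi_indices m" shows "fun_weight (zw_monomial ab) m"
proof -
  have "zw_monomial ab p = (\<Sum>cd\<in>multi_indices m. (if cd = ab then 1 else 0) * zw_monomial cd p)" for p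
  proof -
    have "(\<Sum>cd\<in>multi_indices m. (if cd = ab then 1 else 0) * zw_monomial cd p) =
        (\<Sum>cd\<in>multi_indices m. if cd = ab then zw_monomial cd p else 0)"
      by (intro sum.cong) auto
    then show ?thesis using assms by (simp add: finite_multi_indices)
  qed
  then show ?thesis unfolding fun_weight_def
    by (intro exI[of _ "\<lambda>cd. if cd = ab then 1 else 0"] always_eventually) blast
qed

lemma fun_weight_cmult: "fun_weight f m \<Longrightarrow> fun_weight (\<lambda>p. c * f p) m"
proof -
  assume "fun_weight f m"
  then obtain k where "\<forall>\<^sub>F p in nhds 0. f p = (\<Sum>ab\<in>multi_indices m. k ab * zw_monomial ab p)"
    unfolding fun_weight_def by blast
  then have "\<forall>\<^sub>F p in nhds 0. c * f p = (\<Sum>ab\<in>multi_indices m. (c * k ab) * zw_monomial ab p)"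
    by eventually_elim (simp add: sum_distrib_left mult.assoc)
  then show ?thesis unfolding fun_weight_def by (intro exI[of _ "\<lambda>ab. c * k ab"])
qed

lemma fun_weight_add: "fun_weight f m \<Longrightarrow> fun_weight g m \<Longrightarrow> fun_weight (\<lambda>p. f p + g p) m"
proof -
  assume "fun_weight f m" "fun_weight g m"
  then obtain k l where "\<forall>\<^sub>F p in nhds 0. f p = (\<Sum>ab\<in>multi_indices m. k ab * zw_monomial ab p)"
    "\<forall>\<^sub>F p in nhds 0. g p = (\<Sum>ab\<in>multi_indices m. l ab * zw_monomial ab p)"
    unfolding fun_weight_def by blast
  then have "\<forall>\<^sub>F p in nhds 0. f p + g p = (\<Sum>ab\<in>multi_indices m. (k ab + l ab) * zw_monomial ab p)"
    by eventually_elim (simp add: sum.distrib distrib_right)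
  then show ?thesis unfolding fun_weight_def by (intro exI[of _ "\<lambda>ab. k ab + l ab"])
qed

lemma fun_weight_zero: "fun_weight (\<lambda>p. 0) m"
  unfolding fun_weight_def by (intro exI[of _ "\<lambda>_. 0"]) simp

lemma fun_weight_diff: "fun_weight f m \<Longrightarrow> fun_weight g m \<Longrightarrow> fun_weight (\<lambda>p. f p - g p) m"
  using fun_weight_add[OF _ fun_weight_cmult[of g m "-1"]] by simp

lemma fun_weight_sum: "(\<And>i. i \<in> I \<Longrightarrow> fun_weight (f i) m) \<Longrightarrow> fun_weight (\<lambda>p. \<Sum>i\<in>I. f i p) m"
  by (induction I rule: infinite_finite_induct) (auto intro: fun_weight_zero fun_weight_add)

lemma fun_weight_mult:
  fixes f g :: "(complex^'n::finite) \<times> (complex^'k::finite) \<Rightarrow> complex"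
  assumes "fun_weight f m" "fun_weight g m'"
  shows "fun_weight (\<lambda>p. f p * g p) (m + m')"
proof -
  obtain k l where kl: "\<forall>\<^sub>F p in nhds 0. f p = (\<Sum>ab\<in>multi_indices m. k ab * zw_monomial ab p)"
    "\<forall>\<^sub>F p in nhds 0. g p = (\<Sum>ab\<in>multi_indices m'. l ab * zw_monomial ab p)"
    using assms unfolding fun_weight_def by blast
  define pl where "pl = (\<lambda>(ab :: ('n \<Rightarrow> nat) \<times> ('k \<Rightarrow> nat)) cd. (\<lambda>\<alpha>. fst ab \<alpha> + fst cd \<alpha>, \<lambda>j. snd ab j + snd cd j))"
  have mon: "zw_monomial (pl ab cd) p = zw_monomial ab p * zw_monomial cd p" for ab cd p
    by (simp add: zw_monomial_def pl_def power_add prod.distrib split: prod.split)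
  have mi: "pl ab cd \<in> multi_indices (m + m')" if "ab \<in> multi_indices m" "cd \<in> multi_indices m'" for ab cd
    using that by (auto simp: multi_indices_def pl_def sum.distrib)
  have "fun_weight (\<lambda>p. \<Sum>ab\<in>multi_indices m. \<Sum>cd\<in>multi_indices m'. (k ab * l cd) * zw_monomial (pl ab cd) p) (m + m')"
    by (intro fun_weight_sum fun_weight_cmult fun_weight_monomial mi)
  moreover have "\<forall>\<^sub>F p in nhds 0. f p * g p
      = (\<Sum>ab\<in>multi_indices m. \<Sum>cd\<in>multi_indices m'. (k ab * l cd) * zw_monomial (pl ab cd) p)"
    using kl by eventually_elim (simp add: sum_product mon algebra_simps)
  ultimately show ?thesis by (rule fun_weight_cong)
qed

lemma fun_weight_fst:
  fixes \<alpha> :: "'n::finite"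
  shows "fun_weight (\<lambda>p :: (complex^'n) \<times> (complex^'k::finite). fst p $ \<alpha>) 1"
proof -
  have "(\<Prod>x\<in>UNIV. z $ x ^ (if x = \<alpha> then 1 else 0)) = z $ \<alpha>" for z :: "complex^'n"
  proof -
    have "(\<Prod>x\<in>UNIV. z $ x ^ (if x = \<alpha> then 1 else 0)) = (\<Prod>x\<in>UNIV. if x = \<alpha> then z $ x else 1)"
      by (intro prod.cong) auto
    then show ?thesis by simp
  qed
  then have "zw_monomial (\<lambda>x. if x = \<alpha> then 1 else 0, \<lambda>_. 0) = (\<lambda>p :: (complex^'n) \<times> (complex^'k). fst p $ \<alpha>)"
    by (auto simp: zw_monomial_def)
  moreover have "(\<lambda>x. if x = \<alpha> then 1 else 0, \<lambda>_. 0) \<in> multi_indices 1"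
    by (simp add: multi_indices_def del: of_nat_sum)
  ultimately show ?thesis using fun_weight_monomial by metis
qed

lemma fun_weight_snd:
  fixes j :: "'k::finite"
  shows "fun_weight (\<lambda>p :: (complex^'n::finite) \<times> (complex^'k). snd p $ j) 2"
proof -
  have "(\<Prod>x\<in>UNIV. w $ x ^ (if x = j then 1 else 0)) = w $ j" for w :: "complex^'k"
  proof -
    have "(\<Prod>x\<in>UNIV. w $ x ^ (if x = j then 1 else 0)) = (\<Prod>x\<in>UNIV. if x = j then w $ x else 1)"
      by (intro prod.cong) auto
    then show ?thesis by simp
  qed
  then have "zw_monomial (\<lambda>_. 0, \<lambda>x. if x = j then 1 else 0) = (\<lambda>p :: (complex^'n) \<times> (complex^'k). snd p $ j)"
    by (auto simp: zw_monomial_def)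
  moreover have "(\<lambda>_. 0, \<lambda>x. if x = j then 1 else 0) \<in> multi_indices 2"
    by (simp add: multi_indices_def del: of_nat_sum)
  ultimately show ?thesis using fun_weight_monomial by metis
qed

lemma has_derivative_vec:
  fixes g :: "'v::real_normed_vector \<Rightarrow> complex^'m::finite"
  assumes "\<And>j. ((\<lambda>p. g p $ j) has_derivative (\<lambda>x. g' x $ j)) (at p)"
  shows "(g has_derivative g') (at p)"
proof -
  have e: "q = (\<lambda>p. \<Sum>j\<in>UNIV. axis j (q p $ j))" for q :: "'v \<Rightarrow> complex^'m"
    by (rule ext) (simp add: vec_eq_iff axis_def)
  have "bounded_linear (axis j :: complex \<Rightarrow> complex^'m)" for j
    by (intro linear_conv_bounded_linear[THEN iffD1] linearI) (auto simp: axis_def vec_eq_iff)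
  then show ?thesis
    by (subst (1 2) e) (intro has_derivative_sum bounded_linear.has_derivative[OF _ assms])
qed

lemma vholomorphic_on_poly:
  assumes f: "vpolyf f" and h: "vpolyf h"
  shows "vholomorphic_on (\<lambda>p. (f p, h p)) U"
  unfolding vholomorphic_on_def
proof
  fix p
  have d: "(g has_derivative (\<lambda>x. vddir x g p)) (at p)" if "vpolyf g"
      for g :: "(complex^'a) \<times> (complex^'b) \<Rightarrow> complex^'m" and p
    by (rule has_derivative_vec) (simp add: vddir_def polyf_has_derivative vpolyf_nth[OF that])
  show "\<exists>D. ((\<lambda>p. (f p, h p)) has_derivative D) (at p) \<and> (\<forall>v. D (cscale \<i> v) = cscale \<i> (D v))"
  proof (intro exI conjI allI)
    show "((\<lambda>p. (f p, h p)) has_derivative (\<lambda>x. (vddir x f p, vddir x h p))) (at p)"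
      by (intro has_derivative_Pair d f h)
    show "(vddir (cscale \<i> v) f p, vddir (cscale \<i> v) h p) = cscale \<i> (vddir v f p, vddir v h p)" for v
      by (simp add: vddir_cscale f h) (simp add: cscale_def)
  qed
qed

text \<open>The Hermitian matrices \<open>(1 + \<i>) E\<^sub>\<alpha>\<^sub>\<beta> + (1 - \<i>) E\<^sub>\<beta>\<^sub>\<alpha>\<close>, over all ordered pairs \<open>(\<alpha>, \<beta>)\<close>, form a
  real basis; using \<open>1 + \<i>\<close> instead of \<open>1\<close> and \<open>\<i>\<close> avoids ordering the indices.\<close>

definition herm_basis :: "'n \<times> 'n \<Rightarrow> complex^'n^'n" where
  "herm_basis = (\<lambda>(\<alpha>, \<beta>). \<chi> x y. (if x = \<alpha> \<and> y = \<beta> then 1 + \<i> else 0) + (if x = \<beta> \<and> y = \<alpha> then 1 - \<i> else 0))"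

lemma herm_basis_nth:
  "herm_basis p $ x $ y = (if p = (x, y) then 1 + \<i> else 0) + (if p = (y, x) then 1 - \<i> else 0)"
proof -
  obtain a b where p: "p = (a, b)" by (cases p)
  have "x = a \<and> y = b \<longleftrightarrow> p = (x, y)" "x = b \<and> y = a \<longleftrightarrow> p = (y, x)" using p by auto
  moreover have "herm_basis p $ x $ y =
      (if x = a \<and> y = b then 1 + \<i> else 0) + (if x = b \<and> y = a then 1 - \<i> else 0)"
    unfolding p herm_basis_def by (simp only: case_prod_conv vec_lambda_beta)
  ultimately show ?thesis by (simp only:)
qed

lemma cnj_herm_basis: "cnj (herm_basis p $ y $ x) = herm_basis p $ x $ y"
proof -
  have "cnj ((if P then 1 + \<i> else 0) + (if Q then 1 - \<i> else 0)) =
      (if Q then 1 + \<i> else 0) + (if P then 1 - \<i> else 0)" for P Q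
    by simp
  then show ?thesis unfolding herm_basis_nth .
qed

text \<open>The leading part \<open>a = (a\<^sub>3, a\<^sub>4)\<close> of the field \<open>(coeff_z, coeff_w)\<close> satisfies
  \<open>a\<^sub>3 \<bar>z\<^sub>1 + a\<^sub>4 \<bar>z\<^sub>2 = 0\<close> at \<open>w = \<langle>z, \<bar>z\<rangle>\<close>, because \<open>a\<close> only depends on the
  coordinates of \<open>w\<close> carrying \<open>\<bar>z\<^sub>1\<bar>\<^sup>2\<close> and \<open>z\<^sub>1 \<bar>z\<^sub>2\<close>.\<close>

locale exceptional_example =
  fixes i1 i2 i3 i4 :: "'n::finite" and j0 j1 j2 j3 :: "'k::finite" and e :: "'k \<Rightarrow> 'n \<times> 'n"
  assumes i_dist: "distinct [i1, i2, i3, i4]" and j_dist: "distinct [j0, j1, j2, j3]"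
    and e_inj: "inj_on e (UNIV - {j0})"
    and e_range: "\<And>j. j \<noteq> j0 \<Longrightarrow> fst (e j) \<notin> {i3, i4} \<and> snd (e j) \<notin> {i3, i4}"
    and e_vals: "e j1 = (i1, i1)" "e j2 = (i1, i2)" "e j3 = (i2, i1)"
begin

text \<open>The permutation matrix of this involution is the form with index \<open>j0\<close>. It
  is symmetric and invertible, so it alone excludes a common kernel.\<close>

definition sw :: "'n \<Rightarrow> 'n" where
  "sw x = (if x = i1 then i3 else if x = i3 then i1 else if x = i2 then i4 else if x = i4 then i2 else x)"

definition forms :: "'k \<Rightarrow> complex^'n^'n" where
  "forms j = (if j = j0 then \<chi> x y. if y = sw x then 1 else 0 else herm_basis (e j))"

lemma i_neq [simp]: "i1 \<noteq> i2" "i1 \<noteq> i3" "i1 \<noteq> i4" "i2 \<noteq> i3" "i2 \<noteq> i4" "i3 \<noteq> i4"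
  "i2 \<noteq> i1" "i3 \<noteq> i1" "i4 \<noteq> i1" "i3 \<noteq> i2" "i4 \<noteq> i2" "i4 \<noteq> i3"
  using i_dist by auto

lemma j_neq [simp]: "j0 \<noteq> j1" "j0 \<noteq> j2" "j0 \<noteq> j3" "j1 \<noteq> j2" "j1 \<noteq> j3" "j2 \<noteq> j3"
  "j1 \<noteq> j0" "j2 \<noteq> j0" "j3 \<noteq> j0" "j2 \<noteq> j1" "j3 \<noteq> j1" "j3 \<noteq> j2"
  using j_dist by auto

lemma sw_sw: "sw (sw x) = x"
  by (simp add: sw_def)

lemma levi_j0: "levi forms z \<zeta> $ j0 = (\<Sum>x\<in>UNIV. z $ sw x * \<zeta> $ x)"
proof -
  have "(forms j0 *v z) $ x = (\<Sum>y\<in>UNIV. if y = sw x then z $ y else 0)" for x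
    unfolding matrix_vector_mult_def forms_def by (simp only: vec_lambda_beta if_True, intro sum.cong) auto
  then show ?thesis by (simp add: levi_def)
qed

lemma levi_herm_basis:
  assumes "j \<noteq> j0" "e j = (\<alpha>, \<beta>)"
  shows "levi forms z \<zeta> $ j = (1 + \<i>) * z $ \<beta> * \<zeta> $ \<alpha> + (1 - \<i>) * z $ \<alpha> * \<zeta> $ \<beta>"
proof -
  have "(forms j *v z) $ x = (if x = \<alpha> then (1 + \<i>) * z $ \<beta> else 0) + (if x = \<beta> then (1 - \<i>) * z $ \<alpha> else 0)" for x
  proof -
    have "(forms j *v z) $ x = (\<Sum>y\<in>UNIV. ((if x = \<alpha> \<and> y = \<beta> then 1 + \<i> else 0) + (if x
        = \<beta> \<and> y = \<alpha> then 1 - \<i> else 0)) * z $ y)"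
      using assms by
          (simp only: matrix_vector_mult_def forms_def herm_basis_def vec_lambda_beta case_prod_conv if_False)
    also have "\<dots> = (\<Sum>y\<in>UNIV. (if y = \<beta> then (if x = \<alpha> then (1 + \<i>) * z $ y else 0) else 0)
        + (if y = \<alpha> then (if x = \<beta> then (1 - \<i>) * z $ y else 0) else 0))"
      by (intro sum.cong) (auto simp: algebra_simps)
    finally show ?thesis by (simp add: sum.distrib)
  qed
  then have "levi forms z \<zeta> $ j = (\<Sum>x\<in>UNIV. (if x = \<alpha> then (1
      + \<i>) * z $ \<beta> * \<zeta> $ x else 0) + (if x = \<beta> then (1 - \<i>) * z $ \<alpha> * \<zeta> $ x else 0))"
    unfolding levi_def by (simp only: vec_lambda_beta, intro sum.cong) (auto simp: algebra_simps)
  then show ?thesis by (simp add: sum.distrib)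
qed

lemma nondegenerate_forms: "nondegenerate forms"
  unfolding nondegenerate_def
proof (intro conjI allI impI)
  fix j show "hermitian_matrix (forms j)"
    unfolding hermitian_matrix_def forms_def
  proof (intro allI)
    fix x y
    have sym: "(if y = sw x then 1 else 0) = cnj (if x = sw y then 1 else 0)"
      by (metis complex_cnj_one complex_cnj_zero sw_sw)
    show "(if j = j0 then \<chi> x y. if y = sw x then 1 else 0 else herm_basis (e j)) $ x $ y =
        cnj ((if j = j0 then \<chi> x y. if y = sw x then 1 else 0 else herm_basis (e j)) $ y $ x)"
    proof (cases "j = j0")
      case True
      then show ?thesis by (simp only: simp_thms if_True vec_lambda_beta sym)
    next
      case False
      then show ?thesis by (simp add: cnj_herm_basis)
    qed
  qed
next
  fix z assume "\<forall>j. forms j *v z = 0"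
  then have "levi forms z (axis x 1) $ j0 = 0" for x by (simp add: levi_def)
  then have "z $ sw x = 0" for x
    unfolding levi_j0 by (simp add: axis_def if_distrib[of "\<lambda>t. _ * t"] cong: if_cong)
  then have "z $ sw (sw x) = 0" for x by blast
  then show "z = 0" unfolding sw_sw by (simp add: vec_eq_iff)
next
  fix c :: "'k \<Rightarrow> real" and j assume s: "(\<Sum>j\<in>UNIV. c j *\<^sub>R forms j) = 0"
  have ent: "(\<Sum>j\<in>UNIV. c j *\<^sub>R forms j $ x $ y) = 0" for x y
    using arg_cong[OF s, of "\<lambda>M. M $ x $ y"] by simp
  \<comment> \<open>The entry at \<open>(i1, i3)\<close> isolates \<open>c j0\<close>, since the
    other forms do not involve \<open>i3\<close>.\<close>
  have "(\<Sum>j\<in>UNIV. c j *\<^sub>R forms j $ i1 $ i3) = (\<Sum>j\<in>UNIV. if j = j0 then complex_of_real (c j) else 0)"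
  proof (intro sum.cong refl)
    fix j show "c j *\<^sub>R forms j $ i1 $ i3 = (if j = j0 then complex_of_real (c j) else 0)"
    proof (cases "j = j0")
      case True
      then show ?thesis by (simp add: forms_def sw_def scaleR_conv_of_real)
    next
      case False
      then have "e j \<noteq> (i1, i3)" "e j \<noteq> (i3, i1)" using e_range[OF False] by auto
      then show ?thesis using False by (simp add: forms_def herm_basis_nth)
    qed
  qed
  then have c0: "c j0 = 0" using ent[of i1 i3] by simp
  show "c j = 0"
  proof (cases "j = j0")
    case False
    obtain x y where xy: "e j = (x, y)" by (cases "e j")
    \<comment> \<open>By injectivity of \<open>e\<close> at most one summand is nonzero:
      \<open>C p\<close> is the coefficient attached to the pair \<open>p\<close>, or 0 if there is
      none.\<close>
    define C where "C = (\<lambda>p. \<Sum>j\<in>UNIV - {j0}. if e j = p then c j else 0)"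
    have Cj: "C (e i) = c i" if "i \<noteq> j0" for i
    proof -
      have "C (e i) = (\<Sum>j\<in>UNIV - {j0}. if j = i then c j else 0)"
        unfolding C_def using e_inj that by (intro sum.cong) (auto simp: inj_on_def)
      then show ?thesis using that by simp
    qed
    have "(\<Sum>j\<in>UNIV. c j *\<^sub>R forms j $ x $ y) = (\<Sum>j\<in>UNIV - {j0}. c j *\<^sub>R forms j $ x $ y)"
      using c0 by (subst sum.remove[of _ j0]) auto
    also have "\<dots> = (\<Sum>j\<in>UNIV - {j0}. (1 + \<i>) * of_real (if e j = (x, y) then c j else 0)
        + (1 - \<i>) * of_real (if e j = (y, x) then c j else 0))"
    proof (intro sum.cong refl)
      have *: "k *\<^sub>R ((if P then 1 + \<i> else 0) + (if Q then 1 - \<i> else 0)) =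
          (1 + \<i>) * of_real (if P then k else 0) + (1 - \<i>) * of_real (if Q then k else 0)" for P Q k
        by (simp add: scaleR_conv_of_real algebra_simps)
      fix j assume "j \<in> UNIV - {j0}"
      then have "forms j = herm_basis (e j)" by (simp add: forms_def)
      then show "c j *\<^sub>R forms j $ x $ y = (1 + \<i>) * of_real (if e j = (x, y) then c j else 0)
          + (1 - \<i>) * of_real (if e j = (y, x) then c j else 0)"
        by (simp only: herm_basis_nth *)
    qed
    also have "\<dots> = (1 + \<i>) * of_real (C (x, y)) + (1 - \<i>) * of_real (C (y, x))"
      unfolding C_def by (simp only: sum.distrib sum_distrib_left of_real_sum)
    finally have "(1 + \<i>) * of_real (C (x, y)) + (1 - \<i>) * of_real (C (y, x)) = 0" using ent by simp
    \<comment> \<open>Both values are real, so the real and imaginary parts say that their sum and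
      their difference vanish.\<close>
    then have "C (x, y) = 0" by (simp add: complex_eq_iff)
    then show ?thesis using Cj[OF False] xy by simp
  qed (use c0 in simp)
qed

text \<open>On values of the Hermitian form, \<open>l11\<close>, \<open>l12\<close>,
  \<open>l21\<close> are four times \<open>z1 conj z1\<close>, \<open>z1 conj z2\<close>,
  \<open>z2 conj z1\<close>.\<close>

definition l11 :: "complex^'k \<Rightarrow> complex" where "l11 w = 2 * w $ j1"
definition l12 :: "complex^'k \<Rightarrow> complex" where "l12 w = (1 - \<i>) * w $ j3 + (1 + \<i>) * w $ j2"
definition l21 :: "complex^'k \<Rightarrow> complex" where "l21 w = (1 + \<i>) * w $ j3 + (1 - \<i>) * w $ j2"

definition coeff_z :: "(complex^'n) \<times> (complex^'k) \<Rightarrow> complex^'n" where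
  "coeff_z p = (\<chi> x. if x = i3 then l12 (snd p) * l11 (snd p) +
        8 * \<i> * fst p $ i1 * (fst p $ i1 * l21 (snd p) - fst p $ i2 * l11 (snd p))
      else if x = i4 then - (l11 (snd p) * l11 (snd p)) else 0)"

definition coeff_w :: "(complex^'n) \<times> (complex^'k) \<Rightarrow> complex^'k" where
  "coeff_w p = (\<chi> j. if j = j0 then 2 * \<i> * l11 (snd p) * (fst p $ i1 * l21 (snd p) - fst p $ i2 * l11 (snd p)) else 0)"

lemma weight_l: "fun_weight (\<lambda>p. l11 (snd p)) 2" "fun_weight (\<lambda>p. l12 (snd p)) 2" "fun_weight (\<lambda>p. l21 (snd p)) 2"
  unfolding l11_def l12_def l21_def by (intro fun_weight_add fun_weight_cmult fun_weight_snd)+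

lemma poly_l: "polyf (\<lambda>p. l11 (snd p))" "polyf (\<lambda>p. l12 (snd p))" "polyf (\<lambda>p. l21 (snd p))"
  unfolding l11_def l12_def l21_def by (intro polyf_intros)+

lemma field_weight_example: "field_weight (\<lambda>p. (coeff_z p, coeff_w p)) 3"
  unfolding field_weight_def
proof (intro conjI allI)
  have Y: "fun_weight (\<lambda>p :: (complex^'n) \<times> (complex^'k). fst p $ i1 * l21 (snd p) - fst p $ i2 * l11 (snd p)) 3"
    using fun_weight_diff[OF fun_weight_mult[OF fun_weight_fst weight_l(3)] fun_weight_mult[OF fun_weight_fst weight_l(1)]]
    by simp
  fix x
  have 3: "fun_weight (\<lambda>p :: (complex^'n) \<times> (complex^'k). l12 (snd p) * l11 (snd p) +
        8 * \<i> * (fst p $ i1 * (fst p $ i1 * l21 (snd p) - fst p $ i2 * l11 (snd p)))) 4"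
    using fun_weight_add[OF _ fun_weight_cmult] fun_weight_mult[OF weight_l(2,1)] fun_weight_mult[OF fun_weight_fst Y]
    by fastforce
  have 4: "fun_weight (\<lambda>p :: (complex^'n) \<times> (complex^'k). - 1 * (l11 (snd p) * l11 (snd p))) 4"
    using fun_weight_cmult[OF fun_weight_mult[OF weight_l(1,1)], of "-1"] by simp
  show "fun_weight (\<lambda>p. fst (coeff_z p, coeff_w p) $ x) (3 + 1)"
    using 3 4 fun_weight_zero by (cases "x = i3"; cases "x = i4") (simp_all add: coeff_z_def mult.assoc)
next
  fix j
  have Y: "fun_weight (\<lambda>p :: (complex^'n) \<times> (complex^'k). fst p $ i1 * l21 (snd p) - fst p $ i2 * l11 (snd p)) 3"
    using fun_weight_diff[OF fun_weight_mult[OF fun_weight_fst weight_l(3)] fun_weight_mult[OF fun_weight_fst weight_l(1)]]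
    by simp
  have "fun_weight (\<lambda>p :: (complex^'n) \<times> (complex^'k). 2 * \<i> * (l11 (snd p) * (fst p $ i1 * l21 (snd p) - fst p $ i2 * l11 (snd p)))) 5"
    using fun_weight_cmult[OF fun_weight_mult[OF weight_l(1) Y], of "2 * \<i>"] by simp
  then show "fun_weight (\<lambda>p. snd (coeff_z p, coeff_w p) $ j) (3 + 2)"
    using fun_weight_zero by (cases "j = j0") (simp_all add: coeff_w_def mult.assoc)
qed

lemma vpolyf_example: "vpolyf coeff_z" "vpolyf coeff_w"
proof -
  have "polyf (\<lambda>p. coeff_z p $ x)" for x
    unfolding coeff_z_def by (cases "x = i3"; cases "x = i4") (auto intro!: polyf_intros poly_l)
  then show "vpolyf coeff_z" by (simp add: vpolyf_def)
  have "polyf (\<lambda>p. coeff_w p $ j)" for j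
    unfolding coeff_w_def by (cases "j = j0") (auto intro!: polyf_intros poly_l)
  then show "vpolyf coeff_w" by (simp add: vpolyf_def)
qed

lemma tangent_example: "tangent_on forms (\<lambda>p. (coeff_z p, coeff_w p)) U"
  unfolding tangent_on_def
proof (rule ballI, clarify)
  fix z w assume "(z, w) \<in> quadric forms"
  then have im: "complex_of_real (Im (w $ j)) = levi forms z (cv z) $ j" for j unfolding quadric_iff by blast
  have w: "w $ j = of_real (Re (w $ j)) + \<i> * levi forms z (cv z) $ j"
    "cnj (w $ j) = of_real (Re (w $ j)) - \<i> * levi forms z (cv z) $ j" for j
    unfolding im[symmetric] by (simp_all add: complex_eq_iff)
  note val = levi_herm_basis[OF _ e_vals(1)] levi_herm_basis[OF _ e_vals(2)] levi_herm_basis[OF _ e_vals(3)]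
  define x1 x2 x3 where "x1 = complex_of_real (Re (w $ j1))" "x2 = complex_of_real (Re (w $ j2))" "x3
      = complex_of_real (Re (w $ j3))"
  define a b a' b' where "a = z $ i1" "b = z $ i2" "a' = cnj (z $ i1)" "b' = cnj (z $ i2)"
  have w1: "w $ j1 = x1 + \<i> * (2 * a * a')" "cnj (w $ j1) = x1 - \<i> * (2 * a * a')"
    and w2: "w $ j2 = x2 + \<i> * ((1 + \<i>) * b * a' + (1 - \<i>) * a * b')" "cnj (w $ j2) = x2 - \<i> * ((1
        + \<i>) * b * a' + (1 - \<i>) * a * b')"
    and w3: "w $ j3 = x3 + \<i> * ((1 + \<i>) * a * b' + (1 - \<i>) * b * a')" "cnj (w $ j3) = x3 - \<i> * ((1
        + \<i>) * a * b' + (1 - \<i>) * b * a')"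
    by (subst w, simp add: val x1_x2_x3_def a_b_a'_b'_def algebra_simps)+
  have cnjs: "cnj x1 = x1" "cnj x2 = x2" "cnj x3 = x3" "cnj a = a'" "cnj b = b'" "cnj a' = a" "cnj b' = b"
    by (simp_all add: x1_x2_x3_def a_b_a'_b'_def)
  define P Q R where "P = l11 w" "Q = l12 w" "R = l21 w"
  define P' Q' R' where "P' = cnj (l11 w)" "Q' = cnj (l12 w)" "R' = cnj (l21 w)"
  have PQR: "P = 2 * x1 + 4 * \<i> * a * a'" "P' = 2 * x1 - 4 * \<i> * a * a'"
     "Q = ((1 - \<i>) * x3 + (1 + \<i>) * x2) + 4 * \<i> * a * b'" "Q' = ((1 + \<i>) * x3 + (1 - \<i>) * x2) - 4 * \<i> * b * a'"
     "R = ((1 + \<i>) * x3 + (1 - \<i>) * x2) + 4 * \<i> * b * a'" "R' = ((1 - \<i>) * x3 + (1 + \<i>) * x2) - 4 * \<i> * a * b'"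
    unfolding P_Q_R_def P'_Q'_R'_def l11_def l12_def l21_def
    by (simp_all add: w1 w2 w3 cnjs algebra_simps)
  \<comment> \<open>On the quadric the cubic terms of \<open>a * R - b * P\<close> cancel; what
    remains is \<open>y\<close>, which involves \<open>w\<close> only through its real part.\<close>
  define y y' where "y = a * ((1 + \<i>) * x3 + (1 - \<i>) * x2) - b * (2 * x1)"
    and "y' = a' * ((1 - \<i>) * x3 + (1 + \<i>) * x2) - b' * (2 * x1)"
  have Y: "a * R - b * P = y" "a' * R' - b' * P' = y'" "a * Q' - b * P' = y" "Q * a' - P * b' = y'"
    "8 * \<i> * a * a' = P - P'"
    unfolding PQR y_def y'_def by (simp_all add: algebra_simps)
  show "frechet_derivative (defining_fun forms) (at (z, w)) (coeff_z (z, w), coeff_w (z, w)) = 0"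
    unfolding tangent_iff
  proof
    fix j
    show "complex_of_real (Im (coeff_w (z, w) $ j)) = levi forms z (cv (coeff_z (z, w))) $ j + levi forms (coeff_z (z,
        w)) (cv z) $ j"
    proof (cases "j = j0")
      case False
      \<comment> \<open>The forms other than \<open>j0\<close> do not involve \<open>i3\<close> and
        \<open>i4\<close>, the only components of \<open>coeff_z\<close> that can be
        nonzero.\<close>
      obtain \<alpha> \<beta> where e: "e j = (\<alpha>, \<beta>)" by (cases "e j")
      then show ?thesis using e_range[OF False] False
        by (simp add: levi_herm_basis[OF False e] coeff_z_def coeff_w_def)
    next
      case True
      have L: "levi forms z (cv (coeff_z (z, w))) $ j0 = a * cnj (coeff_z (z, w) $ i3) + b * cnj (coeff_z (z, w) $ i4)"
      proof -
        have "levi forms z (cv (coeff_z (z, w))) $ j0 = (\<Sum>x\<in>UNIV. (if x = i3 then a * cnj (coeff_z (z,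
            w) $ x) else 0) + (if x = i4 then b * cnj (coeff_z (z, w) $ x) else 0))"
          unfolding levi_j0 by (intro sum.cong) (auto simp: coeff_z_def sw_def a_b_a'_b'_def)
        then show ?thesis by (simp add: sum.distrib)
      qed
      have R: "levi forms (coeff_z (z, w)) (cv z) $ j0 = coeff_z (z, w) $ i3 * a' + coeff_z (z, w) $ i4 * b'"
      proof -
        have "levi forms (coeff_z (z, w)) (cv z) $ j0 = (\<Sum>x\<in>UNIV. (if x = i1 then coeff_z (z,
            w) $ i3 * a' else 0) + (if x = i2 then coeff_z (z, w) $ i4 * b' else 0))"
          unfolding levi_j0 by (intro sum.cong) (auto simp: coeff_z_def sw_def a_b_a'_b'_def)
        then show ?thesis by (simp add: sum.distrib)
      qed
      define h0 where "h0 = coeff_w (z, w) $ j0"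
      have h0: "h0 = 2 * \<i> * P * (a * R - b * P)" by (simp add: h0_def coeff_w_def P_Q_R_def a_b_a'_b'_def)
      have "2 * \<i> * complex_of_real (Im h0) = h0 - cnj h0" by (simp add: complex_eq_iff)
      also have "\<dots> = 2 * \<i> * P * (a * R - b * P) - - 2 * \<i> * P' * (a' * R' - b' * P')"
        unfolding h0 by (simp add: P_Q_R_def P'_Q'_R'_def a_b_a'_b'_def)
      \<comment> \<open>The leading part of \<open>coeff_z\<close> contributes
        \<open>P' * y + P * y'\<close>, while \<open>P * y + P' * y'\<close> is required. The
        difference \<open>(P - P') * (y - y')\<close> is supplied by the terms with
        \<open>8 * \<i>\<close>.\<close>
      also have "\<dots> =
        2 * \<i> * (a * (Q' * P' - 8 * \<i> * a' * (a' * R' - b' * P')) - b * (P' * P')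
          + (Q * P + 8 * \<i> * a * (a * R - b * P)) * a' - P * P * b')"
      proof -
        have "a * (Q' * P' - 8 * \<i> * a' * (a' * R' - b' * P')) - b * (P' * P')
          + (Q * P + 8 * \<i> * a * (a * R - b * P)) * a' - P * P * b' =
          (a * Q' - b * P') * P' + (Q * a' - P * b') * P + (8 * \<i> * a * a') * ((a * R - b * P) - (a' * R' - b' * P'))"
          by (simp add: algebra_simps)
        also have "\<dots> = P * (a * R - b * P) + P' * (a' * R' - b' * P')"
          unfolding Y by (simp add: algebra_simps)
        finally have *: "a * (Q' * P' - 8 * \<i> * a' * (a' * R' - b' * P')) - b * (P' * P')
          + (Q * P + 8 * \<i> * a * (a * R - b * P)) * a' - P * P * b' =
          P * (a * R - b * P) + P' * (a' * R' - b' * P')" .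
        show ?thesis unfolding * by (simp add: distrib_left)
      qed
      also have "\<dots> = 2 * \<i> * (levi forms z (cv (coeff_z (z, w))) $ j0 + levi forms (coeff_z (z, w)) (cv z) $ j0)"
        unfolding L R by (simp add: coeff_z_def P_Q_R_def P'_Q'_R'_def a_b_a'_b'_def)
      finally show ?thesis unfolding True h0_def by simp
    qed
  qed
qed

lemma nonzero_component_example: "nonzero_component forms 3"
proof -
  let ?X = "\<lambda>p. (coeff_z p, coeff_w p)"
  have "?X \<in> aut_alg forms"
    unfolding aut_alg_def using vholomorphic_on_poly[OF vpolyf_example] tangent_example
    by (auto intro!: exI[of _ UNIV])
  then have X: "?X \<in> graded_component forms 3"
    unfolding graded_component_def using field_weight_example by blast
  have "\<not> zero_germ ?X"
  proof
    assume "zero_germ ?X"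
    then have z: "\<forall>\<^sub>F p in nhds 0. coeff_z p = 0"
      unfolding zero_germ_def by (rule eventually_mono) (simp add: zero_prod_def)
    \<comment> \<open>On this curve the component \<open>i4\<close> of \<open>coeff_z\<close> is
      \<open>- 4 t^2\<close>.\<close>
    have "((\<lambda>t::real. (0 :: complex^'n, t *\<^sub>R (axis j1 1 :: complex^'k))) \<longlongrightarrow> (0, 0 *\<^sub>R axis j1 1)) (at_right 0)"
      by (intro tendsto_intros)
    then have "\<forall>\<^sub>F t::real in at_right 0. coeff_z (0, t *\<^sub>R axis j1 1) = 0"
      using eventually_compose_filterlim[OF z] by (simp add: zero_prod_def)
    then have "\<forall>\<^sub>F t::real in at_right 0. t = 0"
    proof eventually_elim
      case (elim t)
      then have "coeff_z (0, t *\<^sub>R axis j1 1) $ i4 = 0" by simp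
      then show ?case by (simp add: coeff_z_def l11_def axis_def)
    qed
    moreover have "\<forall>\<^sub>F t::real in at_right 0. t > 0" by (rule eventually_at_right_less)
    ultimately have "\<forall>\<^sub>F t::real in at_right 0. False" by eventually_elim simp
    then show False by simp
  qed
  then show ?thesis unfolding nonzero_component_def using X by blast
qed

lemma exceptional_quadric_example: "exceptional_quadric forms"
proof -
  interpret levi_form forms by unfold_locales (rule nondegenerate_forms)
  show ?thesis by (rule exceptional_quadricI[OF nonzero_component_example])
qed

end

lemma obtain_distinct4:
  assumes "4 \<le> CARD('a::finite)"
  obtains a b c d :: "'a::finite" where "distinct [a, b, c, d]"
proof -
  obtain xs :: "'a list" where xs: "set xs = UNIV" "distinct xs" using finite_distinct_list[of "UNIV :: 'a set"] by auto
  then have "length xs \<ge> 4" using assms by (metis distinct_card)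
  then obtain a b c d ys where "xs = a # b # c # d # ys"
    by (auto simp: Suc_le_length_iff numeral_eq_Suc)
  then show ?thesis using that xs by auto
qed

text \<open>One index carries the form \<open>j0\<close>; the others receive distinct pairs among
  the \<open>(n - 2)^2\<close> pairs avoiding \<open>i3\<close> and \<open>i4\<close>, three of
  which are prescribed.\<close>

lemma exceptional_large:
  assumes n: "4 \<le> CARD('n::finite)" and k: "4 \<le> CARD('k::finite)" "CARD('k) \<le> (CARD('n) - 2)\<^sup>2 + 1"
  shows "exceptional_type TYPE('n) TYPE('k)"
proof -
  obtain i1 i2 i3 i4 :: 'n where i: "distinct [i1, i2, i3, i4]" using obtain_distinct4[OF n] by blast
  obtain j0 j1 j2 j3 :: 'k where j: "distinct [j0, j1, j2, j3]" using obtain_distinct4[OF k(1)] by blast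
  let ?S = "UNIV - {i3, i4}"
  let ?P = "{(i1, i1), (i1, i2), (i2, i1)}"
  let ?J = "UNIV - {j0, j1, j2, j3}"
  have cS: "card ?S = CARD('n) - 2" using i by (subst card_Diff_subset) auto
  have P: "?P \<subseteq> ?S \<times> ?S" "card ?P = 3" using i by auto
  have "card (?S \<times> ?S - ?P) = (CARD('n) - 2)\<^sup>2 - 3"
    using P by (subst card_Diff_subset) (auto simp: card_cartesian_product cS power2_eq_square)
  moreover have "card ?J = CARD('k) - 4" using j by (subst card_Diff_subset) auto
  ultimately have "card ?J \<le> card (?S \<times> ?S - ?P)" using k by simp
  then obtain g where g: "g ` ?J \<subseteq> ?S \<times> ?S - ?P" "inj_on g ?J"
    using card_le_inj[of ?J "?S \<times> ?S - ?P"] by auto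
  define e where "e = (\<lambda>j. if j = j1 then (i1, i1) else if j = j2 then (i1, i2) else if j = j3 then (i2, i1) else g j)"
  have gS: "g j \<in> ?S \<times> ?S" "g j \<notin> ?P" if "j \<in> ?J" for j using g(1) that by blast+
  interpret exceptional_example i1 i2 i3 i4 j0 j1 j2 j3 e
  proof unfold_locales
    show "distinct [i1, i2, i3, i4]" "distinct [j0, j1, j2, j3]" by fact+
    show "inj_on e (UNIV - {j0})"
    proof (rule inj_onI)
      fix x y assume A: "x \<in> UNIV - {j0}" "y \<in> UNIV - {j0}" "e x = e y"
      have gi: "g x = g y \<Longrightarrow> x = y" if "x \<in> ?J" "y \<in> ?J" using g(2) that by (auto dest: inj_onD)
      show "x = y" using A gi gS[of x] gS[of y] i by (auto simp: e_def split: if_splits)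
    qed
    show "fst (e j) \<notin> {i3, i4} \<and> snd (e j) \<notin> {i3, i4}" if "j \<noteq> j0" for j
      using gS(1)[of j] that i by (cases "g j") (auto simp: e_def)
  qed (use j in \<open>auto simp: e_def\<close>)
  show ?thesis unfolding exceptional_type_def using exceptional_quadric_example by blast
qed

theorem theorem8:
  "((CARD('n::finite), CARD('k::finite)) \<in>
      {(n, k) \<in> type_set. n \<le> 3} \<union> {(n, k) \<in> type_set. k \<le> 3} \<union>
      {(n, k) \<in> type_set. k \<ge> n\<^sup>2 - n} \<longrightarrow>
    nonexceptional_type TYPE('n) TYPE('k)) \<and>
   ((CARD('n), CARD('k)) \<in>
      {(n, k) \<in> type_set. 4 \<le> n \<and> 4 \<le> k \<and> k \<le> (n - 4)\<^sup>2 + 5} \<union> {(6, 10)} \<longrightarrow>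
    exceptional_type TYPE('n) TYPE('k))"
proof (intro conjI impI)
  assume "(CARD('n), CARD('k)) \<in>
      {(n, k) \<in> type_set. n \<le> 3} \<union> {(n, k) \<in> type_set. k \<le> 3} \<union>
      {(n, k) \<in> type_set. k \<ge> n\<^sup>2 - n}"
  then show "nonexceptional_type TYPE('n) TYPE('k)" by (intro nonexceptional_small) auto
next
  assume A: "(CARD('n), CARD('k)) \<in>
      {(n, k) \<in> type_set. 4 \<le> n \<and> 4 \<le> k \<and> k \<le> (n - 4)\<^sup>2 + 5} \<union> {(6, 10)}"
  show "exceptional_type TYPE('n) TYPE('k)"
  proof (rule exceptional_large)
    show "4 \<le> CARD('n)" "4 \<le> CARD('k)" using A by auto
    then obtain m where m: "CARD('n) = m + 4" using le_iff_add by (metis add.commute)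
    \<comment> \<open>With \<open>m = n - 4\<close> this is
      \<open>(n - 4)^2 + 5 \<le> (n - 2)^2 + 1\<close>; for the type \<open>(6, 10)\<close> the
      bound is 17.\<close>
    have "m\<^sup>2 + 5 \<le> (m + 2)\<^sup>2 + 1" by (simp add: power2_eq_square)
    then show "CARD('k) \<le> (CARD('n) - 2)\<^sup>2 + 1" using A m by auto
  qed
qed

end
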